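(* Let $\mathcal{H}$ be a real separable Hilbert space with $\dim\mathcal{H}=\infty$. Let $C_0$ be a self-adjoint, positive, trace class operator on $\mathcal{H}$ with $\ker(C_0)=\{0\}$, let $m_0\in\mathrm{Im}(C_0^{1/2})$, let $A:\mathcal{H}\to\mathbb{R}^n$ be a bounded linear operator, let $\Gamma$ be a symmetric positive definite $n\times n$ matrix and $y\in\mathbb{R}^n$. Define $$m=m_0+C_0A^*(\Gamma+AC_0A^* )^{-1}(y-Am_0),\qquad C=C_0-C_0A^*(\Gamma+AC_0A^* )^{-1}AC_0.$$ Then $$D_{\mathrm{KL}}(\mathcal{N}(m,C)\|\mathcal{N}(m_0,C_0))=\lim_{\gamma\to0^+}D^{\gamma}_{\mathrm{KL}}(\mathcal{N}(m,C)\|\mathcal{N}(m_0,C_0))$$ $$=\frac12\left[\log\det(\Gamma+AC_0A^* )-\log\det(\Gamma)-\mathrm{tr}(ACA^*\Gamma^{-1})-\langle m-m_0,A^*\Gamma^{-1}(Am-y)\rangle\right].$$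
   Context: $\mathcal{N}(a,K)$ denotes the Gaussian measure on $\mathcal{H}$ with mean $a$ and covariance operator $K$. For $B$ trace class and $c\neq0$, $\mathrm{tr}_X(B+cI)=\mathrm{tr}(B)+c$ and $\det_X(B+cI)=c\det(I+B/c)$ ($\det$ = Fredholm determinant). For $\gamma>0$ and self-adjoint positive trace class $C_1,C_2$, $d^1_{\mathrm{logdet}}[(C_1+\gamma I),(C_2+\gamma I)]=\mathrm{tr}_X[(C_2+\gamma I)^{-1}(C_1+\gamma I)-I]-\log\det_X[(C_2+\gamma I)^{-1}(C_1+\gamma I)]$ and $D^{\gamma}_{\mathrm{KL}}(\mathcal{N}(m_1,C_1)\|\mathcal{N}(m_2,C_2))=\frac12\langle m_1-m_2,(C_2+\gamma I)^{-1}(m_1-m_2)\rangle+\frac12d^1_{\mathrm{logdet}}[(C_1+\gamma I),(C_2+\gamma I)]$. The true Kullback-Leibler divergence is $D_{\mathrm{KL}}(\nu\|\mu)=\int\log\frac{d\nu}{d\mu}\,d\nu$. *)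

theory Defs
  imports "HOL-Analysis.Analysis" "HOL-Probability.Probability"
begin

definition selfadjoint_op :: "('a::real_inner \<Rightarrow> 'a) \<Rightarrow> bool" where
  "selfadjoint_op T \<longleftrightarrow> bounded_linear T \<and> (\<forall>x y. inner (T x) y = inner x (T y))"

definition positive_op :: "('a::real_inner \<Rightarrow> 'a) \<Rightarrow> bool" where
  "positive_op T \<longleftrightarrow> selfadjoint_op T \<and> (\<forall>x. 0 \<le> inner (T x) x)"

definition op_sqrt :: "('a::real_inner \<Rightarrow> 'a) \<Rightarrow> 'a \<Rightarrow> 'a" where
  "op_sqrt P = (THE S. positive_op S \<and> S \<circ> S = P)"

definition op_abs :: "('a::real_inner \<Rightarrow> 'a) \<Rightarrow> 'a \<Rightarrow> 'a" where
  "op_abs T = op_sqrt (adjoint T \<circ> T)"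

definition is_onb :: "(nat \<Rightarrow> 'a::real_inner) \<Rightarrow> bool" where
  "is_onb e \<longleftrightarrow> (\<forall>i j. inner (e i) (e j) = (if i = j then 1 else 0))
              \<and> closure (span (range e)) = UNIV"

definition onb :: "nat \<Rightarrow> 'a::real_inner" where
  "onb = (SOME e. is_onb e)"

definition trace_class :: "('a::real_inner \<Rightarrow> 'a) \<Rightarrow> bool" where
  "trace_class T \<longleftrightarrow> bounded_linear T \<and> summable (\<lambda>i. inner (op_abs T (onb i)) (onb i))"

text \<open>Trace of a trace class operator (independent of the orthonormal basis).\<close>
definition op_trace :: "('a::real_inner \<Rightarrow> 'a) \<Rightarrow> real" where
  "op_trace T = (\<Sum>i. inner (T (onb i)) (onb i))"

definition fin_det :: "nat \<Rightarrow> (nat \<Rightarrow> nat \<Rightarrow> real) \<Rightarrow> real" where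
  "fin_det n M = (\<Sum>p | p permutes {..<n}. of_int (sign p) * (\<Prod>i<n. M (p i) i))"

definition fredholm_det :: "('a::real_inner \<Rightarrow> 'a) \<Rightarrow> real" where
  "fredholm_det B = lim (\<lambda>n. fin_det n (\<lambda>i j. (if i = j then 1 else 0) + inner (B (onb j)) (onb i)))"

text \<open>Extended trace and extended determinant of B + c I (B trace class, c \<noteq> 0).\<close>
definition trX :: "('a::real_inner \<Rightarrow> 'a) \<Rightarrow> real \<Rightarrow> real" where
  "trX B c = op_trace B + c"

definition detX :: "('a::real_inner \<Rightarrow> 'a) \<Rightarrow> real \<Rightarrow> real" where
  "detX B c = c * fredholm_det (\<lambda>x. (1 / c) *\<^sub>R B x)"

text \<open>d^1_logdet[(C1 + gamma I), (C2 + gamma I)].  Writing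
  (C2 + gamma I)^{-1}(C1 + gamma I) = B + I with B = (C2 + gamma I)^{-1}(C1 - C2) trace class,
  the first term is tr_X[B + 0 I] = tr(B) and the second is log det_X[B + 1 I].\<close>
definition d1_logdet :: "('a::real_inner \<Rightarrow> 'a) \<Rightarrow> ('a \<Rightarrow> 'a) \<Rightarrow> real \<Rightarrow> real" where
  "d1_logdet C1 C2 \<gamma> =
     (let R = inv (\<lambda>x. C2 x + \<gamma> *\<^sub>R x);
          B = (\<lambda>x. R (C1 x - C2 x))
      in op_trace B - ln (detX B 1))"

definition KL_gamma :: "real \<Rightarrow> 'a::real_inner \<Rightarrow> ('a \<Rightarrow> 'a) \<Rightarrow> 'a \<Rightarrow> ('a \<Rightarrow> 'a) \<Rightarrow> real" where
  "KL_gamma \<gamma> m1 C1 m2 C2 =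
     1/2 * inner (m1 - m2) (inv (\<lambda>x. C2 x + \<gamma> *\<^sub>R x) (m1 - m2)) + 1/2 * d1_logdet C1 C2 \<gamma>"

definition is_gaussian :: "'a::real_inner measure \<Rightarrow> 'a \<Rightarrow> ('a \<Rightarrow> 'a) \<Rightarrow> bool" where
  "is_gaussian \<mu> a K \<longleftrightarrow> sets \<mu> = sets borel \<and> prob_space \<mu> \<and>
     (\<forall>h. distr \<mu> borel (\<lambda>x. inner h x) =
        (if inner (K h) h = 0 then return borel (inner h a)
         else density lborel (normal_density (inner h a) (sqrt (inner (K h) h)))))"

definition gaussian :: "'a::real_inner \<Rightarrow> ('a \<Rightarrow> 'a) \<Rightarrow> 'a measure" where
  "gaussian a K = (THE \<mu>. is_gaussian \<mu> a K)"

text \<open>True KL divergence D_KL(nu || mu) = integral of log(d nu / d mu) d nu.\<close>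
definition D_KL :: "'a measure \<Rightarrow> 'a measure \<Rightarrow> real" where
  "D_KL \<nu> \<mu> = KL_divergence (exp 1) \<mu> \<nu>"

end

theory Submission
  imports "Jordan_Normal_Form.Determinant" Defs
begin

text \<open>
  Choose a basis \<open>u\<^sub>j\<close> of the data space that is orthonormal for \<open>\<Gamma>\<close> and diagonalises \<open>A C\<^sub>0 A\<^sup>*\<close> with eigenvalues \<open>g\<^sub>j\<close>,
  and put \<open>a\<^sub>j = A\<^sup>* u\<^sub>j\<close>.  The observation then splits into scalar observations of the functionals \<open>\<langle>a\<^sub>j, x\<rangle>\<close> with unit
  noise, and the \<open>a\<^sub>j\<close> are \<open>C\<^sub>0\<close>-orthogonal.  Multiplying the prior by one scalar likelihood after the other keeps it
  Gaussian, as one sees on characteristic functionals, and ends at \<open>N(m, C)\<close>; so the logarithm of \<open>dN(m, C)/dN(m\<^sub>0, C\<^sub>0)\<close> is an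
  explicit quadratic function of the \<open>\<langle>a\<^sub>j, x\<rangle>\<close>, and its \<open>N(m, C)\<close>-mean only needs second moments.  On the
  regularised side \<open>C - C\<^sub>0\<close> has finite rank, so the Fredholm determinant is by Sylvester's identity a determinant of the numbers
  \<open>\<langle>C\<^sub>0 a\<^sub>j, (C\<^sub>0 + \<gamma>)\<^sup>-\<^sup>1 C\<^sub>0 a\<^sub>k\<rangle>\<close>, which tend to \<open>\<langle>C\<^sub>0 a\<^sub>j, a\<^sub>k\<rangle>\<close>.  With \<open>s\<^sub>j = \<langle>u\<^sub>j, y - A m\<^sub>0\<rangle>\<close> all
  three quantities equal half the sum of \<open>ln (1 + g\<^sub>j) - g\<^sub>j / (1 + g\<^sub>j) + g\<^sub>j s\<^sub>j\<^sup>2 / (1 + g\<^sub>j)\<^sup>2\<close>.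
\<close>

hide_const (open) Determinant.det Matrix.mat Matrix.vec Matrix.row Matrix.col
hide_type (open) Matrix.vec Matrix.mat
no_notation scalar_prod (infix \<open>\<bullet>\<close> 70)
no_notation vec_index (infixl \<open>$\<close> 100)

section \<open>Positive operators\<close>

text \<open>\<open>gaussian\<close> and \<open>op_sqrt\<close> are definite descriptions,
  \<open>onb\<close> and \<open>adjoint\<close> are choices, so each must be pinned down before
  anything can be computed. For \<open>op_abs C0\<close> the operator \<open>C0\<close> is its own
  witness, and uniqueness of positive roots identifies it. For \<open>gaussian\<close> the prior is
  built from independent normals, the posterior arises as a density of the prior, and uniqueness is
  reduced to real-valued marginals. The analytic obstacle is that the inverse of
  \<open>C0 + \<gamma> I\<close> can blow up as \<gamma> tends to 0. It only ever acts between
  vectors \<open>C0 a\<close>, because both the mean shift and the range of \<open>C - C0\<close>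
  lie in the span of the \<open>C0 a\<^sub>j\<close>; there the resolvent forms differ from their
  limits by O(\<gamma>). Unit noise and \<open>C0\<close>-orthogonality decouple the updates: a
  later observation still sees the prior mean and the prior variance along its own direction. Hence
  every formula involves only the prior quantities \<open>g\<^sub>j\<close> and
  \<open>s\<^sub>j\<close>, and the matrices enter through determinant, trace and inverse, each read
  off in the basis \<open>u\<^sub>j\<close>.\<close>

lemma positive_op_simps:
  assumes "positive_op T"
  shows positive_op_bounded_linear: "bounded_linear T"
    and positive_op_linear: "linear T"
    and positive_op_sym: "inner (T x) y = inner x (T y)"
    and positive_op_nonneg: "0 \<le> inner (T x) x"
  using assms by (auto simp: positive_op_def selfadjoint_op_def bounded_linear.linear)

text \<open>Nonnegativity of the form on all combinations of \<open>x\<close> and \<open>y\<close>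
  is a discriminant condition. The form may be degenerate, so \<open>a = 0\<close> is treated
  separately.\<close>

lemma positive_op_cauchy_schwarz:
  assumes T: "positive_op T"
  shows "(inner (T x) y)\<^sup>2 \<le> inner (T x) x * inner (T y) y"
proof -
  interpret T: bounded_linear T using T by (rule positive_op_bounded_linear)
  define a b c where "a = inner (T x) x" and "b = inner (T x) y" and "c = inner (T y) y"
  have ac: "a \<ge> 0" "c \<ge> 0" by (simp_all add: a_def c_def positive_op_nonneg[OF T])
  have yx: "inner (T y) x = b"
    unfolding b_def by (metis T inner_commute positive_op_sym)
  have q: "0 \<le> s\<^sup>2 * a + 2 * s * t * b + t\<^sup>2 * c" for s t
  proof -
    have "0 \<le> inner (T (s *\<^sub>R x + t *\<^sub>R y)) (s *\<^sub>R x + t *\<^sub>R y)" by (rule positive_op_nonneg[OF T])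
    also have "\<dots> = s\<^sup>2 * a + 2 * s * t * b + t\<^sup>2 * c"
      by (simp add: T.add T.scale inner_add_left inner_add_right yx a_def[symmetric] b_def[symmetric] c_def[symmetric]
          power2_eq_square algebra_simps)
    finally show ?thesis .
  qed
  have "b\<^sup>2 \<le> a * c"
  proof (cases "a = 0")
    case True
    \<comment> \<open>With \<open>a = 0\<close> the form is linear in \<open>s\<close>; the weight
      \<open>c + 1\<close> makes the negative term outweigh \<open>t\<^sup>2 * c\<close> and leaves
      \<open>-(c + 2) * b\<^sup>2\<close>.\<close>
    have "0 \<le> 2 * (-(c + 1) * b) * b + b\<^sup>2 * c" using q[of "-(c+1)" b] True
      by (simp add: algebra_simps power2_eq_square)
    then have "(c + 2) * b\<^sup>2 \<le> 0" by (simp add: algebra_simps power2_eq_square)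
    then have "b\<^sup>2 \<le> 0" using ac by (simp add: mult_le_0_iff)
    then show ?thesis using True by simp
  next
    case False
    then have "a > 0" using ac by simp
    have "0 \<le> a * (a * c - b\<^sup>2)" using q[of "-b" a] by (simp add: algebra_simps power2_eq_square)
    then show ?thesis using \<open>a > 0\<close> by (simp add: zero_le_mult_iff)
  qed
  then show ?thesis by (simp add: a_def b_def c_def)
qed

text \<open>Cauchy-Schwarz with \<open>y = T x\<close> bounds the fourth power of
  \<open>norm (T x)\<close>, and one factor \<open>(norm (T x))\<^sup>2\<close> cancels. In operator
  terms, \<open>T \<circ> T\<close> lies below \<open>L T\<close>.\<close>

lemma positive_op_norm_sq_le:
  assumes T: "positive_op T" and L: "\<And>x. norm (T x) \<le> L * norm x"
  shows "(norm (T x))\<^sup>2 \<le> L * inner (T x) x"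
proof (cases "T x = 0")
  case True then show ?thesis by simp
next
  case False
  define n where "n = (norm (T x))\<^sup>2"
  have n: "n > 0" using False by (simp add: n_def)
  have "n\<^sup>2 \<le> inner (T x) x * inner (T (T x)) (T x)"
    using positive_op_cauchy_schwarz[OF T, of x "T x"] by (simp add: n_def power2_norm_eq_inner)
  also have "inner (T (T x)) (T x) \<le> L * n"
  proof -
    have "inner (T (T x)) (T x) \<le> norm (T (T x)) * norm (T x)" by (rule norm_cauchy_schwarz)
    also have "\<dots> \<le> (L * norm (T x)) * norm (T x)" by (intro mult_right_mono L) simp
    finally show ?thesis by (simp add: n_def power2_eq_square)
  qed
  finally have "n\<^sup>2 \<le> inner (T x) x * (L * n)"
    using positive_op_nonneg[OF T, of x] by (simp add: mult_left_mono)
  then have "n * n \<le> (L * inner (T x) x) * n" by (simp add: power2_eq_square algebra_simps)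
  then show ?thesis using n by (simp add: n_def[symmetric])
qed

text \<open>After expanding the square, the preceding bound absorbs
  \<open>(norm (T x))\<^sup>2\<close> into the cross term. The estimate serves twice: it keeps the
  iterates in the square root argument bounded, and it gives the contraction that inverts
  \<open>T + \<gamma> I\<close>.\<close>

lemma positive_op_contraction:
  assumes T: "positive_op T" and L: "\<And>x. norm (T x) \<le> L * norm x" "L \<ge> 0"
  shows "norm (L *\<^sub>R x - T x) \<le> L * norm x"
proof (rule power2_le_imp_le)
  have "(norm (L *\<^sub>R x - T x))\<^sup>2 = L\<^sup>2 * (norm x)\<^sup>2 - 2 * L * inner (T x) x + (norm (T x))\<^sup>2"
    by (simp add: power2_norm_eq_inner inner_diff_left inner_diff_right inner_commute power2_eq_square[of L] algebra_simps)
  also have "\<dots> \<le> L\<^sup>2 * (norm x)\<^sup>2 - 2 * L * inner (T x) x + L * inner (T x) x"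
    using positive_op_norm_sq_le[OF T L(1), of x] by simp
  also have "\<dots> \<le> L\<^sup>2 * (norm x)\<^sup>2"
    using positive_op_nonneg[OF T, of x] L(2) by simp
  finally show "(norm (L *\<^sub>R x - T x))\<^sup>2 \<le> (L * norm x)\<^sup>2" by (simp add: power_mult_distrib)
qed (use L in simp)

lemma positive_op_eq_0:
  assumes T: "positive_op T" and "inner (T x) x = 0"
  shows "T x = 0"
proof -
  have "(inner (T x) (T x))\<^sup>2 \<le> 0"
    using positive_op_cauchy_schwarz[OF T, of x "T x"] assms(2) by simp
  then show ?thesis by simp
qed

text \<open>With \<open>D = S - T\<close> one has \<open>S D = - D T\<close>, hence \<open>(L + S)^n D = D (L - T)^n\<close>.  For \<open>L\<close> at least the
  norm of \<open>T\<close> the right-hand side grows at most like \<open>L^n\<close>, whereas the left-hand side grows faster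
  unless \<open>S D = 0\<close>.\<close>

lemma positive_sqrt_difference:
  assumes S: "positive_op S" and T: "positive_op T" and eq: "S \<circ> S = T \<circ> T"
  shows "S (S x - T x) = 0"
proof -
  interpret S: bounded_linear S using S by (rule positive_op_bounded_linear)
  interpret T: bounded_linear T using T by (rule positive_op_bounded_linear)
  define D where "D = (\<lambda>x. S x - T x)"
  interpret D: bounded_linear D unfolding D_def by (intro bounded_linear_sub S.bounded_linear_axioms T.bounded_linear_axioms)
  obtain L where L: "L > 0" "\<And>x. norm (T x) \<le> norm x * L" using T.pos_bounded by blast
  obtain B where B: "B > 0" "\<And>x. norm (D x) \<le> norm x * B" using D.pos_bounded by blast
  have SS: "S (S x) = T (T x)" for x using eq by (metis comp_apply)
  have SD: "S (D x) = - D (T x)" for x by (simp add: D_def S.diff SS)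
  define p where "p n = ((\<lambda>v. v - (1/L) *\<^sub>R T v) ^^ n) x" for n
  have pS: "p (Suc n) = p n - (1/L) *\<^sub>R T (p n)" for n by (simp add: p_def)
  have pn: "norm (p n) \<le> norm x" for n
  proof (induction n)
    case (Suc n)
    have "norm (p (Suc n)) = norm ((1/L) *\<^sub>R (L *\<^sub>R p n - T (p n)))"
      using L(1) by (simp add: pS scaleR_diff_right)
    also have "\<dots> \<le> (1/L) * (L * norm (p n))"
      unfolding norm_scaleR using positive_op_contraction[OF T, of L "p n"] L
      by (intro mult_mono) (auto simp: mult.commute)
    also have "\<dots> = norm (p n)" using L(1) by simp
    finally show ?case using Suc by simp
  qed (simp add: p_def)
  define q where "q n = D (p n)" for n
  have qS: "q (Suc n) = q n + (1/L) *\<^sub>R S (q n)" for n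
    by (simp add: q_def pS D.diff D.scale SD)
  have q_bd: "norm (q n) \<le> norm x * B" for n
    unfolding q_def using B(2)[of "p n"] pn[of n] B(1) by (meson mult_right_mono less_imp_le order_trans)
  \<comment> \<open>\<open>q n\<close> is \<open>I + S / L\<close> applied \<open>n\<close> times to
    \<open>D x\<close>. Each application adds at least \<open>2 / L * \<delta> n\<close> to the
    squared norm and does not decrease \<open>\<delta>\<close>, so \<open>\<delta> 0 > 0\<close>
    would give linear growth, against the bound on \<open>q\<close>.\<close>
  define \<delta> where "\<delta> n = inner (S (q n)) (q n)" for n
  have mono: "\<delta> 0 \<le> \<delta> n" for n
  proof (induction n)
    case (Suc n)
    have "\<delta> (Suc n) = \<delta> n + 2 / L * (norm (S (q n)))\<^sup>2 + inner (S (S (q n))) (S (q n)) / L\<^sup>2"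
      using positive_op_sym[OF S, of "S (q n)" "q n"]
      by (simp add: \<delta>_def qS S.add S.scale inner_add_left inner_add_right inner_commute power2_norm_eq_inner
            power2_eq_square[of L] field_simps)
    also have "\<dots> \<ge> \<delta> n" using L(1) positive_op_nonneg[OF S, of "S (q n)"] by simp
    finally show ?case using Suc by simp
  qed simp
  have grow: "(norm (q n))\<^sup>2 \<ge> 2 / L * \<delta> 0 * n" for n
  proof (induction n)
    case (Suc n)
    have "(norm (q (Suc n)))\<^sup>2 = (norm (q n))\<^sup>2 + 2 / L * \<delta> n + (norm (S (q n)))\<^sup>2 / L\<^sup>2"
      by (simp add: \<delta>_def qS inner_add_left inner_add_right inner_commute power2_norm_eq_inner power2_eq_square[of L]
         field_simps)
    also have "\<dots> \<ge> 2 / L * \<delta> 0 * n + 2 / L * \<delta> 0"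
      using Suc mono[of n] L(1)
      by (intro order_trans[OF add_mono[OF Suc mult_left_mono[OF mono[of n]]]]) auto
    finally show ?case by (simp add: algebra_simps add_divide_distrib)
  qed simp
  have "\<delta> 0 = 0"
  proof (rule ccontr)
    assume "\<delta> 0 \<noteq> 0"
    then have "\<delta> 0 > 0" using positive_op_nonneg[OF S, of "q 0"] by (simp add: \<delta>_def)
    then have c: "2 / L * \<delta> 0 > 0" using L(1) by simp
    obtain n where n: "(norm x * B)\<^sup>2 < real n * (2 / L * \<delta> 0)" using reals_Archimedean3[OF c] by blast
    have "(norm (q n))\<^sup>2 \<le> (norm x * B)\<^sup>2" using q_bd[of n] by (intro power_mono) auto
    then show False using grow[of n] n by (simp add: mult.commute)
  qed
  then have "S (q 0) = 0" unfolding \<delta>_def by (rule positive_op_eq_0[OF S])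
  then show ?thesis by (simp add: q_def p_def D_def)
qed

text \<open>The previous lemma, used in both orders, shows that \<open>S\<close> and
  \<open>T\<close> both annihilate \<open>S x - T x\<close>; moving \<open>S - T\<close> across the
  inner product then makes its norm zero.\<close>

lemma positive_sqrt_unique:
  assumes S: "positive_op S" and T: "positive_op T" and eq: "S \<circ> S = T \<circ> T"
  shows "S = T"
proof
  fix x
  have l: "linear S" "linear T" by (simp_all add: positive_op_linear S T)
  have 1: "S (S x - T x) = 0" by (rule positive_sqrt_difference[OF S T eq])
  have "T (T x - S x) = 0" by (rule positive_sqrt_difference[OF T S eq[symmetric]])
  then have 2: "T (S x - T x) = 0" using l by (simp add: linear_diff)
  have "inner (S x - T x) (S x - T x) = inner x (S (S x - T x) - T (S x - T x))"
    by (simp add: inner_diff_left inner_diff_right positive_op_sym[OF S] positive_op_sym[OF T]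
        linear_diff[OF l(1)] linear_diff[OF l(2)])
  then show "S x = T x" using 1 2 by simp
qed

text \<open>\<open>T\<close> is self-adjoint, hence a positive square root of
  \<open>adjoint T \<circ> T\<close>, and it is the only one. This turns the trace class hypothesis
  on \<open>C0\<close> into summability of its diagonal.\<close>

lemma op_abs_positive:
  assumes T: "positive_op T"
  shows "op_abs T = T"
proof -
  have "adjoint T = T" by (rule adjoint_unique) (use positive_op_sym[OF T] in blast)
  then show ?thesis
    unfolding op_abs_def op_sqrt_def using T positive_sqrt_unique by (intro the_equality) auto
qed

section \<open>Resolvents of positive operators\<close>

context
  fixes T :: "'a::{real_inner,complete_space} \<Rightarrow> 'a" and \<gamma> :: real
  assumes T: "positive_op T" and \<gamma>: "\<gamma> > 0"
begin

lemma regularized_norm_ge: "\<gamma> * norm x \<le> norm (T x + \<gamma> *\<^sub>R x)"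
proof (cases "x = 0")
  case False
  have "\<gamma> * norm x * norm x \<le> inner (T x + \<gamma> *\<^sub>R x) x"
    using positive_op_nonneg[OF T, of x]
    by (simp add: inner_add_left power2_norm_eq_inner[symmetric] power2_eq_square)
  also have "\<dots> \<le> norm (T x + \<gamma> *\<^sub>R x) * norm x" by (rule norm_cauchy_schwarz)
  finally show ?thesis using False by simp
qed simp

lemma regularized_bij: "bij (\<lambda>x. T x + \<gamma> *\<^sub>R x)"
proof (rule bijI)
  interpret T: bounded_linear T using T by (rule positive_op_bounded_linear)
  show "inj (\<lambda>x. T x + \<gamma> *\<^sub>R x)"
  proof (rule injI)
    fix x y assume "T x + \<gamma> *\<^sub>R x = T y + \<gamma> *\<^sub>R y"
    then have "T (x - y) + \<gamma> *\<^sub>R (x - y) = 0" by (simp add: T.diff algebra_simps)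
    then have "\<gamma> * norm (x - y) \<le> 0" using regularized_norm_ge[of "x - y"] by simp
    then show "x = y" using \<gamma> by (simp add: mult_le_0_iff)
  qed
  show "surj (\<lambda>x. T x + \<gamma> *\<^sub>R x)"
      unfolding surj_def
  proof
    fix z
    obtain L where L: "L > 0" "\<And>x. norm (T x) \<le> norm x * L" using T.pos_bounded by blast
    \<comment> \<open>A solution of \<open>T x + \<gamma> *\<^sub>R x = z\<close> is a fixed point
      of \<open>f\<close>: adding \<open>L *\<^sub>R x\<close> to both sides produces
      \<open>L - T\<close>, of norm at most \<open>L\<close>, whence the factor
      \<open>L / (L + \<gamma>)\<close>.\<close>
    define f where "f x = (1 / (L + \<gamma>)) *\<^sub>R (L *\<^sub>R x - T x + z)" for x
    have "\<exists>!x. x \<in> UNIV \<and> f x = x"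
    proof (rule Banach_fix)
      show "Topological_Spaces.complete (UNIV :: 'a set)" by (rule complete_UNIV)
      show "0 \<le> L / (L + \<gamma>)" "L / (L + \<gamma>) < 1" using L(1) \<gamma> by auto
      fix x y
      have "f x - f y = (1 / (L + \<gamma>)) *\<^sub>R (L *\<^sub>R (x - y) - T (x - y))"
        by (simp add: f_def T.diff algebra_simps)
      then have "dist (f x) (f y) = 1 / (L + \<gamma>) * norm (L *\<^sub>R (x - y) - T (x - y))"
        using L(1) \<gamma> by (simp add: dist_norm)
      also have "\<dots> \<le> 1 / (L + \<gamma>) * (L * norm (x - y))"
        using L \<gamma> by (intro mult_left_mono positive_op_contraction[OF T]) (auto simp: mult.commute)
      finally show "dist (f x) (f y) \<le> L / (L + \<gamma>) * dist x y" by (simp add: dist_norm)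
    qed auto
    then obtain x where x: "f x = x" by blast
    have "(L + \<gamma>) *\<^sub>R x = L *\<^sub>R x - T x + z"
      using arg_cong[OF x, of "\<lambda>u. (L + \<gamma>) *\<^sub>R u"] L(1) \<gamma> by (simp add: f_def)
    then have "z = T x + \<gamma> *\<^sub>R x" by (simp add: algebra_simps)
    then show "\<exists>x. z = T x + \<gamma> *\<^sub>R x" by blast
  qed
qed

lemma resolvent_right: "T (inv_into UNIV (\<lambda>x. T x + \<gamma> *\<^sub>R x) z) + \<gamma> *\<^sub>R inv_into UNIV (\<lambda>x. T x + \<gamma> *\<^sub>R x) z = z"
  using surj_f_inv_f[OF bij_is_surj[OF regularized_bij]] .

lemma resolvent_left: "inv_into UNIV (\<lambda>x. T x + \<gamma> *\<^sub>R x) (T x + \<gamma> *\<^sub>R x) = x"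
  using inv_f_f[OF bij_is_inj[OF regularized_bij]] .

lemma resolvent_linear: "linear (inv_into UNIV (\<lambda>x. T x + \<gamma> *\<^sub>R x))" (is "linear ?R")
proof -
  have T': "linear T" by (rule positive_op_linear[OF T])
  have inj: "x = y" if "T x + \<gamma> *\<^sub>R x = T y + \<gamma> *\<^sub>R y" for x y
    using injD[OF bij_is_inj[OF regularized_bij], of x y] that by blast
  show ?thesis
  proof (rule linearI)
    fix x y
    have "T (?R x + ?R y) + \<gamma> *\<^sub>R (?R x + ?R y) = x + y"
      using resolvent_right[of x] resolvent_right[of y] T' by (simp add: linear_add algebra_simps)
    then show "?R (x + y) = ?R x + ?R y" using resolvent_right[of "x + y"] by (rule inj[OF trans[OF _ sym], rotated])
  next
    fix c x
    have "T (c *\<^sub>R ?R x) + \<gamma> *\<^sub>R (c *\<^sub>R ?R x) = c *\<^sub>R (T (?R x) + \<gamma> *\<^sub>R ?R x)"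
      using T' by (simp add: linear_scale algebra_simps)
    also have "\<dots> = c *\<^sub>R x" by (simp only: resolvent_right)
    finally show "?R (c *\<^sub>R x) = c *\<^sub>R ?R x" using resolvent_right[of "c *\<^sub>R x"] by (rule inj[OF trans[OF _ sym], rotated])
  qed
qed

text \<open>The resolvent \<open>R\<close> alone may have norm \<open>1 / \<gamma>\<close>. The
  \<open>T\<close> in front of \<open>b\<close> gives
  \<open>R (T b) = b - \<gamma> *\<^sub>R R b\<close>, and the other \<open>T\<close>, moved off
  \<open>a\<close>, turns the error into \<gamma> times a form in \<open>T (R b)\<close>, whose norm
  is at most \<open>2 * norm b\<close> for every \<gamma>.\<close>

lemma resolvent_form_bound:
  "\<bar>inner (T a) (inv_into UNIV (\<lambda>x. T x + \<gamma> *\<^sub>R x) (T b)) - inner (T a) b\<bar> \<le> \<gamma> * (2 * norm a * norm b)"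
proof -
  let ?R = "inv_into UNIV (\<lambda>x. T x + \<gamma> *\<^sub>R x)"
  have 1: "?R (T b) = b - \<gamma> *\<^sub>R ?R b"
    using resolvent_left[of b]
    by (simp only: linear_add[OF resolvent_linear] linear_scale[OF resolvent_linear] eq_diff_eq)
  have 2: "norm (\<gamma> *\<^sub>R ?R b) \<le> norm b"
    using regularized_norm_ge[of "?R b"] \<gamma> by (simp add: resolvent_right)
  have "norm (T (?R b)) \<le> norm b + norm (\<gamma> *\<^sub>R ?R b)"
  proof -
    have "T (?R b) = b - \<gamma> *\<^sub>R ?R b" using resolvent_right[of b] by (simp only: eq_diff_eq)
    then show ?thesis by (simp only: norm_triangle_ineq4)
  qed
  then have 3: "norm (T (?R b)) \<le> 2 * norm b" using 2 by simp
  have "inner (T a) (?R (T b)) - inner (T a) b = - \<gamma> * inner a (T (?R b))"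
    by (simp add: 1 inner_diff_right positive_op_sym[OF T])
  then have "\<bar>inner (T a) (?R (T b)) - inner (T a) b\<bar> = \<gamma> * \<bar>inner a (T (?R b))\<bar>"
    using \<gamma> by (simp add: abs_mult)
  also have "\<dots> \<le> \<gamma> * (norm a * norm (T (?R b)))"
    using \<gamma> by (intro mult_left_mono Cauchy_Schwarz_ineq2) auto
  also have "\<dots> \<le> \<gamma> * (norm a * (2 * norm b))"
    using \<gamma> 3 by (intro mult_left_mono) auto
  finally show ?thesis by (simp add: algebra_simps)
qed

end

lemma resolvent_form_tendsto:
  fixes T :: "'a::{real_inner,complete_space} \<Rightarrow> 'a"
  assumes T: "positive_op T"
  shows "((\<lambda>\<gamma>. inner (T a) (inv_into UNIV (\<lambda>x. T x + \<gamma> *\<^sub>R x) (T b))) \<longlongrightarrow> inner (T a) b) (at_right 0)"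
proof -
  have "((\<lambda>\<gamma>. \<gamma> * (2 * norm a * norm b)) \<longlongrightarrow> 0 * (2 * norm a * norm b)) (at_right 0)"
    by (intro tendsto_intros)
  then have "((\<lambda>\<gamma>. \<gamma> * (2 * norm a * norm b)) \<longlongrightarrow> 0) (at_right 0)" by simp
  then have "((\<lambda>\<gamma>. inner (T a) (inv_into UNIV (\<lambda>x. T x + \<gamma> *\<^sub>R x) (T b)) - inner (T a) b) \<longlongrightarrow> 0) (at_right 0)"
  proof (rule Lim_null_comparison[rotated])
    show "\<forall>\<^sub>F \<gamma> in at_right 0. norm (inner (T a) (inv_into UNIV (\<lambda>x. T x + \<gamma> *\<^sub>R x) (T b)) - inner (T a) b)
        \<le> \<gamma> * (2 * norm a * norm b)"
      using resolvent_form_bound[OF T] by (auto simp: eventually_at_right_less eventually_at_filter)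
  qed
  then show ?thesis by (rule LIM_zero_cancel)
qed

section \<open>Orthonormal bases\<close>

text \<open>Orthonormalisation for the form \<open>inner (K x) y\<close>: the identity as
  \<open>K\<close> gives the usual process, a covariance operator gives a Cholesky factorisation. A
  vanishing residual becomes the vector \<open>0\<close>, so the indices of \<open>d\<close> are
  kept.\<close>

fun gram_schmidt :: "('a::real_inner \<Rightarrow> 'a) \<Rightarrow> (nat \<Rightarrow> 'a) \<Rightarrow> nat \<Rightarrow> 'a" where
  "gram_schmidt K d n =
     (let r = d n - (\<Sum>j<n. inner (K (d n)) (gram_schmidt K d j) *\<^sub>R gram_schmidt K d j)
      in (1 / sqrt (inner (K r) r)) *\<^sub>R r)"

declare gram_schmidt.simps [simp del]

context
  fixes K :: "'a::real_inner \<Rightarrow> 'a" and d w :: "nat \<Rightarrow> 'a"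
  assumes K: "positive_op K" and ker: "\<And>x. K x = 0 \<Longrightarrow> x = 0"
  defines "w \<equiv> gram_schmidt K d"
begin

lemma gram_schmidt_residual:
  obtains r where "r = d n - (\<Sum>j<n. inner (K (d n)) (w j) *\<^sub>R w j)"
    and "w n = (1 / sqrt (inner (K r) r)) *\<^sub>R r" and "r = sqrt (inner (K r) r) *\<^sub>R w n"
proof -
  define r where "r = d n - (\<Sum>j<n. inner (K (d n)) (w j) *\<^sub>R w j)"
  have w: "w n = (1 / sqrt (inner (K r) r)) *\<^sub>R r"
    unfolding w_def r_def by (subst gram_schmidt.simps) (simp add: Let_def)
  \<comment> \<open>Injectivity of \<open>K\<close> enters here: a residual of zero
    \<open>K\<close>-length vanishes, so it is recovered from \<open>w n\<close> in the degenerate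
    case too.\<close>
  have "r = 0" if "inner (K r) r = 0" using positive_op_eq_0[OF K that] ker by blast
  then have "r = sqrt (inner (K r) r) *\<^sub>R w n" by (cases "inner (K r) r = 0") (auto simp: w)
  then show ?thesis using that r_def w by blast
qed

lemma gram_schmidt_normalized: "w n = 0 \<or> inner (K (w n)) (w n) = 1"
proof -
  obtain r where r: "w n = (1 / sqrt (inner (K r) r)) *\<^sub>R r" by (rule gram_schmidt_residual[of n])
  have "inner (K r) r \<ge> 0" by (rule positive_op_nonneg[OF K])
  then show ?thesis
    by (cases "inner (K r) r = 0") (auto simp: r linear_scale[OF positive_op_linear[OF K]])
qed

lemma gram_schmidt_orthogonal_less: "i < n \<Longrightarrow> inner (K (w n)) (w i) = 0"
proof (induction n arbitrary: i rule: less_induct)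
  case (less n)
  have orth: "inner (K (w j)) (w i) = 0" if "j < n" "j \<noteq> i" for j
    using less.IH[of j i] less.IH[of i j] less.prems that positive_op_sym[OF K, of "w j" "w i"]
    by (cases "j < i") (auto simp: inner_commute)
  obtain r where r: "r = d n - (\<Sum>j<n. inner (K (d n)) (w j) *\<^sub>R w j)"
    "w n = (1 / sqrt (inner (K r) r)) *\<^sub>R r" by (rule gram_schmidt_residual[of n])
  have "inner (K r) (w i) = inner (K (d n)) (w i) - (\<Sum>j<n. inner (K (d n)) (w j) * inner (K (w j)) (w i))"
    unfolding r(1) by (simp add: linear_diff[OF positive_op_linear[OF K]] linear_sum[OF positive_op_linear[OF K]]
        linear_scale[OF positive_op_linear[OF K]] inner_diff_left inner_sum_left)
  also have "(\<Sum>j<n. inner (K (d n)) (w j) * inner (K (w j)) (w i))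
      = (\<Sum>j<n. if j = i then inner (K (d n)) (w i) * inner (K (w i)) (w i) else 0)"
    by (intro sum.cong) (auto simp: orth)
  also have "\<dots> = inner (K (d n)) (w i) * inner (K (w i)) (w i)" using less.prems by (simp add: sum.delta)
  finally have "inner (K r) (w i) = 0" using gram_schmidt_normalized[of i] by auto
  then show ?case by (simp add: r(2) linear_scale[OF positive_op_linear[OF K]])
qed

lemma gram_schmidt_orthogonal: "i \<noteq> j \<Longrightarrow> inner (K (w i)) (w j) = 0"
proof -
  assume "i \<noteq> j"
  moreover have "inner (K (w i)) (w j) = inner (K (w j)) (w i)"
    by (subst positive_op_sym[OF K]) (rule inner_commute)
  ultimately show ?thesis
    using gram_schmidt_orthogonal_less[of i j] gram_schmidt_orthogonal_less[of j i] by (cases i j rule: linorder_cases) simp_all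
qed

lemma gram_schmidt_span: "d n \<in> span (w ` {..n})"
proof -
  obtain r where r: "r = d n - (\<Sum>j<n. inner (K (d n)) (w j) *\<^sub>R w j)"
    "r = sqrt (inner (K r) r) *\<^sub>R w n" by (rule gram_schmidt_residual[of n])
  have "r \<in> span (w ` {..n})" by (subst r(2)) (intro span_scale span_base, auto)
  moreover have "(\<Sum>j<n. inner (K (d n)) (w j) *\<^sub>R w j) \<in> span (w ` {..n})"
    by (intro span_sum span_scale span_base) auto
  ultimately have "r + (\<Sum>j<n. inner (K (d n)) (w j) *\<^sub>R w j) \<in> span (w ` {..n})" by (rule span_add)
  then show ?thesis by (simp add: r(1))
qed

text \<open>Both sides are linear in \<open>x\<close>, so it is enough to check the generators; a
  zero generator satisfies the identity trivially.\<close>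

lemma gram_schmidt_expand:
  assumes "x \<in> span (w ` I)" "finite I"
  shows "x = (\<Sum>i\<in>I. inner (K x) (w i) *\<^sub>R w i)"
proof -
  have l: "linear K" by (rule positive_op_linear[OF K])
  have "span (w ` I) \<subseteq> {x. x = (\<Sum>i\<in>I. inner (K x) (w i) *\<^sub>R w i)}"
  proof (rule span_minimal)
    show "subspace {x. x = (\<Sum>i\<in>I. inner (K x) (w i) *\<^sub>R w i)}"
      by (auto simp: subspace_def linear_add[OF l] linear_scale[OF l] linear_0[OF l] inner_add_left
          scaleR_add_left sum.distrib scaleR_sum_right[symmetric] scaleR_scaleR[symmetric] simp del: scaleR_scaleR)
    have "w j = (\<Sum>i\<in>I. inner (K (w j)) (w i) *\<^sub>R w i)" if "j \<in> I" for j
    proof -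
      have "(\<Sum>i\<in>I. inner (K (w j)) (w i) *\<^sub>R w i) = (\<Sum>i\<in>I. if i = j then w j else 0)"
        using gram_schmidt_normalized[of j] by (intro sum.cong refl) (auto simp: gram_schmidt_orthogonal)
      then show ?thesis using that assms(2) by (simp add: sum.delta)
    qed
    then show "w ` I \<subseteq> {x. x = (\<Sum>i\<in>I. inner (K x) (w i) *\<^sub>R w i)}" by blast
  qed
  then show ?thesis using assms(1) by blast
qed

lemma gram_schmidt_form:
  assumes "x \<in> span (w ` I)" "finite I"
  shows "inner (K x) x = (\<Sum>i\<in>I. (inner (K x) (w i))\<^sup>2)"
proof -
  have "inner (K x) x = inner (K x) (\<Sum>i\<in>I. inner (K x) (w i) *\<^sub>R w i)"
    using gram_schmidt_expand[OF assms] by simp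
  then show ?thesis by (simp add: inner_sum_right power2_eq_square)
qed

end

lemma positive_op_ident: "positive_op (\<lambda>x::'a::real_inner. x)"
  by (simp add: positive_op_def selfadjoint_op_def bounded_linear_ident)

text \<open>Gram-Schmidt is run on a dense sequence and the zero outputs are dropped. If only
  finitely many vectors survived, the expansion identity, being a closed condition, would extend
  from their dense span to the whole space, against infinite dimension.\<close>

lemma onb_exists:
  assumes sep: "separable_space (euclidean :: 'a::real_inner topology)"
    and infdim: "\<not> (\<exists>S::'a set. finite S \<and> span S = UNIV)"
  shows "\<exists>e::nat \<Rightarrow> 'a. is_onb e"
proof -
  obtain C :: "'a set" where C: "countable C" "closure C = UNIV"
    using sep by (auto simp: separable_space_def)
  have "C \<noteq> {}" using C(2) by auto
  define d where "d = from_nat_into C"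
  have d: "range d = C" unfolding d_def using C(1) \<open>C \<noteq> {}\<close> by (simp add: range_from_nat_into)
  define w where "w = gram_schmidt (\<lambda>x::'a. x) d"
  note gs = gram_schmidt_normalized[OF positive_op_ident, where d = d, folded w_def, simplified]
    gram_schmidt_orthogonal[OF positive_op_ident, where d = d, folded w_def, simplified]
    gram_schmidt_span[OF positive_op_ident, where d = d, folded w_def, simplified]
    gram_schmidt_expand[OF positive_op_ident, where d = d, folded w_def, simplified]
  have "C \<subseteq> span (range w)"
  proof
    fix x assume "x \<in> C"
    then obtain n where "x = d n" using d by blast
    then show "x \<in> span (range w)" using gs(3)[of n] span_mono[of "w ` {..n}" "range w"] by auto
  qed
  then have dense: "closure (span (range w)) = UNIV" using C(2) closure_mono by blast
  define I where "I = {n. w n \<noteq> 0}"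
  have spI: "span (range w) = span (w ` I)"
  proof -
    have "range w \<subseteq> insert 0 (w ` I)" by (auto simp: I_def)
    then have "span (range w) \<subseteq> span (w ` I)" using span_mono span_insert_0 by metis
    moreover have "span (w ` I) \<subseteq> span (range w)" by (intro span_mono) auto
    ultimately show ?thesis by (rule subset_antisym)
  qed
  have inf: "infinite I"
  proof
    assume fin: "finite I"
    have "closed {x. x = (\<Sum>i\<in>I. inner x (w i) *\<^sub>R w i)}"
      by (intro closed_Collect_eq continuous_intros)
    moreover have "span (w ` I) \<subseteq> {x. x = (\<Sum>i\<in>I. inner x (w i) *\<^sub>R w i)}"
      using gs(4) fin by blast
    ultimately have "x = (\<Sum>i\<in>I. inner x (w i) *\<^sub>R w i)" for x
      using closure_minimal[of "span (w ` I)" "{x. x = (\<Sum>i\<in>I. inner x (w i) *\<^sub>R w i)}"] dense spI by auto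
    then have "x \<in> span (w ` I)" for x
      using span_sum[of I "\<lambda>i. inner x (w i) *\<^sub>R w i" "w ` I"] by (metis imageI span_base span_scale)
    then show False using infdim fin by blast
  qed
  define e where "e n = w (enumerate I n)" for n
  have "range e = w ` I" unfolding e_def using range_enumerate[OF inf] by (metis image_image)
  moreover have "inner (e i) (e j) = (if i = j then 1 else 0)" for i j
  proof (cases "i = j")
    case True
    have "enumerate I i \<in> I" using inf by (rule enumerate_in_set)
    then show ?thesis using gs(1)[of "enumerate I i"] True by (auto simp: e_def I_def)
  next
    case False
    then have "enumerate I i \<noteq> enumerate I j" using inf by (metis enumerate_mono less_linear less_irrefl)
    then show ?thesis using gs(2)[of "enumerate I i" "enumerate I j"] False by (simp add: e_def)
  qed
  ultimately have "is_onb e" using dense spI by (simp add: is_onb_def)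
  then show ?thesis by blast
qed

section \<open>Expansion in an orthonormal basis, Riesz theorems and adjoints\<close>

context
  fixes e :: "nat \<Rightarrow> 'a::real_inner"
  assumes e: "is_onb e"
begin

lemma onb_inner: "inner (e i) (e j) = (if i = j then 1 else 0)"
  using e by (simp add: is_onb_def)

lemma onb_inner_sum: "inner (\<Sum>k<n. c k *\<^sub>R e k) (e j) = (if j < n then c j else 0)"
proof -
  have "inner (\<Sum>k<n. c k *\<^sub>R e k) (e j) = (\<Sum>k<n. if k = j then c k else 0)"
    by (simp add: inner_sum_left onb_inner if_distrib cong: if_cong)
  then show ?thesis by (simp add: sum.delta)
qed

lemma onb_sum_norm:
  assumes "finite I"
  shows "(norm (\<Sum>k\<in>I. c k *\<^sub>R e k))\<^sup>2 = (\<Sum>k\<in>I. (c k)\<^sup>2)"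
proof -
  have "(norm (\<Sum>k\<in>I. c k *\<^sub>R e k))\<^sup>2 = (\<Sum>k\<in>I. \<Sum>j\<in>I. if j = k then c k * c j else 0)"
    unfolding power2_norm_eq_inner inner_sum_left inner_sum_right
    by (intro sum.cong refl) (auto simp: onb_inner)
  then show ?thesis using assms by (simp add: sum.delta power2_eq_square)
qed

lemma onb_residual_norm: "norm (x - (\<Sum>k<n. inner x (e k) *\<^sub>R e k)) \<le> norm x"
proof (rule power2_le_imp_le)
  let ?p = "\<Sum>k<n. inner x (e k) *\<^sub>R e k"
  have "inner x ?p = (norm ?p)\<^sup>2"
    by (simp add: onb_sum_norm inner_sum_right power2_eq_square[of "inner _ _"])
  then have "(norm (x - ?p))\<^sup>2 = (norm x)\<^sup>2 - (norm ?p)\<^sup>2"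
    by (simp add: power2_norm_eq_inner inner_diff_left inner_diff_right inner_commute)
  then show "(norm (x - ?p))\<^sup>2 \<le> (norm x)\<^sup>2" by simp
qed simp

text \<open>On finite combinations of basis vectors the partial sums are eventually exact. The
  residual maps are contractions uniformly in \<open>n\<close>, which carries convergence over to
  the closure.\<close>

lemma onb_expansion: "(\<lambda>n. \<Sum>k<n. inner x (e k) *\<^sub>R e k) \<longlonglongrightarrow> x"
proof -
  define p where "p n x = (\<Sum>k<n. inner x (e k) *\<^sub>R e k)" for n x
  have padd: "p n (x + y) = p n x + p n y" for n x y
    by (simp add: p_def inner_add_left scaleR_add_left sum.distrib)
  have pscale: "p n (c *\<^sub>R x) = c *\<^sub>R p n x" for n x c
    by (simp add: p_def scaleR_sum_right)
  have pdiff: "p n (x - y) = p n x - p n y" for n x y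
    by (simp add: p_def inner_diff_left scaleR_diff_left sum_subtractf)
  define S where "S = {x. (\<lambda>n. p n x) \<longlonglongrightarrow> x}"
  have "subspace S"
    unfolding subspace_def S_def
    by (auto simp: padd pscale intro!: tendsto_intros) (simp add: p_def)
  moreover have "range e \<subseteq> S"
  proof -
    have "(\<lambda>n. p n (e j)) \<longlonglongrightarrow> e j" for j
    proof (rule tendsto_eventually)
      have "p n (e j) = e j" if "n > j" for n
      proof -
        have "p n (e j) = (\<Sum>k<n. if k = j then e j else 0)"
          unfolding p_def by (intro sum.cong) (auto simp: onb_inner)
        then show ?thesis using that by (simp add: sum.delta)
      qed
      then show "\<forall>\<^sub>F n in sequentially. p n (e j) = e j"
        by (rule eventually_mono[OF eventually_gt_at_top[of j]])
    qed
    then show ?thesis by (auto simp: S_def)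
  qed
  ultimately have span: "span (range e) \<subseteq> S" by (simp add: span_minimal)
  have "x \<in> closure (span (range e))" using e by (simp add: is_onb_def)
  have "(\<lambda>n. p n x) \<longlonglongrightarrow> x"
  proof (rule metric_LIMSEQ_I)
    fix \<epsilon> :: real assume \<epsilon>: "\<epsilon> > 0"
    obtain y where y: "y \<in> span (range e)" "dist y x < \<epsilon> / 2"
      using \<open>x \<in> closure _\<close> \<epsilon> closure_approachable[of x] by (meson half_gt_zero)
    have "(\<lambda>n. p n y) \<longlonglongrightarrow> y" using y(1) span by (auto simp: S_def)
    then obtain N where N: "\<And>n. n \<ge> N \<Longrightarrow> dist (p n y) y < \<epsilon> / 2"
      using metric_LIMSEQ_D[of _ y "\<epsilon>/2"] \<epsilon> by (meson half_gt_zero)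
    have "dist (p n x) x < \<epsilon>" if "n \<ge> N" for n
    proof -
      have "p n x - x = (p n y - y) - ((x - y) - p n (x - y))" by (simp add: pdiff)
      then have "dist (p n x) x \<le> norm (p n y - y) + norm ((x - y) - p n (x - y))"
        by (metis dist_norm norm_triangle_ineq4)
      also have "\<dots> \<le> dist (p n y) y + dist y x"
        using onb_residual_norm[of "x - y" n] by (simp add: p_def dist_norm norm_minus_commute)
      also have "\<dots> < \<epsilon>" using N[OF that] y(2) by simp
      finally show ?thesis .
    qed
    then show "\<exists>N. \<forall>n\<ge>N. dist (p n x) x < \<epsilon>" by blast
  qed
  then show ?thesis by (simp add: p_def)
qed

lemma onb_parseval: "(\<lambda>k. inner x (e k) * inner y (e k)) sums inner x y"
proof -
  have "(\<lambda>n. inner (\<Sum>k<n. inner x (e k) *\<^sub>R e k) y) \<longlonglongrightarrow> inner x y"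
    by (intro tendsto_intros onb_expansion)
  then show ?thesis by (simp add: sums_def inner_sum_left inner_commute[of "e _" y])
qed

end

text \<open>Completeness of the space is used here: the squared distance of two partial sums is a
  difference of partial sums of a convergent real series.\<close>

lemma riesz_fischer:
  fixes e :: "nat \<Rightarrow> 'a::{real_inner,complete_space}"
  assumes e: "is_onb e" and c: "summable (\<lambda>k. (c k)\<^sup>2)"
  shows "\<exists>x. \<forall>k. inner x (e k) = c k"
proof -
  define s where "s n = (\<Sum>k<n. c k *\<^sub>R e k)" for n
  define t where "t n = (\<Sum>k<n. (c k)\<^sup>2)" for n
  have st: "(norm (s n - s m))\<^sup>2 = t n - t m" if "m \<le> n" for m n
  proof -
    have d: "{..<n} = {..<m} \<union> {m..<n}" "{..<m} \<inter> {m..<n} = {}" using that by auto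
    have "s n - s m = (\<Sum>k\<in>{m..<n}. c k *\<^sub>R e k)" "t n - t m = (\<Sum>k\<in>{m..<n}. (c k)\<^sup>2)"
      unfolding s_def t_def d(1) by (simp_all add: sum.union_disjoint d(2))
    then show ?thesis by (simp add: onb_sum_norm[OF e])
  qed
  have "Cauchy t" using c unfolding t_def by (simp add: summable_iff_convergent convergent_Cauchy)
  have "Cauchy s"
  proof (rule metric_CauchyI)
    fix \<epsilon> :: real assume \<epsilon>: "\<epsilon> > 0"
    then obtain N where N: "\<And>m n. m \<ge> N \<Longrightarrow> n \<ge> N \<Longrightarrow> dist (t m) (t n) < \<epsilon>\<^sup>2"
      using metric_CauchyD[OF \<open>Cauchy t\<close>, of "\<epsilon>\<^sup>2"] by auto
    have *: "dist (s n) (s m) < \<epsilon>" if "m \<ge> N" "n \<ge> N" "m \<le> n" for m n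
    proof (rule power2_less_imp_less)
      show "(dist (s n) (s m))\<^sup>2 < \<epsilon>\<^sup>2"
        using N[OF that(2,1)] st[OF that(3)] by (simp add: dist_norm)
    qed (use \<epsilon> in simp)
    have "dist (s m) (s n) < \<epsilon>" if "m \<ge> N" "n \<ge> N" for m n
      using *[of m n] *[of n m] that by (cases "m \<le> n") (auto simp: dist_commute)
    then show "\<exists>M. \<forall>m\<ge>M. \<forall>n\<ge>M. dist (s m) (s n) < \<epsilon>" by blast
  qed
  then obtain x where x: "s \<longlonglongrightarrow> x" using Cauchy_convergent convergent_def by blast
  have "inner x (e k) = c k" for k
  proof (rule LIMSEQ_unique)
    show "(\<lambda>n. inner (s n) (e k)) \<longlonglongrightarrow> inner x (e k)" by (intro tendsto_intros x)
    show "(\<lambda>n. inner (s n) (e k)) \<longlonglongrightarrow> c k"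
      unfolding s_def onb_inner_sum[OF e]
      by (intro tendsto_eventually eventually_mono[OF eventually_gt_at_top[of k]]) simp
  qed
  then show ?thesis by blast
qed

text \<open>Testing \<open>f\<close> on the sum of \<open>f (e k) *\<^sub>R e k\<close> yields the
  squared norm of that sum, so boundedness of \<open>f\<close> makes its coefficients square
  summable.\<close>

lemma riesz_representation:
  fixes e :: "nat \<Rightarrow> 'a::{real_inner,complete_space}" and f :: "'a \<Rightarrow> real"
  assumes e: "is_onb e" and f: "bounded_linear f"
  shows "\<exists>a. \<forall>x. f x = inner x a"
proof -
  interpret f: bounded_linear f by fact
  obtain B where B: "B > 0" "\<And>x. norm (f x) \<le> norm x * B" using f.pos_bounded by blast
  have bd: "(\<Sum>k<n. (f (e k))\<^sup>2) \<le> B\<^sup>2" for n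
  proof -
    define s where "s = (\<Sum>k<n. f (e k) *\<^sub>R e k)"
    define t where "t = (\<Sum>k<n. (f (e k))\<^sup>2)"
    have "t \<ge> 0" by (simp add: t_def sum_nonneg)
    have "f s = t" by (simp add: s_def t_def f.sum f.scale power2_eq_square)
    moreover have "norm s = sqrt t" using onb_sum_norm[OF e, of "{..<n}"]
      by (metis finite_lessThan norm_ge_zero real_sqrt_unique s_def t_def)
    ultimately have "t \<le> sqrt t * B" using B(2)[of s] \<open>t \<ge> 0\<close> by simp
    then have "sqrt t * sqrt t \<le> B * sqrt t" using \<open>t \<ge> 0\<close> by (simp add: mult.commute)
    then have "sqrt t \<le> B" using \<open>t \<ge> 0\<close> B(1)
      by (cases "t = 0") (simp_all add: mult_le_cancel_right del: real_sqrt_mult_self)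
    then show ?thesis using sqrt_le_D t_def by blast
  qed
  then have "summable (\<lambda>k. (f (e k))\<^sup>2)"
    by (intro bounded_imp_summable[where B="B\<^sup>2"]) (simp_all only: lessThan_Suc_atMost[symmetric] bd zero_le_power2)
  from riesz_fischer[OF e this] obtain a where a: "\<forall>k. inner a (e k) = f (e k)" by blast
  have "f x = inner x a" for x
  proof (rule LIMSEQ_unique)
    show "(\<lambda>n. f (\<Sum>k<n. inner x (e k) *\<^sub>R e k)) \<longlonglongrightarrow> f x" by (intro f.tendsto onb_expansion[OF e])
    show "(\<lambda>n. f (\<Sum>k<n. inner x (e k) *\<^sub>R e k)) \<longlonglongrightarrow> inner x a"
      using onb_parseval[OF e, of x a] by (simp add: sums_def f.sum f.scale a)
  qed
  then show ?thesis by blast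
qed

text \<open>\<open>adjoint\<close> is a choice; Riesz representation, applied for each
  \<open>y\<close>, shows that there is something to choose.\<close>

lemma adjoint_hilbert:
  fixes e :: "nat \<Rightarrow> 'a::{real_inner,complete_space}" and A :: "'a \<Rightarrow> 'b::real_inner"
  assumes e: "is_onb e" and A: "bounded_linear A"
  shows "inner (A x) y = inner x (adjoint A y)"
proof -
  have "\<forall>y. \<exists>a. \<forall>x. inner (A x) y = inner x a"
  proof
    fix y
    have "bounded_linear (\<lambda>x. inner (A x) y)"
      using bounded_linear_compose[OF bounded_linear_inner_left A] .
    then show "\<exists>a. \<forall>x. inner (A x) y = inner x a" by (rule riesz_representation[OF e])
  qed
  then obtain f where "\<forall>x y. inner (A x) y = inner x (f y)" by metis
  then have "\<forall>x y. inner (A x) y = inner x (adjoint A y)" unfolding adjoint_def by (rule someI[where x=f])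
  then show ?thesis by blast
qed

section \<open>Characteristic functionals on a separable space\<close>

text \<open>A point \<open>x\<close> outside the ball violates the halfspace with normal
  \<open>x - c\<close> strictly. Strict violation is open in the normal, so some normal in the dense
  set \<open>C\<close> is violated as well.\<close>

lemma cball_eq_halfspaces:
  fixes c :: "'a::real_inner"
  assumes C: "closure C = UNIV" and r: "r \<ge> 0"
  shows "cball c r = (\<Inter>d\<in>C. {x. inner d x \<le> inner d c + r * norm d})"
proof (intro Set.set_eqI iffI)
  fix x assume "x \<in> cball c r"
  then have "norm (x - c) \<le> r" by (simp add: dist_norm norm_minus_commute)
  then have "inner d (x - c) \<le> r * norm d" for d
    using norm_cauchy_schwarz[of d "x - c"] mult_left_mono[of "norm (x - c)" r "norm d"]
    by (simp add: mult.commute)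
  then show "x \<in> (\<Inter>d\<in>C. {x. inner d x \<le> inner d c + r * norm d})"
    by (auto simp: inner_diff_right algebra_simps)
next
  fix x assume x: "x \<in> (\<Inter>d\<in>C. {x. inner d x \<le> inner d c + r * norm d})"
  show "x \<in> cball c r"
  proof (rule ccontr)
    assume "x \<notin> cball c r"
    then have n: "norm (x - c) > r" by (simp add: dist_norm norm_minus_commute)
    have op: "open {d. r * norm d < inner d (x - c)}" by (intro open_Collect_less continuous_intros)
    have "x - c \<in> {d. r * norm d < inner d (x - c)}"
      using n r by (auto simp: power2_norm_eq_inner[symmetric] power2_eq_square intro!: mult_strict_right_mono)
    then have "{d. r * norm d < inner d (x - c)} \<inter> C \<noteq> {}"
      using open_Int_closure_eq_empty[OF op, of C] C by auto
    then obtain d where "d \<in> C" "r * norm d < inner d (x - c)" by blast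
    then show False using x by (auto simp: inner_diff_right algebra_simps not_le)
  qed
qed

text \<open>By separability an open set is a countable union of closed balls with centres in
  \<open>C\<close> and rational radii, and each ball is a countable intersection of halfspaces.
  Measurability and equality of measures can therefore be tested through scalar functionals.\<close>

lemma sets_borel_eq_halfspaces:
  assumes sep: "separable_space (euclidean :: 'a::real_inner topology)"
  shows "sets (borel :: 'a measure) = sigma_sets UNIV (range (\<lambda>(h, c). {x. inner h x \<le> c}))"
    (is "_ = sigma_sets UNIV ?G")
proof -
  obtain C :: "'a set" where C: "countable C" "closure C = UNIV"
    using sep by (auto simp: separable_space_def)
  have cb: "cball c r \<in> sigma_sets UNIV ?G" for c r
  proof (cases "r \<ge> 0")
    case True
    have "C \<noteq> {}" using C(2) by auto
    have "{x. inner d x \<le> inner d c + r * norm d} \<in> ?G" for d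
      by (rule image_eqI[where x="(d, inner d c + r * norm d)"]) auto
    then show ?thesis
      unfolding cball_eq_halfspaces[OF C(2) True]
      using C(1) \<open>C \<noteq> {}\<close> by (intro sigma_algebra.countable_INT''[OF sigma_algebra_sigma_sets]) (auto intro: sigma_sets.Basic sigma_sets_top)
  qed (simp add: cball_empty sigma_sets.Empty)
  have op: "U \<in> sigma_sets UNIV ?G" if U: "open U" for U
  proof -
    define P where "P = {p. fst p \<in> C \<and> snd p \<in> \<rat> \<and> cball (fst p) (snd p) \<subseteq> U}"
    have "P \<subseteq> C \<times> \<rat>" by (auto simp: P_def)
    then have cP: "countable P" using C(1) countable_rat by (meson countable_SIGMA countable_subset)
    have "U \<subseteq> (\<Union>p\<in>P. cball (fst p) (snd p))"
    proof
      fix x assume "x \<in> U"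
      then obtain e where e: "e > 0" "ball x e \<subseteq> U" using U open_contains_ball by blast
      obtain q where q: "q \<in> \<rat>" "0 < q" "q < e / 2" using Rats_dense_in_real[of 0 "e/2"] e(1) by auto
      obtain c where c: "c \<in> C" "dist c x < q"
        using C(2) closure_approachable[of x C] q(2) by auto
      have "cball c q \<subseteq> ball x e"
      proof
        fix z assume "z \<in> cball c q"
        then have "dist c z \<le> q" by simp
        then show "z \<in> ball x e" using dist_triangle[of x z c] c(2) q(3) by (simp add: dist_commute)
      qed
      then have "(c, q) \<in> P" using e c(1) q(1) by (auto simp: P_def)
      moreover have "x \<in> cball c q" using c(2) by simp
      ultimately show "x \<in> (\<Union>p\<in>P. cball (fst p) (snd p))" by force
    qed
    then have U_eq: "U = (\<Union>p\<in>P. cball (fst p) (snd p))" by (auto simp: P_def)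
    show ?thesis unfolding U_eq by (rule sigma_sets_UNION) (use cP cb in auto)
  qed
  have "sets (borel :: 'a measure) = sigma_sets UNIV {S. open S}"
    unfolding borel_def by (rule sets_measure_of) auto
  also have "\<dots> = sigma_sets UNIV ?G"
  proof (rule sigma_sets_eqI)
    fix a assume "a \<in> ?G"
    then obtain h c where a: "a = {x. inner h x \<le> c}" by auto
    have "closed a" unfolding a by (intro closed_Collect_le continuous_intros)
    then have "a \<in> sets borel" by simp
    then show "a \<in> sigma_sets UNIV {S. open S}" using calculation by simp
  qed (use op in auto)
  finally show ?thesis .
qed

lemma measurable_inner_halfspaces:
  fixes f :: "'b \<Rightarrow> 'a::real_inner"
  assumes sep: "separable_space (euclidean :: 'a topology)"
    and f: "\<And>h. (\<lambda>x. inner h (f x)) \<in> borel_measurable M"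
  shows "f \<in> borel_measurable M"
proof -
  have "f \<in> measurable M (sigma UNIV (range (\<lambda>(h, c). {x. inner h x \<le> c})))"
  proof (rule measurable_measure_of)
    fix y assume "y \<in> range (\<lambda>(h::'a, c). {x. inner h x \<le> c})"
    then obtain h c where "y = {x. inner h x \<le> c}" by auto
    then have "f -` y \<inter> space M = (\<lambda>x. inner h (f x)) -` {..c} \<inter> space M" by auto
    then show "f -` y \<inter> space M \<in> sets M" using measurable_sets[OF f[of h], of "{..c}"] by simp
  qed auto
  then show ?thesis
    using sets_borel_eq_halfspaces[OF sep] by (subst measurable_cong_sets[OF refl]) auto
qed

lemma borel_measurable_inner_const [measurable]: "(\<lambda>x. inner h x) \<in> borel_measurable borel"
  by (intro borel_measurable_continuous_onI continuous_intros)

lemma borel_measurable_inner_const':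
  "sets M = sets borel \<Longrightarrow> (\<lambda>x. inner h x) \<in> borel_measurable M"
  using borel_measurable_inner_const by (subst measurable_cong_sets[OF _ refl])

lemma integrable_bounded_weight:
  fixes f :: "'a \<Rightarrow> real"
  assumes "finite_measure M" and f: "f \<in> borel_measurable M" "\<And>x. \<bar>f x\<bar> \<le> B"
    and X: "X \<in> borel_measurable M"
  shows "complex_integrable M (\<lambda>x. of_real (f x) * iexp (X x))" and "integrable M f"
proof -
  interpret finite_measure M by fact
  note [measurable] = f(1) X
  show "complex_integrable M (\<lambda>x. of_real (f x) * iexp (X x))"
    by (rule integrable_const_bound[where B=B]) (auto simp: norm_mult f(2))
  show "integrable M f" by (rule integrable_const_bound[where B=B]) (auto simp: f(2))
qed

text \<open>\<open>t = 0\<close> shows that \<open>f\<close> has the same mass \<open>c\<close>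
  under both measures. For \<open>c > 0\<close> the normalised densities give two laws of
  \<open>X\<close> with equal characteristic functions; for \<open>c = 0\<close> the weight vanishes
  almost everywhere.\<close>

lemma weighted_levy_uniqueness:
  fixes f X :: "'a \<Rightarrow> real"
  assumes pm: "prob_space \<mu>" "prob_space \<nu>" and sets: "sets \<nu> = sets \<mu>"
    and f: "f \<in> borel_measurable \<mu>" "\<And>x. 0 \<le> f x" "\<And>x. f x \<le> B" and X: "X \<in> borel_measurable \<mu>"
    and eq: "\<And>t. (CLINT x|\<mu>. of_real (f x) * iexp (t * X x)) = (CLINT x|\<nu>. of_real (f x) * iexp (t * X x))"
    and A: "A \<in> sets borel"
  shows "(LINT x|\<mu>. f x * indicator A (X x)) = (LINT x|\<nu>. f x * indicator A (X x))"
proof -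
  interpret \<mu>: prob_space \<mu> by fact
  interpret \<nu>: prob_space \<nu> by fact
  have f': "\<bar>f x\<bar> \<le> B" for x using f(2,3)[of x] by simp
  have m: "f \<in> borel_measurable \<nu>" "X \<in> borel_measurable \<nu>"
    using f(1) X by (simp_all add: measurable_cong_sets[OF sets refl])
  note [measurable] = f(1) X m A
  define c where "c = (LINT x|\<mu>. f x)"
  have "complex_of_real (LINT x|\<mu>. f x) = complex_of_real (LINT x|\<nu>. f x)"
    using eq[of 0] by (simp add: integral_of_real)
  then have c': "c = (LINT x|\<nu>. f x)" by (simp add: c_def)
  have int: "integrable \<mu> f" "integrable \<nu> f"
    using integrable_bounded_weight(2)[OF \<mu>.finite_measure_axioms f(1) f' X]
      integrable_bounded_weight(2)[OF \<nu>.finite_measure_axioms m(1) f' m(2)] by auto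
  have "c \<ge> 0" unfolding c_def using f(2) by simp
  show ?thesis
  proof (cases "c = 0")
    case True
    have z: "(LINT x|M. f x * indicator A (X x)) = 0"
      if "integrable M f" "(LINT x|M. f x) = 0" for M
    proof -
      have "AE x in M. f x = 0" using integral_nonneg_eq_0_iff_AE[OF that(1)] f(2) that(2) by auto
      then show ?thesis by (intro integral_eq_zero_AE) auto
    qed
    show ?thesis using z[OF int(1)] z[OF int(2)] True c' c_def by simp
  next
    case False
    then have c: "c > 0" using \<open>c \<ge> 0\<close> by simp
    have main: "real_distribution (distr (density M (\<lambda>x. ennreal (f x / c))) borel X)
        \<and> (\<forall>t. char (distr (density M (\<lambda>x. ennreal (f x / c))) borel X) t
             = (CLINT x|M. of_real (f x) * iexp (t * X x)) / of_real c)
        \<and> measure (distr (density M (\<lambda>x. ennreal (f x / c))) borel X) A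
             = (LINT x|M. f x * indicator A (X x)) / c"
      if M: "f \<in> borel_measurable M" "X \<in> borel_measurable M" "integrable M f" "c = (LINT x|M. f x)" for M
    proof (intro conjI allI)
      note [measurable] = M(1,2)
      let ?D = "density M (\<lambda>x. ennreal (f x / c))"
      have "(\<integral>\<^sup>+x. ennreal (f x / c) \<partial>M) = ennreal (LINT x|M. f x / c)"
        using M(3) f(2) c by (intro nn_integral_eq_integral) auto
      also have "\<dots> = 1" using M(4) c by simp
      finally have D: "prob_space ?D" by (intro prob_spaceI) (simp add: emeasure_density)
      show R: "real_distribution (distr ?D borel X)"
        by (rule prob_space.real_distribution_distr[OF D]) simp
      show "char (distr ?D borel X) t = (CLINT x|M. of_real (f x) * iexp (t * X x)) / of_real c" for t
      proof -
        have "char (distr ?D borel X) t = (CLINT x|?D. iexp (t * X x))"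
          unfolding char_def by (subst integral_distr) auto
        also have "\<dots> = (CLINT x|M. (f x / c) *\<^sub>R iexp (t * X x))"
          using f(2) c by (subst integral_density) auto
        also have "\<dots> = (CLINT x|M. (of_real (f x) * iexp (t * X x)) / of_real c)"
          by (simp add: scaleR_conv_of_real)
        finally show ?thesis by simp
      qed
      interpret R: real_distribution "distr ?D borel X" by fact
      have "measure (distr ?D borel X) A = (LINT x|distr ?D borel X. indicator A x)" by simp
      also have "\<dots> = (LINT x|?D. indicator A (X x))" by (subst integral_distr) auto
      also have "\<dots> = (LINT x|M. (f x / c) *\<^sub>R indicator A (X x))"
        using f(2) c by (subst integral_density) auto
      also have "\<dots> = (LINT x|M. f x * indicator A (X x) / c)" by simp
      finally show "measure (distr ?D borel X) A = (LINT x|M. f x * indicator A (X x)) / c" by simp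
    qed
    note 1 = main[OF f(1) X int(1) c_def] and 2 = main[OF m int(2) c']
    have "distr (density \<mu> (\<lambda>x. ennreal (f x / c))) borel X = distr (density \<nu> (\<lambda>x. ennreal (f x / c))) borel X"
      using 1 2 eq by (intro Levy_uniqueness ext) auto
    then have "(LINT x|\<mu>. f x * indicator A (X x)) / c = (LINT x|\<nu>. f x * indicator A (X x)) / c"
      using 1 2 by metis
    then show ?thesis using c by simp
  qed
qed

text \<open>Levy's theorem is only available on the real line.  Weights \<open>1 + cos\<close> and \<open>1 + sin\<close> are nonnegative,
  so it can be applied to one coordinate at a time while keeping a character in the remaining directions.\<close>

lemma char_functional_restrict:
  fixes \<mu> \<nu> :: "'a::real_inner measure" and g :: "'a \<Rightarrow> real"
  assumes pm: "prob_space \<mu>" "prob_space \<nu>" and sets: "sets \<mu> = sets borel" "sets \<nu> = sets borel"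
    and g: "g \<in> borel_measurable borel" "\<And>x. 0 \<le> g x" "\<And>x. g x \<le> 1"
    and eq: "\<And>h. (CLINT x|\<mu>. of_real (g x) * iexp (inner h x)) = (CLINT x|\<nu>. of_real (g x) * iexp (inner h x))"
    and A: "A \<in> sets borel"
  shows "(CLINT x|\<mu>. of_real (g x * indicator A (inner h x)) * iexp (inner k x))
       = (CLINT x|\<nu>. of_real (g x * indicator A (inner h x)) * iexp (inner k x))"
proof -
  interpret \<mu>: prob_space \<mu> by fact
  interpret \<nu>: prob_space \<nu> by fact
  note g' = g(1)[unfolded measurable_cong_sets[OF sets(1)[symmetric] refl]]
    g(1)[unfolded measurable_cong_sets[OF sets(2)[symmetric] refl]]
  have ag: "\<bar>g x\<bar> \<le> 1" for x using g(2,3)[of x] by simp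
  have inn: "(\<lambda>x. inner h x) \<in> borel_measurable \<mu>" "(\<lambda>x. inner h x) \<in> borel_measurable \<nu>" for h :: 'a
    by (rule borel_measurable_inner_const'[OF sets(1)], rule borel_measurable_inner_const'[OF sets(2)])
  note [measurable] = g' inn A
  have I: "complex_integrable \<mu> (\<lambda>x. of_real (g x) * iexp (inner h x))"
    "complex_integrable \<nu> (\<lambda>x. of_real (g x) * iexp (inner h x))" for h
    using integrable_bounded_weight(1)[OF \<mu>.finite_measure_axioms g'(1) ag inn(1)]
      integrable_bounded_weight(1)[OF \<nu>.finite_measure_axioms g'(2) ag inn(2)] by auto
  have trig: "(LINT x|\<mu>. g x * (1 + w (inner k x)) * indicator A (inner h x))
      = (LINT x|\<nu>. g x * (1 + w (inner k x)) * indicator A (inner h x))"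
    if w: "w \<in> borel_measurable borel" "\<And>t. \<bar>w t\<bar> \<le> 1"
      and \<alpha>: "\<And>t. complex_of_real (w t) = \<alpha> * iexp t + \<beta> * iexp (-t)" for w :: "real \<Rightarrow> real" and \<alpha> \<beta>
  proof (rule weighted_levy_uniqueness[where B=2])
    note [measurable] = w(1)
    show "(\<lambda>x. g x * (1 + w (inner k x))) \<in> borel_measurable \<mu>" by measurable
    have "-1 \<le> w t" "w t \<le> 1" for t using w(2)[of t] by auto
    then have w': "0 \<le> 1 + w t" "1 + w t \<le> 2" for t by (smt (verit))+
    then show "0 \<le> g x * (1 + w (inner k x))" "g x * (1 + w (inner k x)) \<le> 2" for x
      using mult_mono[OF g(3)[of x] w'(2)[of "inner k x"]] w'(1)[of "inner k x"] g(2)[of x] by auto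
    fix t
    \<comment> \<open>Expressing \<open>w\<close> by exponentials turns the weighted character into
      characters at \<open>t *\<^sub>R h\<close>, \<open>t *\<^sub>R h + k\<close> and
      \<open>t *\<^sub>R h - k\<close>, to each of which \<open>eq\<close> applies.\<close>
    have e: "complex_of_real (g x * (1 + w (inner k x))) * iexp (t * inner h x)
       = complex_of_real (g x) * iexp (inner (t *\<^sub>R h) x)
        + \<alpha> * (complex_of_real (g x) * iexp (inner (t *\<^sub>R h + k) x))
        + \<beta> * (complex_of_real (g x) * iexp (inner (t *\<^sub>R h - k) x))" for x
      by (simp add: \<alpha> inner_add_left inner_diff_left algebra_simps exp_add[symmetric])
    show "(CLINT x|\<mu>. complex_of_real (g x * (1 + w (inner k x))) * iexp (t * inner h x))
        = (CLINT x|\<nu>. complex_of_real (g x * (1 + w (inner k x))) * iexp (t * inner h x))"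
      unfolding e using I eq by (simp del: inner_scaleR_left)
  qed (use pm sets A inn in auto)
  have tc: "(LINT x|\<mu>. g x * (1 + cos (inner k x)) * indicator A (inner h x))
      = (LINT x|\<nu>. g x * (1 + cos (inner k x)) * indicator A (inner h x))"
    by (rule trig[of cos "1/2" "1/2"])
      (simp_all add: cis_conv_exp[symmetric] complex_eq_iff del: of_real_minus)
  have ts: "(LINT x|\<mu>. g x * (1 + sin (inner k x)) * indicator A (inner h x))
      = (LINT x|\<nu>. g x * (1 + sin (inner k x)) * indicator A (inner h x))"
    by (rule trig[of sin "-\<i>/2" "\<i>/2"])
      (simp_all add: cis_conv_exp[symmetric] complex_eq_iff del: of_real_minus)
  \<comment> \<open>The weight with \<open>w = 0\<close> is subtracted below, removing the
    \<open>1\<close> that was added for nonnegativity.\<close>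
  have t0: "(LINT x|\<mu>. g x * indicator A (inner h x)) = (LINT x|\<nu>. g x * indicator A (inner h x))"
    using trig[of "\<lambda>t. 0" 0 0] by simp
  define G where "G x = g x * indicator A (inner h x)" for x
  have G: "G \<in> borel_measurable \<mu>" "G \<in> borel_measurable \<nu>" unfolding G_def by measurable
  have aG: "\<bar>G x\<bar> \<le> 1" for x using ag[of x] by (auto simp: G_def indicator_def)
  note [measurable] = G
  have split: "(LINT x|M. g x * (1 + w (inner k x)) * indicator A (inner h x))
     = (LINT x|M. G x) + (LINT x|M. G x * w (inner k x))" 
    and int: "integrable M (\<lambda>x. G x * w (inner k x))"
    if "prob_space M" "G \<in> borel_measurable M" "\<And>h. (\<lambda>x. inner h x) \<in> borel_measurable M"
      "w \<in> borel_measurable borel" "\<And>t. \<bar>w t\<bar> \<le> 1" for w :: "real \<Rightarrow> real" and M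
  proof -
    interpret M: prob_space M by fact
    note [measurable] = that(2,3,4)
    have b: "\<bar>G x * w (inner k x)\<bar> \<le> 1" for x
      using mult_mono[OF aG[of x] that(5)[of "inner k x"]] by (simp add: abs_mult)
    show i: "integrable M (\<lambda>x. G x * w (inner k x))"
      by (rule M.integrable_const_bound[where B=1]) (auto simp: b)
    have "integrable M G" by (rule M.integrable_const_bound[where B=1]) (auto simp: aG)
    then show "(LINT x|M. g x * (1 + w (inner k x)) * indicator A (inner h x))
       = (LINT x|M. G x) + (LINT x|M. G x * w (inner k x))"
      using i by (subst Bochner_Integration.integral_add[symmetric])
        (auto intro!: Bochner_Integration.integral_cong simp: G_def algebra_simps)
  qed
  note sp = split[OF pm(1) G(1) inn(1)] split[OF pm(2) G(2) inn(2)]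
  note it = int[OF pm(1) G(1) inn(1)] int[OF pm(2) G(2) inn(2)]
  have C: "(LINT x|\<mu>. G x * cos (inner k x)) = (LINT x|\<nu>. G x * cos (inner k x))"
    and S: "(LINT x|\<mu>. G x * sin (inner k x)) = (LINT x|\<nu>. G x * sin (inner k x))"
    using tc ts t0 sp(1)[of cos] sp(2)[of cos] sp(1)[of sin] sp(2)[of sin] by (auto simp: G_def[symmetric])
  have "(CLINT x|M. of_real (G x) * iexp (inner k x))
      = of_real (LINT x|M. G x * cos (inner k x)) + \<i> * of_real (LINT x|M. G x * sin (inner k x))"
    if "integrable M (\<lambda>x. G x * cos (inner k x))" "integrable M (\<lambda>x. G x * sin (inner k x))" for M
  proof -
    have "of_real (G x) * iexp (inner k x)
      = complex_of_real (G x * cos (inner k x)) + \<i> * complex_of_real (G x * sin (inner k x))" for x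
      by (simp add: cis_conv_exp[symmetric] cis.code Complex_eq algebra_simps)
    then show ?thesis using that by (simp add: integral_of_real integrable_of_real del: of_real_mult)
  qed
  then show ?thesis using C S it[of cos] it[of sin] by (simp add: G_def[symmetric])
qed

text \<open>Halfspace indicators are inserted one at a time under the integral while an arbitrary
  character is carried along. Setting that character to \<open>1\<close> gives equality on finite
  intersections of halfspaces, an intersection-stable generator of the Borel sets.\<close>

lemma char_functional_unique:
  fixes \<mu> \<nu> :: "'a::real_inner measure"
  assumes sep: "separable_space (euclidean :: 'a topology)"
    and pm: "prob_space \<mu>" "prob_space \<nu>" and sets: "sets \<mu> = sets borel" "sets \<nu> = sets borel"
    and eq: "\<And>h. (CLINT x|\<mu>. iexp (inner h x)) = (CLINT x|\<nu>. iexp (inner h x))"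
  shows "\<mu> = \<nu>"
proof -
  interpret \<mu>: prob_space \<mu> by fact
  interpret \<nu>: prob_space \<nu> by fact
  define cyl :: "('a \<times> real) list \<Rightarrow> 'a set" where "cyl L = {x. \<forall>(h, c)\<in>set L. inner h x \<le> c}" for L
  have cyl_Cons: "indicator (cyl ((h, c) # L)) x = (indicator (cyl L) x * indicator {..c} (inner h x) :: real)" for h c L x
    by (auto simp: cyl_def indicator_def)
  have cyl_sets: "cyl L \<in> sets borel" for L
  proof -
    have "cyl L = (\<Inter>p\<in>set L. {x. inner (fst p) x \<le> snd p})" by (auto simp: cyl_def case_prod_beta)
    then have "closed (cyl L)" by (simp add: closed_INT closed_Collect_le continuous_intros)
    then show ?thesis by simp
  qed
  have chars: "(CLINT x|\<mu>. of_real (indicator (cyl L) x) * iexp (inner k x))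
      = (CLINT x|\<nu>. of_real (indicator (cyl L) x) * iexp (inner k x))" for L k
  proof (induction L arbitrary: k)
    case Nil
    then show ?case using eq by (simp add: cyl_def)
  next
    case (Cons p L)
    obtain h c where p: "p = (h, c)" by fastforce
    show ?case
      unfolding p cyl_Cons
      by (rule char_functional_restrict[OF pm sets _ _ _ Cons]) (auto intro!: borel_measurable_indicator cyl_sets)
  qed
  have "complex_of_real (measure \<mu> (cyl L)) = complex_of_real (measure \<nu> (cyl L))" for L
    using chars[of L 0] cyl_sets[of L] sets by (simp add: integral_of_real)
  then have meas: "emeasure \<mu> (cyl L) = emeasure \<nu> (cyl L)" for L
    by (simp add: \<mu>.emeasure_eq_measure \<nu>.emeasure_eq_measure)
  have sig: "sets (borel :: 'a measure) = sigma_sets UNIV (range cyl)"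
    unfolding sets_borel_eq_halfspaces[OF sep]
  proof (rule sigma_sets_eqI)
    fix a :: "'a set" assume "a \<in> range (\<lambda>(h, c). {x. inner h x \<le> c})"
    then obtain h c where "a = {x. inner h x \<le> c}" by auto
    then have "a = cyl [(h, c)]" by (simp add: cyl_def)
    then show "a \<in> sigma_sets UNIV (range cyl)" by auto
  next
    fix b assume "b \<in> range cyl"
    then show "b \<in> sigma_sets UNIV (range (\<lambda>(h, c). {x. inner h x \<le> c}))"
      using cyl_sets sets_borel_eq_halfspaces[OF sep] by auto
  qed
  show ?thesis
  proof (rule measure_eqI_generator_eq[where E="range cyl" and \<Omega>=UNIV and A="\<lambda>_. UNIV"])
    show "Int_stable (range cyl)"
    proof (rule Int_stableI_image)
      fix L L' show "\<exists>k\<in>UNIV. cyl L \<inter> cyl L' = cyl k"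
        by (rule bexI[where x="L @ L'"]) (auto simp: cyl_def)
    qed
    show "range (\<lambda>_::nat. UNIV) \<subseteq> range cyl" using cyl_def[of "[]"] by (auto intro: image_eqI[where x="[]"])
  qed (use meas sets sig in auto)
qed

section \<open>Gaussian measures\<close>

lemma distr_std_normal_affine:
  assumes "\<sigma> > 0"
  shows "distr std_normal_distribution borel (\<lambda>x. m + \<sigma> * x) = density lborel (normal_density m \<sigma>)"
proof -
  interpret prob_space std_normal_distribution by (rule prob_space_normal_density) simp
  have "distributed std_normal_distribution lborel (\<lambda>x. x) (normal_density 0 1)"
    by (auto simp: distributed_def distr_id2)
  from normal_density_affine[OF this, of \<sigma> m]
  have "distributed std_normal_distribution lborel (\<lambda>x. m + \<sigma> * x) (normal_density m \<sigma>)"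
    using assms by simp
  then have "distr std_normal_distribution lborel (\<lambda>x. m + \<sigma> * x) = density lborel (normal_density m \<sigma>)"
    by (simp add: distributed_def)
  then show ?thesis by (metis distr_cong sets_lborel)
qed

lemma char_normal:
  assumes "\<sigma> > 0"
  shows "char (density lborel (normal_density m \<sigma>)) t = iexp (t * m) * of_real (exp (- (\<sigma> * t)\<^sup>2 / 2))"
proof -
  have "char (density lborel (normal_density m \<sigma>)) t = (CLINT x|std_normal_distribution. iexp (t * (m + \<sigma> * x)))"
    unfolding distr_std_normal_affine[OF assms, symmetric] char_def by (subst integral_distr) auto
  also have "\<dots> = (CLINT x|std_normal_distribution. iexp (t * m) * iexp ((\<sigma> * t) * x))"
    by (simp add: exp_add[symmetric] algebra_simps)
  also have "\<dots> = iexp (t * m) * char std_normal_distribution (\<sigma> * t)" by (simp add: char_def)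
  finally show ?thesis by (simp add: char_std_normal_distribution)
qed

text \<open>For linear \<open>K\<close> this is equivalent to \<open>is_gaussian\<close>, without
  its case split on zero variance; in this form a change of density becomes a computation with
  exponentials.\<close>

definition has_gaussian_char :: "'a::real_inner measure \<Rightarrow> 'a \<Rightarrow> ('a \<Rightarrow> 'a) \<Rightarrow> bool" where
  "has_gaussian_char \<mu> a K \<longleftrightarrow> prob_space \<mu> \<and> sets \<mu> = sets borel \<and>
     (\<forall>h. (CLINT x|\<mu>. iexp (inner h x)) = iexp (inner h a) * of_real (exp (- inner (K h) h / 2)))"

lemma char_distr_inner:
  fixes \<mu> :: "'a::real_inner measure"
  assumes "sets \<mu> = sets borel"
  shows "char (distr \<mu> borel (\<lambda>x. inner h x)) t = (CLINT x|\<mu>. iexp (inner (t *\<^sub>R h) x))"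
proof -
  note [measurable] = borel_measurable_inner_const'[OF assms]
  show ?thesis unfolding char_def by (subst integral_distr) auto
qed

lemma is_gaussian_imp_char:
  assumes "is_gaussian \<mu> a K" and "\<And>h. 0 \<le> inner (K h) h"
  shows "has_gaussian_char \<mu> a K"
  unfolding has_gaussian_char_def
proof (intro conjI allI)
  show p: "prob_space \<mu>" "sets \<mu> = sets borel" using assms by (auto simp: is_gaussian_def)
  fix h
  let ?v = "inner (K h) h"
  have d: "distr \<mu> borel (\<lambda>x. inner h x) = (if ?v = 0 then return borel (inner h a)
         else density lborel (normal_density (inner h a) (sqrt ?v)))"
    using assms by (auto simp: is_gaussian_def)
  have c: "(CLINT x|\<mu>. iexp (inner h x)) = char (distr \<mu> borel (\<lambda>x. inner h x)) 1"
    using char_distr_inner[OF p(2), of h 1] by simp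
  note [measurable] = borel_measurable_inner_const'[OF p(2)]
  show "(CLINT x|\<mu>. iexp (inner h x)) = iexp (inner h a) * of_real (exp (- ?v / 2))"
  proof (cases "?v = 0")
    case True
    then show ?thesis unfolding c d by (simp add: char_def integral_return)
  next
    case False
    then have "?v > 0" using assms(2)[of h] by simp
    then show ?thesis unfolding c d by (simp add: char_normal)
  qed
qed

text \<open>A characteristic functional has modulus at most 1, so the exponent cannot be positive.
  Positivity of the updated covariances thus follows from their being covariances.\<close>

lemma has_gaussian_char_nonneg:
  assumes "has_gaussian_char \<mu> a K"
  shows "0 \<le> inner (K h) h"
proof -
  interpret prob_space \<mu> using assms by (simp add: has_gaussian_char_def)
  have "exp (- inner (K h) h / 2) = norm (iexp (inner h a) * complex_of_real (exp (- inner (K h) h / 2)))"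
    by (simp add: norm_mult)
  also have "\<dots> = norm (CLINT x|\<mu>. iexp (inner h x))" using assms by (simp add: has_gaussian_char_def)
  also have "\<dots> \<le> (LINT x|\<mu>. norm (iexp (inner h x)))" by (rule integral_norm_bound)
  also have "\<dots> = 1" by (simp add: prob_space)
  finally show ?thesis by simp
qed

text \<open>Linearity of \<open>K\<close> makes the exponent along \<open>t *\<^sub>R h\<close>
  quadratic in \<open>t\<close>, and one-dimensional uniqueness identifies the marginal, which is a
  point mass when the variance is zero.\<close>

lemma has_gaussian_char_imp_is_gaussian:
  assumes \<mu>: "has_gaussian_char \<mu> a K" and K: "linear K"
  shows "is_gaussian \<mu> a K"
  unfolding is_gaussian_def
proof (intro conjI allI)
  show p: "sets \<mu> = sets borel" "prob_space \<mu>" using \<mu> by (auto simp: has_gaussian_char_def)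
  interpret \<mu>: prob_space \<mu> by fact
  fix h
  note [measurable] = borel_measurable_inner_const'[OF p(1)]
  define v where "v = inner (K h) h"
  have v: "v \<ge> 0" unfolding v_def by (rule has_gaussian_char_nonneg[OF \<mu>])
  have D: "real_distribution (distr \<mu> borel (\<lambda>x. inner h x))" by (rule \<mu>.real_distribution_distr) simp
  have c: "char (distr \<mu> borel (\<lambda>x. inner h x)) t = iexp (t * inner h a) * of_real (exp (- (t\<^sup>2 * v) / 2))" for t
  proof -
    have "char (distr \<mu> borel (\<lambda>x. inner h x)) t
        = iexp (inner (t *\<^sub>R h) a) * of_real (exp (- inner (K (t *\<^sub>R h)) (t *\<^sub>R h) / 2))"
      unfolding char_distr_inner[OF p(1)] using \<mu> unfolding has_gaussian_char_def by blast
    then show ?thesis by (simp add: linear_scale[OF K] v_def power2_eq_square mult.assoc)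
  qed
  show "distr \<mu> borel (\<lambda>x. inner h x) =
        (if inner (K h) h = 0 then return borel (inner h a)
         else density lborel (normal_density (inner h a) (sqrt (inner (K h) h))))"
  proof (cases "v = 0")
    case True
    have "distr \<mu> borel (\<lambda>x. inner h x) = return borel (inner h a)"
    proof (rule Levy_uniqueness[OF D])
      show "real_distribution (return borel (inner h a))"
        by (auto simp: real_distribution_def real_distribution_axioms_def prob_space_return)
      show "char (distr \<mu> borel (\<lambda>x. inner h x)) = char (return borel (inner h a))"
        using c True by (auto simp: char_def integral_return)
    qed
    then show ?thesis using True by (simp add: v_def)
  next
    case False
    then have v: "v > 0" using v by simp
    have "distr \<mu> borel (\<lambda>x. inner h x) = density lborel (normal_density (inner h a) (sqrt v))"
    proof (rule Levy_uniqueness[OF D])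
      show "real_distribution (density lborel (normal_density (inner h a) (sqrt v)))"
        using v by (auto simp: real_distribution_def real_distribution_axioms_def prob_space_normal_density)
      show "char (distr \<mu> borel (\<lambda>x. inner h x)) = char (density lborel (normal_density (inner h a) (sqrt v)))"
        using v c by (auto simp: char_normal power_mult_distrib mult.commute)
    qed
    then show ?thesis using v by (simp add: v_def)
  qed
qed

lemma gaussian_eqI:
  fixes \<mu> :: "'a::real_inner measure"
  assumes sep: "separable_space (euclidean :: 'a topology)"
    and \<mu>: "has_gaussian_char \<mu> a K" and K: "linear K"
  shows "gaussian a K = \<mu>"
  unfolding gaussian_def
proof (rule the_equality)
  show "is_gaussian \<mu> a K" by (rule has_gaussian_char_imp_is_gaussian[OF \<mu> K])
  fix \<nu> assume "is_gaussian \<nu> a K"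
  then have "has_gaussian_char \<nu> a K"
    using has_gaussian_char_nonneg[OF \<mu>] by (rule is_gaussian_imp_char)
  then show "\<nu> = \<mu>" using \<mu> by (intro char_functional_unique[OF sep]) (auto simp: has_gaussian_char_def)
qed

lemma gaussian_second_moment:
  assumes \<mu>: "is_gaussian \<mu> m K" and v: "0 \<le> inner (K a) a"
  shows "integrable \<mu> (\<lambda>x. (z - inner a x)\<^sup>2)"
    and "(LINT x|\<mu>. (z - inner a x)\<^sup>2) = inner (K a) a + (z - inner a m)\<^sup>2"
proof -
  define v where "v = inner (K a) a"
  define b where "b = inner a m"
  have p: "sets \<mu> = sets borel" "prob_space \<mu>" using \<mu> by (auto simp: is_gaussian_def)
  note [measurable] = borel_measurable_inner_const'[OF p(1)]
  have d: "distr \<mu> borel (\<lambda>x. inner a x) = (if v = 0 then return borel b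
         else density lborel (normal_density b (sqrt v)))"
    using \<mu> by (auto simp: is_gaussian_def v_def b_def)
  have "has_bochner_integral (distr \<mu> borel (\<lambda>x. inner a x)) (\<lambda>t. (z - t)\<^sup>2) (v + (z - b)\<^sup>2)"
  proof (cases "v = 0")
    case True
    have "integrable (return borel b) (\<lambda>t. (z - t)\<^sup>2)"
      by (subst integrable_cong_AE[of _ _ "\<lambda>t. (z - b)\<^sup>2"])
        (auto simp: AE_return intro!: finite_measure.integrable_const prob_space.finite_measure prob_space_return)
    then show ?thesis unfolding d using True by (simp add: has_bochner_integral_iff integral_return)
  next
    case False
    then have v: "sqrt v > 0" "v > 0" using assms(2) by (auto simp: v_def)
    \<comment> \<open>The square is expanded around the mean \<open>b\<close>, where the moments of
      order 0, 1, 2 are 1, 0 and \<open>v\<close>.\<close>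
    have 0: "has_bochner_integral lborel (normal_density b (sqrt v)) 1"
      using v by (simp add: has_bochner_integral_iff)
    have 1: "has_bochner_integral lborel (\<lambda>x. normal_density b (sqrt v) x * (x - b)) 0"
      using normal_moment_odd[OF v(1), of b 0] by simp
    have 2: "has_bochner_integral lborel (\<lambda>x. normal_density b (sqrt v) x * (x - b)\<^sup>2) v"
      using normal_moment_even[OF v(1), of b 1] v by (simp add: numeral_2_eq_2[symmetric])
    have "has_bochner_integral lborel (\<lambda>x. (z - b)\<^sup>2 * normal_density b (sqrt v) x
        - 2 * (z - b) * (normal_density b (sqrt v) x * (x - b)) + normal_density b (sqrt v) x * (x - b)\<^sup>2)
        ((z - b)\<^sup>2 * 1 - 2 * (z - b) * 0 + v)"
      by (intro has_bochner_integral_add has_bochner_integral_diff has_bochner_integral_mult_right 0 1 2)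
    also have "(\<lambda>x. (z - b)\<^sup>2 * normal_density b (sqrt v) x
        - 2 * (z - b) * (normal_density b (sqrt v) x * (x - b)) + normal_density b (sqrt v) x * (x - b)\<^sup>2)
       = (\<lambda>x. normal_density b (sqrt v) x *\<^sub>R (z - x)\<^sup>2)"
      by (auto simp: fun_eq_iff power2_eq_square algebra_simps)
    finally have "has_bochner_integral (density lborel (normal_density b (sqrt v))) (\<lambda>t. (z - t)\<^sup>2) (v + (z - b)\<^sup>2)"
      by (intro has_bochner_integral_density) (auto simp: add.commute)
    then show ?thesis unfolding d using False by simp
  qed
  then have I: "integrable (distr \<mu> borel (\<lambda>x. inner a x)) (\<lambda>t. (z - t)\<^sup>2)"
    "integral\<^sup>L (distr \<mu> borel (\<lambda>x. inner a x)) (\<lambda>t. (z - t)\<^sup>2) = v + (z - b)\<^sup>2"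
    by (auto simp: has_bochner_integral_iff)
  show "integrable \<mu> (\<lambda>x. (z - inner a x)\<^sup>2)" using I(1) by (subst (asm) integrable_distr_eq) auto
  show "(LINT x|\<mu>. (z - inner a x)\<^sup>2) = inner (K a) a + (z - inner a m)\<^sup>2"
    using I(2) by (subst (asm) integral_distr) (auto simp: v_def b_def)
qed

text \<open>Completing the square: the tilted standard normal density is a multiple \<kappa> of the
  normal density with mean \<open>c / (1 + g)\<close> and variance
  \<open>1 / (1 + g)\<close>.\<close>

lemma std_normal_tilted_char:
  fixes g c s :: real
  assumes g: "g \<ge> 0"
  shows "(CLINT \<eta>|std_normal_distribution. iexp (s * \<eta>) * of_real (exp (\<eta> * c - g * \<eta>\<^sup>2 / 2)))
     = iexp (s * c / (1 + g)) * of_real (exp ((c\<^sup>2 - s\<^sup>2) / (2 * (1 + g))) / sqrt (1 + g))"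
proof -
  define \<kappa> where "\<kappa> = exp (c\<^sup>2 / (2 * (1 + g))) / sqrt (1 + g)"
  define \<sigma> where "\<sigma> = 1 / sqrt (1 + g)"
  have \<sigma>: "\<sigma> > 0" "\<sigma>\<^sup>2 = 1 / (1 + g)" using g by (auto simp: \<sigma>_def power_divide)
  have q: "- (\<eta> - c / (1 + g))\<^sup>2 / (2 * \<sigma>\<^sup>2) = (\<eta> * c - g * \<eta>\<^sup>2 / 2) - \<eta>\<^sup>2 / 2 - c\<^sup>2 / (2 * (1 + g))" for \<eta>
  proof -
    define G where "G = 1 + g"
    have G: "G > 0" "g = G - 1" using g by (auto simp: G_def)
    show ?thesis unfolding \<sigma>(2) G_def[symmetric] unfolding G(2) using G(1)
      by (simp add: power2_eq_square field_simps)
  qed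
  have w: "std_normal_density \<eta> * exp (\<eta> * c - g * \<eta>\<^sup>2 / 2) = \<kappa> * normal_density (c / (1 + g)) \<sigma> \<eta>" for \<eta>
  proof -
    have "sqrt (2 * pi * \<sigma>\<^sup>2) = sqrt (2 * pi) / sqrt (1 + g)" unfolding \<sigma>(2) using g by (simp add: real_sqrt_divide)
    moreover have "exp (- (\<eta> - c / (1 + g))\<^sup>2 / (2 * \<sigma>\<^sup>2)) * exp (c\<^sup>2 / (2 * (1 + g)))
        = exp (- \<eta>\<^sup>2 / 2) * exp (\<eta> * c - g * \<eta>\<^sup>2 / 2)"
      unfolding q exp_add[symmetric] by simp
    ultimately show ?thesis
      using g by (simp add: normal_density_def \<kappa>_def mult.commute)
  qed
  have "(CLINT \<eta>|std_normal_distribution. iexp (s * \<eta>) * of_real (exp (\<eta> * c - g * \<eta>\<^sup>2 / 2)))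
     = (CLINT \<eta>|lborel. std_normal_density \<eta> *\<^sub>R (iexp (s * \<eta>) * of_real (exp (\<eta> * c - g * \<eta>\<^sup>2 / 2))))"
    by (subst integral_density) auto
  also have "\<dots> = (CLINT \<eta>|lborel. of_real \<kappa> * (normal_density (c / (1 + g)) \<sigma> \<eta> *\<^sub>R iexp (s * \<eta>)))"
  proof (rule Bochner_Integration.integral_cong[OF refl])
    fix \<eta>
    have "std_normal_density \<eta> *\<^sub>R (iexp (s * \<eta>) * of_real (exp (\<eta> * c - g * \<eta>\<^sup>2 / 2)))
      = of_real (std_normal_density \<eta> * exp (\<eta> * c - g * \<eta>\<^sup>2 / 2)) * iexp (s * \<eta>)"
      by (simp add: scaleR_conv_of_real algebra_simps)
    then show "std_normal_density \<eta> *\<^sub>R (iexp (s * \<eta>) * of_real (exp (\<eta> * c - g * \<eta>\<^sup>2 / 2)))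
      = of_real \<kappa> * (normal_density (c / (1 + g)) \<sigma> \<eta> *\<^sub>R iexp (s * \<eta>))"
      unfolding w by (simp add: scaleR_conv_of_real algebra_simps)
  qed
  also have "\<dots> = of_real \<kappa> * char (density lborel (normal_density (c / (1 + g)) \<sigma>)) s"
    unfolding char_def by (subst integral_density) (auto simp del: mult_scaleR_right)
  also have "\<dots> = of_real \<kappa> * (iexp (s * (c / (1 + g))) * of_real (exp (- (\<sigma> * s)\<^sup>2 / 2)))"
    by (simp only: char_normal[OF \<sigma>(1)])
  also have "\<dots> = iexp (s * c / (1 + g)) * of_real (\<kappa> * exp (- (\<sigma> * s)\<^sup>2 / 2))" by simp
  also have "\<kappa> * exp (- (\<sigma> * s)\<^sup>2 / 2) = exp ((c\<^sup>2 - s\<^sup>2) / (2 * (1 + g))) / sqrt (1 + g)"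
  proof -
    have "- (\<sigma> * s)\<^sup>2 / 2 = - s\<^sup>2 / (2 * (1 + g))" by (simp add: power_mult_distrib \<sigma>(2))
    then show ?thesis
      unfolding \<kappa>_def by (simp only: times_divide_eq_left exp_add[symmetric] add_divide_distrib[symmetric]) simp
  qed
  finally show ?thesis .
qed

text \<open>Writing \<open>exp (-t\<^sup>2/2)\<close> as the average of \<open>iexp (\<eta> t)\<close> over a standard normal \<open>\<eta>\<close> turns the likelihood into a
  mixture of characters, whose \<open>\<mu>\<close>-integrals are known.\<close>

lemma gaussian_likelihood_char:
  fixes \<mu> :: "'a::real_inner measure"
  assumes \<mu>: "has_gaussian_char \<mu> m K" and K: "linear K" and sym: "\<And>x y. inner (K x) y = inner x (K y)"
  shows "(CLINT x|\<mu>. of_real (exp (- (z - inner a x)\<^sup>2 / 2)) * iexp (inner h x))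
    = iexp (inner h m + (z - inner a m) * inner (K h) a / (1 + inner (K a) a))
      * of_real (exp (- inner (K h) h / 2 + ((inner (K h) a)\<^sup>2 - (z - inner a m)\<^sup>2) / (2 * (1 + inner (K a) a)))
          / sqrt (1 + inner (K a) a))"
proof -
  define s g c where "s = z - inner a m" and "g = inner (K a) a" and "c = inner (K h) a"
  have g: "g \<ge> 0" unfolding g_def by (rule has_gaussian_char_nonneg[OF \<mu>])
  have p: "prob_space \<mu>" "sets \<mu> = sets borel" using \<mu> by (auto simp: has_gaussian_char_def)
  interpret \<mu>: prob_space \<mu> by fact
  interpret N: prob_space std_normal_distribution by (rule prob_space_normal_density) simp
  interpret P: pair_prob_space std_normal_distribution \<mu> ..
  note [measurable] = borel_measurable_inner_const'[OF p(2)]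
  let ?F = "\<lambda>\<eta> x. iexp (\<eta> * (z - inner a x) + inner h x)"
  have hs: "of_real (exp (- (z - inner a x)\<^sup>2 / 2)) * iexp (inner h x) = (CLINT \<eta>|std_normal_distribution. ?F \<eta> x)" for x
  proof -
    have "(CLINT \<eta>|std_normal_distribution. ?F \<eta> x)
       = (CLINT \<eta>|std_normal_distribution. iexp ((z - inner a x) * \<eta>) * iexp (inner h x))"
      by (simp add: exp_add[symmetric] algebra_simps)
    also have "\<dots> = char std_normal_distribution (z - inner a x) * iexp (inner h x)"
      by (simp add: char_def)
    finally show ?thesis by (simp add: char_std_normal_distribution)
  qed
  have int: "integrable (std_normal_distribution \<Otimes>\<^sub>M \<mu>) (case_prod ?F)"
    by (rule P.integrable_const_bound[where B=1]) (auto simp: norm_exp_i_times split_beta)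
  \<comment> \<open>For fixed \<eta> the integrand is, up to a phase, the character at
    \<open>h - \<eta> *\<^sub>R a\<close>; what depends on \<eta> in its value is exactly the tilt
    integrated in the previous lemma.\<close>
  have inner_int: "(CLINT x|\<mu>. ?F \<eta> x) = iexp (inner h m) * of_real (exp (- inner (K h) h / 2))
      * (iexp (s * \<eta>) * of_real (exp (\<eta> * c - g * \<eta>\<^sup>2 / 2)))" for \<eta>
  proof -
    have "(CLINT x|\<mu>. ?F \<eta> x) = (CLINT x|\<mu>. iexp (\<eta> * z) * iexp (inner (h - \<eta> *\<^sub>R a) x))"
      by (simp add: exp_add[symmetric] inner_diff_left algebra_simps)
    also have "\<dots> = iexp (\<eta> * z) * (CLINT x|\<mu>. iexp (inner (h - \<eta> *\<^sub>R a) x))" by simp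
    also have "(CLINT x|\<mu>. iexp (inner (h - \<eta> *\<^sub>R a) x))
      = iexp (inner (h - \<eta> *\<^sub>R a) m) * of_real (exp (- inner (K (h - \<eta> *\<^sub>R a)) (h - \<eta> *\<^sub>R a) / 2))"
      using \<mu> unfolding has_gaussian_char_def by blast
    also have "inner (K (h - \<eta> *\<^sub>R a)) (h - \<eta> *\<^sub>R a) = inner (K h) h - 2 * \<eta> * c + \<eta>\<^sup>2 * g"
      using sym[of a h]
      by (simp add: linear_diff[OF K] linear_scale[OF K] inner_diff_left inner_diff_right c_def g_def
          inner_commute power2_eq_square algebra_simps)
    also have "- (inner (K h) h - 2 * \<eta> * c + \<eta>\<^sup>2 * g) / 2 = - inner (K h) h / 2 + (\<eta> * c - g * \<eta>\<^sup>2 / 2)"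
      by (simp add: field_simps)
    also have "iexp (\<eta> * z) * (iexp (inner (h - \<eta> *\<^sub>R a) m) * of_real (exp (- inner (K h) h / 2 + (\<eta> * c - g * \<eta>\<^sup>2 / 2))))
       = (iexp (\<eta> * z) * iexp (inner (h - \<eta> *\<^sub>R a) m)) * of_real (exp (- inner (K h) h / 2)) * of_real (exp (\<eta> * c - g * \<eta>\<^sup>2 / 2))"
      by (simp only: exp_add of_real_mult mult.assoc)
    also have "iexp (\<eta> * z) * iexp (inner (h - \<eta> *\<^sub>R a) m) = iexp (inner h m) * iexp (s * \<eta>)"
      by (simp add: exp_add[symmetric] inner_diff_left s_def algebra_simps)
    finally show ?thesis by (simp only: mult.assoc mult.left_commute)
  qed
  have "(CLINT x|\<mu>. of_real (exp (- (z - inner a x)\<^sup>2 / 2)) * iexp (inner h x))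
     = (CLINT x|\<mu>. CLINT \<eta>|std_normal_distribution. ?F \<eta> x)" by (simp only: hs)
  also have "\<dots> = (CLINT \<eta>|std_normal_distribution. CLINT x|\<mu>. ?F \<eta> x)"
    by (rule P.Fubini_integral[OF int])
  also have "\<dots> = (CLINT \<eta>|std_normal_distribution. iexp (inner h m) * of_real (exp (- inner (K h) h / 2))
      * (iexp (s * \<eta>) * of_real (exp (\<eta> * c - g * \<eta>\<^sup>2 / 2))))" by (simp only: inner_int)
  also have "\<dots> = iexp (inner h m) * of_real (exp (- inner (K h) h / 2))
      * (CLINT \<eta>|std_normal_distribution. (iexp (s * \<eta>) * of_real (exp (\<eta> * c - g * \<eta>\<^sup>2 / 2))))" by (rule integral_mult_right_zero)
  also have "\<dots> = iexp (inner h m) * of_real (exp (- inner (K h) h / 2))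
      * (iexp (s * c / (1 + g)) * of_real (exp ((c\<^sup>2 - s\<^sup>2) / (2 * (1 + g))) / sqrt (1 + g)))"
    by (simp only: std_normal_tilted_char[OF g])
  also have "\<dots> = iexp (inner h m + s * c / (1 + g))
      * of_real (exp (- inner (K h) h / 2 + (c\<^sup>2 - s\<^sup>2) / (2 * (1 + g))) / sqrt (1 + g))"
    by (simp only: exp_add of_real_add of_real_mult of_real_divide distrib_left mult.assoc mult.left_commute
        times_divide_eq_right)
  finally show ?thesis by (simp only: s_def c_def g_def)
qed

text \<open>This is Bayes' rule for one observation \<open>z\<close> of \<open>inner a x\<close>
  with unit noise. The constant \<open>sqrt (1 + g) * exp (s\<^sup>2 / (2 * (1 + g)))\<close> is the
  reciprocal of the mean likelihood, found by putting \<open>h = 0\<close> in the preceding formula;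
  the new mean and covariance are read off the exponent.\<close>

lemma gaussian_scalar_update:
  fixes \<mu> :: "'a::real_inner measure" and a :: 'a and z :: real
  assumes \<mu>: "has_gaussian_char \<mu> m K" and K: "linear K" and sym: "\<And>x y. inner (K x) y = inner x (K y)"
  defines "g \<equiv> inner (K a) a" and "s \<equiv> z - inner a m"
  shows "has_gaussian_char
    (density \<mu> (\<lambda>x. ennreal (sqrt (1 + g) * exp (s\<^sup>2 / (2 * (1 + g)) - (z - inner a x)\<^sup>2 / 2))))
    (m + (s / (1 + g)) *\<^sub>R K a) (\<lambda>h. K h - (inner (K h) a / (1 + g)) *\<^sub>R K a)"
proof -
  have g: "g \<ge> 0" unfolding g_def by (rule has_gaussian_char_nonneg[OF \<mu>])
  have p: "prob_space \<mu>" "sets \<mu> = sets borel" using \<mu> by (auto simp: has_gaussian_char_def)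
  interpret \<mu>: prob_space \<mu> by fact
  note [measurable] = borel_measurable_inner_const'[OF p(2)]
  define f where "f x = sqrt (1 + g) * exp (s\<^sup>2 / (2 * (1 + g)) - (z - inner a x)\<^sup>2 / 2)" for x
  define \<nu> where "\<nu> = density \<mu> (\<lambda>x. ennreal (f x))"
  have f: "f \<in> borel_measurable \<mu>" "\<And>x. f x \<ge> 0" using g by (auto simp: f_def[abs_def])
  note [measurable] = f(1)
  have fe: "f x = sqrt (1 + g) * exp (s\<^sup>2 / (2 * (1 + g))) * exp (- (z - inner a x)\<^sup>2 / 2)" for x
    by (simp add: f_def mult.assoc exp_add[symmetric])
  have bd: "\<bar>f x\<bar> \<le> sqrt (1 + g) * exp (s\<^sup>2 / (2 * (1 + g)))" for x
    unfolding fe using g by (simp add: mult_le_cancel_left1 abs_mult)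
  have char: "(CLINT x|\<mu>. of_real (f x) * iexp (inner h x))
      = iexp (inner h (m + (s / (1 + g)) *\<^sub>R K a))
        * of_real (exp (- inner (K h - (inner (K h) a / (1 + g)) *\<^sub>R K a) h / 2))" for h
  proof -
    let ?q = "sqrt (1 + g) * exp (s\<^sup>2 / (2 * (1 + g)))"
    have "(CLINT x|\<mu>. of_real (f x) * iexp (inner h x))
       = (CLINT x|\<mu>. of_real ?q * (of_real (exp (- (z - inner a x)\<^sup>2 / 2)) * iexp (inner h x)))"
      by (simp only: fe of_real_mult mult.assoc)
    also have "\<dots> = of_real ?q * (CLINT x|\<mu>. of_real (exp (- (z - inner a x)\<^sup>2 / 2)) * iexp (inner h x))"
      by (rule integral_mult_right_zero)
    also have "\<dots> = iexp (inner h m + s * inner (K h) a / (1 + g))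
        * of_real (?q * (exp (- inner (K h) h / 2 + ((inner (K h) a)\<^sup>2 - s\<^sup>2) / (2 * (1 + g))) / sqrt (1 + g)))"
      unfolding gaussian_likelihood_char[OF \<mu> K sym] g_def[symmetric] s_def[symmetric]
      by (simp only: of_real_mult mult.left_commute)
    also have "?q * (exp (- inner (K h) h / 2 + ((inner (K h) a)\<^sup>2 - s\<^sup>2) / (2 * (1 + g))) / sqrt (1 + g))
       = exp (s\<^sup>2 / (2 * (1 + g)) + (- inner (K h) h / 2 + ((inner (K h) a)\<^sup>2 - s\<^sup>2) / (2 * (1 + g))))"
      unfolding exp_add using g by simp
    also have "s\<^sup>2 / (2 * (1 + g)) + (- inner (K h) h / 2 + ((inner (K h) a)\<^sup>2 - s\<^sup>2) / (2 * (1 + g)))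
       = - inner (K h - (inner (K h) a / (1 + g)) *\<^sub>R K a) h / 2"
    proof -
      have "inner (K a) h = inner (K h) a" using sym[of a h] by (simp add: inner_commute)
      moreover have "x / (2 * G) + (- k / 2 + (c\<^sup>2 - x) / (2 * G)) = - (k - c / G * c) / 2" for x k c G :: real
        by (simp add: diff_divide_distrib power2_eq_square)
      ultimately show ?thesis by (simp only: inner_diff_left inner_scaleR_left)
    qed
    also have "inner h m + s * inner (K h) a / (1 + g) = inner h (m + (s / (1 + g)) *\<^sub>R K a)"
      using sym[of h a] by (simp add: inner_add_right)
    finally show ?thesis .
  qed
  have charD: "(CLINT x|\<nu>. iexp (inner h x)) = (CLINT x|\<mu>. of_real (f x) * iexp (inner h x))" for h
    unfolding \<nu>_def using f(2) by (subst integral_density) (auto simp: scaleR_conv_of_real)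
  have "prob_space \<nu>"
  proof (rule prob_spaceI)
    have int: "integrable \<mu> f"
      using bd f(1) by (intro \<mu>.integrable_const_bound) (auto simp only: real_norm_def intro: AE_I2)
    have "complex_of_real (LINT x|\<mu>. f x) = 1"
      using char[of 0] by (simp add: linear_0[OF K] integral_of_real)
    then have "(LINT x|\<mu>. f x) = 1" by simp
    then have "(\<integral>\<^sup>+x. ennreal (f x) \<partial>\<mu>) = 1"
      using nn_integral_eq_integral[OF int] f(2) by simp
    then show "emeasure \<nu> (space \<nu>) = 1" by (simp add: \<nu>_def emeasure_density)
  qed
  then show ?thesis
    unfolding has_gaussian_char_def f_def[symmetric] \<nu>_def[symmetric]
    using charD char p(2) by (auto simp: \<nu>_def)
qed

text \<open>By \<open>K\<close>-orthogonality the updates in \<open>J\<close> leave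
  \<open>K (a k)\<close>, \<open>inner (a k) m\<close> and \<open>inner (K h) (a k)\<close>
  unchanged, so the scalar update in the next direction is still expressed by the prior
  quantities.\<close>

lemma gaussian_orthogonal_updates:
  fixes \<mu> :: "'a::real_inner measure" and a :: "'j \<Rightarrow> 'a" and z :: "'j \<Rightarrow> real"
  assumes \<mu>: "has_gaussian_char \<mu> m K" and K: "linear K" and sym: "\<And>x y. inner (K x) y = inner x (K y)"
    and J: "finite J" and orth: "\<And>i j. i \<noteq> j \<Longrightarrow> inner (K (a i)) (a j) = 0"
  defines "g \<equiv> \<lambda>j. inner (K (a j)) (a j)" and "s \<equiv> \<lambda>j. z j - inner (a j) m"
  shows "has_gaussian_char
    (density \<mu> (\<lambda>x. ennreal (\<Prod>j\<in>J. sqrt (1 + g j) * exp ((s j)\<^sup>2 / (2 * (1 + g j)) - (z j - inner (a j) x)\<^sup>2 / 2))))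
    (m + (\<Sum>j\<in>J. (s j / (1 + g j)) *\<^sub>R K (a j)))
    (\<lambda>h. K h - (\<Sum>j\<in>J. (inner (K h) (a j) / (1 + g j)) *\<^sub>R K (a j)))"
  using J
proof (induction J)
  case empty
  then show ?case using \<mu> by (simp add: density_1)
next
  case (insert k J)
  define f where "f j x = sqrt (1 + g j) * exp ((s j)\<^sup>2 / (2 * (1 + g j)) - (z j - inner (a j) x)\<^sup>2 / 2)" for j x
  define \<nu> where "\<nu> = density \<mu> (\<lambda>x. ennreal (\<Prod>j\<in>J. f j x))"
  define m' where "m' = m + (\<Sum>j\<in>J. (s j / (1 + g j)) *\<^sub>R K (a j))"
  define K' where "K' h = K h - (\<Sum>j\<in>J. (inner (K h) (a j) / (1 + g j)) *\<^sub>R K (a j))" for h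
  have sets: "sets \<mu> = sets borel" using \<mu> by (simp add: has_gaussian_char_def)
  note [measurable] = borel_measurable_inner_const'[OF sets]
  have fm: "f j \<in> borel_measurable \<mu>" for j unfolding f_def by measurable
  note [measurable] = fm
  have g: "g j \<ge> 0" for j unfolding g_def by (rule has_gaussian_char_nonneg[OF \<mu>])
  have f0: "f j x \<ge> 0" for j x using g[of j] by (simp add: f_def)
  have IH: "has_gaussian_char \<nu> m' K'" using insert.IH by (simp add: \<nu>_def f_def m'_def K'_def[abs_def])
  have orth_k: "inner (K (a k)) (a j) = 0" "inner (a k) (K (a j)) = 0" if "j \<in> J" for j
    using insert.hyps that orth[of k j] sym[of "a k" "a j"] by auto
  have K'k: "K' (a k) = K (a k)"
  proof -
    have "(\<Sum>j\<in>J. (inner (K (a k)) (a j) / (1 + g j)) *\<^sub>R K (a j)) = 0"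
      by (intro sum.neutral) (auto simp: orth_k)
    then show ?thesis by (simp add: K'_def)
  qed
  have m'k: "inner (a k) m' = inner (a k) m"
  proof -
    have "(\<Sum>j\<in>J. s j / (1 + g j) * inner (a k) (K (a j))) = 0"
      by (intro sum.neutral) (auto simp: orth_k)
    then show ?thesis by (simp add: m'_def inner_add_right inner_sum_right)
  qed
  have lin: "linear K'"
    unfolding K'_def[abs_def]
    by (intro linear_compose_sub K linear_compose_sum ballI linearI)
      (auto simp: linear_add[OF K] linear_scale[OF K] inner_add_left add_divide_distrib scaleR_add_left)
  have sym': "inner (K' x) y = inner x (K' y)" for x y
  proof -
    have "inner (a j) (K y) = inner y (K (a j))" for j
      using sym[of "a j" y] by (simp add: inner_commute)
    then show ?thesis
      by (simp add: K'_def inner_diff_left inner_diff_right inner_sum_left inner_sum_right sym mult.commute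
          times_divide_eq_left)
  qed
  have K'a: "inner (K' h) (a k) = inner (K h) (a k)" for h
    by (metis K'k sym sym')
  have "has_gaussian_char (density \<nu> (\<lambda>x. ennreal (f k x)))
     (m' + (s k / (1 + g k)) *\<^sub>R K (a k)) (\<lambda>h. K' h - (inner (K h) (a k) / (1 + g k)) *\<^sub>R K (a k))"
    using gaussian_scalar_update[OF IH lin sym', of "a k" "z k"]
    unfolding K'k m'k K'a f_def g_def s_def .
  moreover have "density \<nu> (\<lambda>x. ennreal (f k x)) = density \<mu> (\<lambda>x. ennreal (\<Prod>j\<in>insert k J. f j x))"
    unfolding \<nu>_def using insert.hyps f0
    by (subst density_density_eq) (auto simp: ennreal_mult' prod_nonneg mult.commute intro!: arg_cong2[where f=density])
  moreover have "m' + (s k / (1 + g k)) *\<^sub>R K (a k) = m + (\<Sum>j\<in>insert k J. (s j / (1 + g j)) *\<^sub>R K (a j))"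
    using insert.hyps by (simp add: m'_def algebra_simps)
  moreover have "(\<lambda>h. K' h - (inner (K h) (a k) / (1 + g k)) *\<^sub>R K (a k))
     = (\<lambda>h. K h - (\<Sum>j\<in>insert k J. (inner (K h) (a j) / (1 + g j)) *\<^sub>R K (a j)))"
    using insert.hyps by (simp add: K'_def algebra_simps fun_eq_iff)
  ultimately show ?case by (simp add: f_def)
qed

section \<open>Existence of Gaussian measures with injective, summable covariance\<close>

lemma product_prob_space_std_normal: "product_prob_space (\<lambda>_::nat. std_normal_distribution)"
  by (auto simp: product_prob_space_def product_prob_space_axioms_def product_sigma_finite_def
      prob_space_imp_sigma_finite prob_space_normal_density)

lemma iid_normal_char_sum:
  "(CLINT \<xi>|PiM UNIV (\<lambda>_::nat. std_normal_distribution). iexp (\<Sum>i<n. b i * \<xi> i))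
     = of_real (exp (- (\<Sum>i<n. (b i)\<^sup>2) / 2))"
proof -
  let ?\<Omega> = "PiM UNIV (\<lambda>_::nat. std_normal_distribution)"
  interpret product_prob_space "\<lambda>_::nat. std_normal_distribution" UNIV
    by (rule product_prob_space_std_normal)
  have comp: "distr ?\<Omega> borel (\<lambda>\<xi>. \<xi> i) = std_normal_distribution" for i
    using PiM_component[of i] by (simp cong: distr_cong)
  have ind: "indep_vars (\<lambda>_. borel) (\<lambda>i \<xi>. b i * \<xi> i) {..<n}"
  proof -
    have "indep_vars (\<lambda>_. std_normal_distribution) (\<lambda>i \<xi>. \<xi> i) UNIV"
      by (subst indep_vars_iff_distr_eq_PiM)
        (auto simp: restrict_UNIV distr_id2 PiM_component)
    then have "indep_vars (\<lambda>_. borel) (\<lambda>i \<xi>. b i * \<xi> i) UNIV"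
      by (rule indep_vars_compose2) auto
    then show ?thesis by (rule indep_vars_subset) auto
  qed
  have [measurable]: "(\<lambda>\<xi>. \<xi> i) \<in> borel_measurable ?\<Omega>" for i
    using measurable_component_singleton[of i UNIV "\<lambda>_. std_normal_distribution"] by simp
  have "(CLINT \<xi>|?\<Omega>. iexp (\<Sum>i<n. b i * \<xi> i)) = char (distr ?\<Omega> borel (\<lambda>\<xi>. \<Sum>i<n. b i * \<xi> i)) 1"
    unfolding char_def by (subst integral_distr) auto
  also have "\<dots> = (\<Prod>i<n. char (distr ?\<Omega> borel (\<lambda>\<xi>. b i * \<xi> i)) 1)"
    by (rule char_distr_sum[OF ind])
  also have "\<dots> = (\<Prod>i<n. char std_normal_distribution (b i))"
  proof (rule prod.cong[OF refl])
    fix i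
    have "char (distr ?\<Omega> borel (\<lambda>\<xi>. b i * \<xi> i)) 1 = (CLINT \<xi>|?\<Omega>. iexp (b i * \<xi> i))"
      unfolding char_def by (subst integral_distr) auto
    also have "\<dots> = char (distr ?\<Omega> borel (\<lambda>\<xi>. \<xi> i)) (b i)"
      unfolding char_def by (subst integral_distr) auto
    finally show "char (distr ?\<Omega> borel (\<lambda>\<xi>. b i * \<xi> i)) 1 = char std_normal_distribution (b i)"
      by (simp only: comp)
  qed
  also have "\<dots> = of_real (exp (- (\<Sum>i<n. (b i)\<^sup>2) / 2))"
    by (simp add: char_std_normal_distribution exp_sum[symmetric] sum_negf[symmetric] sum_divide_distrib
        flip: of_real_prod)
  finally show ?thesis .
qed

text \<open>The law of the sum is recognised as a one-dimensional Gaussian by its characteristic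
  function, whose second moment is already known; zero variance is covered as well.\<close>

lemma iid_normal_sum_second_moment:
  "(\<integral>\<^sup>+\<xi>. ennreal ((\<Sum>i<n. b i * \<xi> i)\<^sup>2) \<partial>PiM UNIV (\<lambda>_::nat. std_normal_distribution))
     = ennreal (\<Sum>i<n. (b i)\<^sup>2)"
proof -
  let ?\<Omega> = "PiM UNIV (\<lambda>_::nat. std_normal_distribution)"
  interpret product_prob_space "\<lambda>_::nat. std_normal_distribution" UNIV
    by (rule product_prob_space_std_normal)
  have [measurable]: "(\<lambda>\<xi>. \<xi> i) \<in> borel_measurable ?\<Omega>" for i
    using measurable_component_singleton[of i UNIV "\<lambda>_. std_normal_distribution"] by simp
  define X where "X \<xi> = (\<Sum>i<n. b i * \<xi> i)" for \<xi> :: "nat \<Rightarrow> real"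
  have [measurable]: "X \<in> borel_measurable ?\<Omega>" unfolding X_def[abs_def] by measurable
  define v where "v = (\<Sum>i<n. (b i)\<^sup>2)"
  have v: "v \<ge> 0" by (simp add: v_def sum_nonneg)
  let ?D = "distr ?\<Omega> borel X"
  have "has_gaussian_char ?D 0 (\<lambda>h. v * h)"
    unfolding has_gaussian_char_def
  proof (intro conjI allI)
    show "prob_space ?D" by (rule P.prob_space_distr) simp
    fix h :: real
    have "(CLINT x|?D. iexp (inner h x)) = (CLINT \<xi>|?\<Omega>. iexp (\<Sum>i<n. (h * b i) * \<xi> i))"
      by (subst integral_distr) (auto simp: X_def sum_distrib_left mult.assoc)
    also have "\<dots> = of_real (exp (- (\<Sum>i<n. (h * b i)\<^sup>2) / 2))" by (rule iid_normal_char_sum)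
    also have "(\<Sum>i<n. (h * b i)\<^sup>2) = v * h * h"
      by (simp add: power_mult_distrib sum_distrib_left[symmetric] v_def power2_eq_square[of h])
    finally show "(CLINT x|?D. iexp (inner h x)) = iexp (inner h 0) * of_real (exp (- inner (v * h) h / 2))"
      by simp
  qed simp
  then have G: "is_gaussian ?D 0 (\<lambda>h. v * h)"
    by (rule has_gaussian_char_imp_is_gaussian) (auto intro!: linearI simp: algebra_simps)
  have "integrable ?D (\<lambda>x. x\<^sup>2)" "(LINT x|?D. x\<^sup>2) = v"
    using gaussian_second_moment[OF G, of 1 0] v by auto
  then have "integrable ?\<Omega> (\<lambda>\<xi>. (X \<xi>)\<^sup>2)" "(LINT \<xi>|?\<Omega>. (X \<xi>)\<^sup>2) = v"
    by (auto simp: integrable_distr_eq integral_distr)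
  then show ?thesis using nn_integral_eq_integral[of ?\<Omega> "\<lambda>\<xi>. (X \<xi>)\<^sup>2"] by (simp add: X_def v_def)
qed

text \<open>\<open>K\<close>-orthonormalising the basis \<open>e\<close> gives a triangular (Cholesky) factorisation of \<open>K\<close>, so every coordinate of
  the Gaussian vector is a finite combination of independent standard normals; square summability of the
  coordinates then only needs their second moments.\<close>

lemma gaussian_exists:
  fixes e :: "nat \<Rightarrow> 'a::{real_inner,complete_space}" and K :: "'a \<Rightarrow> 'a"
  assumes sep: "separable_space (euclidean :: 'a topology)" and e: "is_onb e"
    and K: "positive_op K" and ker: "\<And>x. K x = 0 \<Longrightarrow> x = 0"
    and tr: "summable (\<lambda>k. inner (K (e k)) (e k))"
  shows "\<exists>\<mu>. has_gaussian_char \<mu> a K"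
proof -
  let ?\<Omega> = "PiM UNIV (\<lambda>_::nat. std_normal_distribution)"
  interpret product_prob_space "\<lambda>_::nat. std_normal_distribution" UNIV
    by (rule product_prob_space_std_normal)
  have [measurable]: "(\<lambda>\<xi>. \<xi> i) \<in> borel_measurable ?\<Omega>" for i
    using measurable_component_singleton[of i UNIV "\<lambda>_. std_normal_distribution"] by simp
  have l: "linear K" by (rule positive_op_linear[OF K])
  define w where "w = gram_schmidt K e"
  have orth: "inner (K (w i)) (w j) = 0" if "i \<noteq> j" for i j
    unfolding w_def by (rule gram_schmidt_orthogonal[OF K ker that])
  have span: "e k \<in> span (w ` {..<n})" if "k < n" for k n
    using gram_schmidt_span[OF K ker, of e k] span_mono[of "w ` {..k}" "w ` {..<n}"] that
    by (force simp: w_def)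
  have form: "inner (K x) x = (\<Sum>i<n. (inner (K x) (w i))\<^sup>2)" if "x \<in> span (w ` {..<n})" for x n
    using gram_schmidt_form[OF K ker that[unfolded w_def]] by (simp add: w_def)
  \<comment> \<open>\<open>e k\<close> lies in the span of the vectors \<open>w j\<close> with
    \<open>j \<le> k\<close>, which are \<open>K\<close>-orthogonal to later ones. The factor is
    thus triangular, and lengthening the sum that defines \<open>x k\<close> does not change
    it.\<close>
  have tri: "inner (K (e k)) (w i) = 0" if "k < i" for k i
  proof -
    have "span (w ` {..<i}) \<subseteq> {x. inner (K x) (w i) = 0}"
      by (rule span_minimal)
        (auto simp: orth subspace_def linear_add[OF l] linear_scale[OF l] linear_0[OF l] inner_add_left)
    then show ?thesis using span[OF that] by auto
  qed
  define x where "x k \<xi> = (\<Sum>i\<le>k. inner (K (e k)) (w i) * \<xi> i)" for k and \<xi> :: "nat \<Rightarrow> real"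
  have x_eq: "x k \<xi> = (\<Sum>i<n. inner (K (e k)) (w i) * \<xi> i)" if "k < n" for k n \<xi>
    unfolding x_def using that tri by (intro sum.mono_neutral_left) auto
  have xm [measurable]: "x k \<in> borel_measurable ?\<Omega>" for k unfolding x_def[abs_def] by measurable
  have x2: "(\<integral>\<^sup>+\<xi>. ennreal ((x k \<xi>)\<^sup>2) \<partial>?\<Omega>) = ennreal (inner (K (e k)) (e k))" for k
    using iid_normal_sum_second_moment[of "\<lambda>i. inner (K (e k)) (w i)" "Suc k"]
    by (simp only: x_eq[of k "Suc k", symmetric] lessI form[OF span[OF lessI], symmetric])
  have "(\<integral>\<^sup>+\<xi>. (\<Sum>k. ennreal ((x k \<xi>)\<^sup>2)) \<partial>?\<Omega>) = (\<Sum>k. ennreal (inner (K (e k)) (e k)))"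
    by (subst nn_integral_suminf) (auto simp: x2)
  also have "\<dots> = ennreal (\<Sum>k. inner (K (e k)) (e k))"
    by (intro suminf_ennreal2 tr positive_op_nonneg[OF K])
  finally have AE: "AE \<xi> in ?\<Omega>. (\<Sum>k. ennreal ((x k \<xi>)\<^sup>2)) \<noteq> \<infinity>"
    by (intro nn_integral_PInf_AE) auto
  \<comment> \<open>The choice of \<open>X\<close> from its coordinates is confined to the almost
    sure event \<open>P\<close>. Off \<open>P\<close> the value is \<open>0\<close>, so each
    \<open>inner h (X \<xi>)\<close> is an explicit measurable series or zero.\<close>
  define P where "P \<xi> \<longleftrightarrow> (\<Sum>k. ennreal ((x k \<xi>)\<^sup>2)) \<noteq> \<infinity>" for \<xi>
  have [measurable]: "Measurable.pred ?\<Omega> P" unfolding P_def[abs_def] by measurable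
  define X where "X \<xi> = (if P \<xi> then SOME u. \<forall>k. inner u (e k) = x k \<xi> else 0)" for \<xi>
  have X: "inner (X \<xi>) (e k) = x k \<xi>" if "P \<xi>" for \<xi> k
  proof -
    have "summable (\<lambda>k. (x k \<xi>)\<^sup>2)"
      using that unfolding P_def by (intro summable_suminf_not_top) auto
    then have "\<exists>u. \<forall>k. inner u (e k) = x k \<xi>" by (rule riesz_fischer[OF e])
    then have "\<forall>k. inner (SOME u. \<forall>k. inner u (e k) = x k \<xi>) (e k) = x k \<xi>" by (rule someI_ex)
    then show ?thesis using that by (simp add: X_def)
  qed
  have X_sums: "(\<lambda>k. inner h (e k) * x k \<xi>) sums inner h (X \<xi>)" if "P \<xi>" for h \<xi>
    using onb_parseval[OF e, of h "X \<xi>"] by (simp add: X[OF that])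
  have inner_X: "inner h (X \<xi>) = (if P \<xi> then \<Sum>k. inner h (e k) * x k \<xi> else 0)" for h \<xi>
    using sums_unique[OF X_sums] by (auto simp: X_def)
  have Xm [measurable]: "(\<lambda>\<xi>. inner h (X \<xi>)) \<in> borel_measurable ?\<Omega>" for h
    unfolding inner_X by measurable
  have aXm [measurable]: "(\<lambda>\<xi>. a + X \<xi>) \<in> borel_measurable ?\<Omega>"
    by (rule measurable_inner_halfspaces[OF sep]) (simp add: inner_add_right)
  let ?\<mu> = "distr ?\<Omega> borel (\<lambda>\<xi>. a + X \<xi>)"
  have "has_gaussian_char ?\<mu> a K"
    unfolding has_gaussian_char_def
  proof (intro conjI allI)
    show "prob_space ?\<mu>" by (rule P.prob_space_distr) simp
    fix h
    \<comment> \<open>The truncation \<open>h' n\<close> lies in the span of the first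
      \<open>n\<close> vectors \<open>w\<close>, where the exponent is computed exactly. Dominated
      convergence on one side and continuity of \<open>K\<close> on the other remove the
      truncation.\<close>
    define h' where "h' n = (\<Sum>k<n. inner h (e k) *\<^sub>R e k)" for n
    have h': "h' \<longlonglongrightarrow> h" unfolding h'_def[abs_def] by (rule onb_expansion[OF e])
    have h'_span: "h' n \<in> span (w ` {..<n})" for n
      unfolding h'_def by (intro span_sum span_scale span) auto
    have part: "(\<Sum>k<n. inner h (e k) * x k \<xi>) = (\<Sum>i<n. inner (K (h' n)) (w i) * \<xi> i)" for n \<xi>
    proof -
      have "(\<Sum>k<n. inner h (e k) * x k \<xi>) = (\<Sum>k<n. \<Sum>i<n. inner h (e k) * (inner (K (e k)) (w i) * \<xi> i))"
        by (intro sum.cong refl) (simp add: x_eq[of _ n] sum_distrib_left)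
      also have "\<dots> = (\<Sum>i<n. \<Sum>k<n. inner h (e k) * (inner (K (e k)) (w i) * \<xi> i))" by (rule sum.swap)
      also have "\<dots> = (\<Sum>i<n. inner (K (h' n)) (w i) * \<xi> i)"
        by (intro sum.cong refl)
          (simp add: h'_def linear_sum[OF l] linear_scale[OF l] inner_sum_left sum_distrib_right mult.assoc)
      finally show ?thesis .
    qed
    have ch: "(CLINT \<xi>|?\<Omega>. iexp (\<Sum>k<n. inner h (e k) * x k \<xi>)) = of_real (exp (- inner (K (h' n)) (h' n) / 2))" for n
      unfolding part iid_normal_char_sum form[OF h'_span, symmetric] ..
    have "(\<lambda>n. CLINT \<xi>|?\<Omega>. iexp (\<Sum>k<n. inner h (e k) * x k \<xi>)) \<longlonglongrightarrow> (CLINT \<xi>|?\<Omega>. iexp (inner h (X \<xi>)))"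
    proof (rule integral_dominated_convergence[where w="\<lambda>_. 1"])
      show "AE \<xi> in ?\<Omega>. (\<lambda>n. iexp (\<Sum>k<n. inner h (e k) * x k \<xi>)) \<longlonglongrightarrow> iexp (inner h (X \<xi>))"
        using AE
      proof eventually_elim
        case (elim \<xi>)
        then have "(\<lambda>n. \<Sum>k<n. inner h (e k) * x k \<xi>) \<longlonglongrightarrow> inner h (X \<xi>)"
          using X_sums[of \<xi> h] by (simp add: P_def sums_def)
        then show ?case by (intro tendsto_intros)
      qed
    qed (auto simp: norm_exp_i_times)
    moreover have "(\<lambda>n. CLINT \<xi>|?\<Omega>. iexp (\<Sum>k<n. inner h (e k) * x k \<xi>))
        \<longlonglongrightarrow> of_real (exp (- inner (K h) h / 2))"
      unfolding ch by (intro tendsto_intros bounded_linear.tendsto[OF positive_op_bounded_linear[OF K]] h') auto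
    ultimately have lim: "(CLINT \<xi>|?\<Omega>. iexp (inner h (X \<xi>))) = of_real (exp (- inner (K h) h / 2))"
      by (rule LIMSEQ_unique)
    have "(CLINT y|?\<mu>. iexp (inner h y)) = (CLINT \<xi>|?\<Omega>. iexp (inner h a) * iexp (inner h (X \<xi>)))"
      by (subst integral_distr) (auto simp: inner_add_right exp_add distrib_left)
    also have "\<dots> = iexp (inner h a) * (CLINT \<xi>|?\<Omega>. iexp (inner h (X \<xi>)))" by (rule integral_mult_right_zero)
    finally show "(CLINT y|?\<mu>. iexp (inner h y)) = iexp (inner h a) * of_real (exp (- inner (K h) h / 2))"
      by (simp only: lim)
  qed simp
  then show ?thesis by blast
qed

section \<open>Simultaneous diagonalisation\<close>

lemma symmetric_matrix_inner:
  fixes A :: "real^'n^'n"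
  assumes "transpose A = A"
  shows "inner x (A *v y) = inner y (A *v x)"
  by (metis assms dot_lmul_matrix inner_commute transpose_matrix_vector)

lemma matrix_inv_left:
  fixes A :: "real^'n^'n"
  assumes "invertible A"
  shows "matrix_inv A ** A = mat 1"
  using assms someI_ex[of "\<lambda>A'. A ** A' = mat 1 \<and> A' ** A = mat 1"]
  by (auto simp: invertible_def matrix_inv_def)

text \<open>The next vector maximises the Rayleigh quotient of \<open>G\<close> against \<open>\<Gamma>\<close> on the \<open>\<Gamma>\<close>-orthogonal complement of the
  previous ones.\<close>

lemma simultaneous_diagonalisation_aux:
  fixes \<Gamma> G :: "real^'n^'n"
  assumes \<Gamma>: "transpose \<Gamma> = \<Gamma>" "\<And>v. v \<noteq> 0 \<Longrightarrow> 0 < inner v (\<Gamma> *v v)" and G: "transpose G = G"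
    and J: "finite (J :: 'n set)"
  shows "\<exists>u g. \<forall>i\<in>J. (\<forall>j\<in>J. inner (u i) (\<Gamma> *v u j) = (if i = j then 1 else 0)) \<and>
           (\<forall>x. inner (u i) (G *v x) = g i * inner (u i) (\<Gamma> *v x))"
  using J
proof (induction J)
  case (insert k J)
  then obtain u g where u: "\<And>i j. i \<in> J \<Longrightarrow> j \<in> J \<Longrightarrow> inner (u i) (\<Gamma> *v u j) = (if i = j then 1 else 0)"
    and g: "\<And>i x. i \<in> J \<Longrightarrow> inner (u i) (G *v x) = g i * inner (u i) (\<Gamma> *v x)" by blast
  note sym = symmetric_matrix_inner[OF \<Gamma>(1)] symmetric_matrix_inner[OF G]
  define V where "V = {x. \<forall>i\<in>J. inner (u i) (\<Gamma> *v x) = 0}"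
  have V_add: "x + t *\<^sub>R y \<in> V" if "x \<in> V" "y \<in> V" for x y t
    using that by (auto simp: V_def matrix_vector_right_distrib matrix_vector_mult_scaleR inner_add_right)
  have V_scale: "t *\<^sub>R x \<in> V" if "x \<in> V" for x t
    using that by (auto simp: V_def matrix_vector_mult_scaleR)
  have cont: "continuous_on S (\<lambda>x. inner x (A *v x))" "continuous_on S (\<lambda>x. inner y (A *v x))"
    for S y and A :: "real^'n^'n"
    by (intro continuous_intros linear_continuous_on matrix_vector_mul_bounded_linear)+
  define T where "T = sphere 0 1 \<inter> V"
  have "V = (\<Inter>i\<in>J. {x. inner (u i) (\<Gamma> *v x) = 0})" by (auto simp: V_def)
  then have "closed V" using cont(2)[of UNIV] by (auto intro!: closed_INT closed_Collect_eq continuous_on_const)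
  then have "compact T" unfolding T_def by (intro compact_Int_closed compact_sphere)
  moreover have "T \<noteq> {}"
  proof -
    \<comment> \<open>Since \<open>k\<close> is not in \<open>J\<close>, there are fewer constraints
      than dimensions, so the complement \<open>V\<close> contains a unit vector.\<close>
    have "dim ((\<lambda>i. \<Gamma> *v u i) ` J) \<le> card J" using insert.hyps(1) by (intro order_trans[OF dim_le_card' card_image_le]) auto
    also have "\<dots> < CARD('n)" using insert.hyps by (metis finite card_seteq UNIV_I linorder_not_less subset_UNIV)
    finally obtain x where x: "x \<noteq> 0" "\<And>y. y \<in> span ((\<lambda>i. \<Gamma> *v u i) ` J) \<Longrightarrow> orthogonal x y"
      using orthogonal_to_subspace_exists[of "(\<lambda>i. \<Gamma> *v u i) ` J"] by auto
    have "inner (u i) (\<Gamma> *v x) = 0" if "i \<in> J" for i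
      using x(2)[of "\<Gamma> *v u i"] that sym(1)[of "u i" x] by (simp add: orthogonal_def span_base)
    then have "x \<in> V" by (auto simp: V_def)
    then have "(1 / norm x) *\<^sub>R x \<in> T" using x(1) V_scale by (simp add: T_def)
    then show ?thesis by blast
  qed
  moreover have "continuous_on T (\<lambda>x. inner x (G *v x) / inner x (\<Gamma> *v x))"
    using \<Gamma>(2) by (intro continuous_on_divide cont) (auto simp: T_def, metis less_irrefl norm_zero zero_neq_one)
  ultimately obtain p where p: "p \<in> T"
    "\<And>x. x \<in> T \<Longrightarrow> inner x (G *v x) / inner x (\<Gamma> *v x) \<le> inner p (G *v p) / inner p (\<Gamma> *v p)"
    using continuous_attains_sup[of T "\<lambda>x. inner x (G *v x) / inner x (\<Gamma> *v x)"] by blast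
  define \<rho> where "\<rho> = inner p (G *v p) / inner p (\<Gamma> *v p)"
  have pV: "p \<in> V" and p0: "p \<noteq> 0" using p(1) by (auto simp: T_def)
  have pp: "inner p (\<Gamma> *v p) > 0" by (rule \<Gamma>(2)[OF p0])
  have pG: "inner p (G *v p) = \<rho> * inner p (\<Gamma> *v p)" using pp by (simp add: \<rho>_def)
  \<comment> \<open>By maximality of \<rho> the form \<open>Q\<close> is nonnegative on
    \<open>V\<close>, and it vanishes at \<open>p\<close>. A semidefinite form that vanishes at a
    vector vanishes against that vector, which is the eigenvector equation on
    \<open>V\<close>.\<close>
  define Q where "Q x y = \<rho> * inner x (\<Gamma> *v y) - inner x (G *v y)" for x y
  have Q_nonneg: "Q x x \<ge> 0" if x: "x \<in> V" for x
  proof (cases "x = 0")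
    case False
    define y where "y = (1 / norm x) *\<^sub>R x"
    have "y \<in> T" using False V_scale[OF x] by (simp add: T_def y_def)
    then have "y \<noteq> 0" by (auto simp: T_def)
    then have "inner y (G *v y) \<le> \<rho> * inner y (\<Gamma> *v y)"
      using p(2)[OF \<open>y \<in> T\<close>] \<Gamma>(2)[of y] by (simp add: \<rho>_def[symmetric] divide_le_eq)
    then have "(1 / norm x)\<^sup>2 * inner x (G *v x) \<le> (1 / norm x)\<^sup>2 * (\<rho> * inner x (\<Gamma> *v x))"
      by (simp add: y_def matrix_vector_mult_scaleR power2_eq_square algebra_simps)
    then show ?thesis using False by (simp add: Q_def divide_le_cancel)
  qed (simp add: Q_def)
  have Qp: "Q p v = 0" if v: "v \<in> V" for v
  proof (rule ccontr)
    assume nz: "Q p v \<noteq> 0"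
    have q: "0 \<le> 2 * t * Q p v + t\<^sup>2 * Q v v" for t
      using Q_nonneg[OF V_add[OF pV v, of t]] sym(1)[of v p] sym(2)[of v p] pG
      by (simp add: Q_def matrix_vector_right_distrib matrix_vector_mult_scaleR inner_add_left inner_add_right
          power2_eq_square algebra_simps)
    have "Q v v \<ge> 0" by (rule Q_nonneg[OF v])
    \<comment> \<open>The minimising \<open>t\<close> would be \<open>- Q p v / Q v v\<close>; the
      added \<open>1\<close> keeps the denominator positive when \<open>Q v v = 0\<close>.\<close>
    have "0 \<le> 2 * (- Q p v / (Q v v + 1)) * Q p v + (- Q p v / (Q v v + 1))\<^sup>2 * Q v v" by (rule q)
    also have "\<dots> = (Q p v)\<^sup>2 / (Q v v + 1)\<^sup>2 * (- 2 * (Q v v + 1) + Q v v)"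
    proof -
      have "2 * (- q / D) * q + (- q / D)\<^sup>2 * r = q\<^sup>2 / D\<^sup>2 * (- 2 * D + r)" if "D \<noteq> 0" for q D r :: real
        using that by (simp add: field_simps power2_eq_square)
      then show ?thesis using \<open>Q v v \<ge> 0\<close> by (metis add_nonneg_eq_0_iff zero_le_one zero_neq_one)
    qed
    also have "\<dots> < 0"
      using nz \<open>Q v v \<ge> 0\<close> by (intro mult_pos_neg) auto
    finally show False by simp
  qed
  define w where "w = (1 / sqrt (inner p (\<Gamma> *v p))) *\<^sub>R p"
  have wV: "w \<in> V" unfolding w_def by (rule V_scale[OF pV])
  have w1: "inner w (\<Gamma> *v w) = 1"
    using pp by (simp add: w_def matrix_vector_mult_scaleR power2_eq_square[symmetric])
  have wJ: "inner (u i) (\<Gamma> *v w) = 0" "inner w (\<Gamma> *v u i) = 0" "inner w (G *v u i) = 0" if "i \<in> J" for i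
    using wV that g[OF that, of w] sym(1)[of w "u i"] sym(2)[of w "u i"] by (auto simp: V_def)
  have wG: "inner w (G *v x) = \<rho> * inner w (\<Gamma> *v x)" for x
  proof -
    define c where "c i = inner (u i) (\<Gamma> *v x)" for i
    \<comment> \<open>\<open>v\<close> is the part of \<open>x\<close> in \<open>V\<close>. Since
      \<open>w\<close> is orthogonal to each \<open>u i\<close> for both forms, replacing
      \<open>x\<close> by \<open>v\<close> alters neither side of the claim.\<close>
    define v where "v = x - (\<Sum>i\<in>J. c i *\<^sub>R u i)"
    have mv: "inner y (A *v v) = inner y (A *v x) - (\<Sum>i\<in>J. c i * inner y (A *v u i))" for y and A :: "real^'n^'n"
      by (simp add: v_def matrix_vector_mult_diff_distrib linear_sum[OF matrix_vector_mul_linear]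
          matrix_vector_mult_scaleR inner_diff_right inner_sum_right)
    have "inner (u j) (\<Gamma> *v v) = 0" if "j \<in> J" for j
    proof -
      have "(\<Sum>i\<in>J. c i * inner (u j) (\<Gamma> *v u i)) = (\<Sum>i\<in>J. if i = j then c j else 0)"
        using that by (intro sum.cong) (auto simp: u)
      then show ?thesis using that insert.hyps(1) by (simp add: mv c_def[symmetric])
    qed
    then have "Q p v = 0" by (intro Qp) (auto simp: V_def)
    then have "inner w (G *v v) = \<rho> * inner w (\<Gamma> *v v)" by (simp add: w_def Q_def)
    then show ?thesis by (simp add: mv wJ)
  qed
  have "(\<forall>j\<in>insert k J. inner ((u(k := w)) i) (\<Gamma> *v (u(k := w)) j) = (if i = j then 1 else 0)) \<and>
      (\<forall>x. inner ((u(k := w)) i) (G *v x) = (g(k := \<rho>)) i * inner ((u(k := w)) i) (\<Gamma> *v x))"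
    if "i \<in> insert k J" for i
    using that insert.hyps(2) w1 wJ wG u g by auto
  then show ?case by blast
qed simp

lemma simultaneous_diagonalisation:
  fixes \<Gamma> G :: "real^'n^'n"
  assumes \<Gamma>: "transpose \<Gamma> = \<Gamma>" "\<And>v. v \<noteq> 0 \<Longrightarrow> 0 < inner v (\<Gamma> *v v)" and G: "transpose G = G"
  shows "\<exists>(u :: 'n \<Rightarrow> real^'n) g. (\<forall>i j. inner (u i) (\<Gamma> *v u j) = (if i = j then 1 else 0)) \<and>
           (\<forall>i j. inner (u i) (G *v u j) = (if i = j then g i else 0))"
proof -
  obtain u :: "'n \<Rightarrow> real^'n" and g where "\<forall>i. (\<forall>j. inner (u i) (\<Gamma> *v u j) = (if i = j then 1 else 0)) \<and>
      (\<forall>x. inner (u i) (G *v x) = g i * inner (u i) (\<Gamma> *v x))"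
    using simultaneous_diagonalisation_aux[OF assms, of UNIV] by auto
  then have "\<forall>i j. inner (u i) (\<Gamma> *v u j) = (if i = j then 1 else 0)"
    "\<forall>i j. inner (u i) (G *v u j) = (if i = j then g i else 0)" by auto
  then show ?thesis by blast
qed

section \<open>Determinant, inverse and trace under congruence to diagonal form\<close>

context
  fixes u :: "'n \<Rightarrow> real^'n" and N :: "real^'n^'n" and d :: "'n \<Rightarrow> real" and U :: "real^'n^'n"
  assumes diag: "\<And>i j. inner (u i) (N *v u j) = (if i = j then d i else 0)"
    and d: "\<And>i. d i \<noteq> 0"
  defines "U \<equiv> \<chi> i j. u j $ i"
begin

lemma columns_congruence: "(transpose U ** (H ** U)) $ i $ j = inner (u i) (H *v u j)"
proof -
  have "(H ** U) $ k $ j = (H *v u j) $ k" for k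
    by (simp add: U_def matrix_matrix_mult_def matrix_vector_mult_def)
  moreover have "transpose U $ i = u i" by (simp add: U_def transpose_def vec_eq_iff)
  ultimately show ?thesis
    by (subst matrix_matrix_mult_def) (simp add: inner_vec_def[of "u i"])
qed

lemma diag_congruence_det: "det N * (det U)\<^sup>2 = (\<Prod>i\<in>UNIV. d i)"
proof -
  have "det (transpose U ** (N ** U)) = (\<Prod>i\<in>UNIV. (transpose U ** (N ** U)) $ i $ i)"
    by (rule det_diagonal) (simp add: columns_congruence diag)
  then show ?thesis by (simp add: columns_congruence diag det_mul det_transpose power2_eq_square mult.left_commute)
qed

lemma diag_congruence_nonsingular: "det N \<noteq> 0" "det U \<noteq> 0"
  using diag_congruence_det d by (auto simp: prod_zero_iff)

text \<open>In matrix terms the inverse is \<open>U\<close> times the inverse diagonal times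
  \<open>transpose U\<close>. It is verified by testing against the vectors \<open>u j\<close>,
  which separate points because \<open>transpose U\<close> is invertible.\<close>

lemma diag_congruence_inverse: "matrix_inv N *v x = (\<Sum>i\<in>UNIV. (inner (u i) x / d i) *\<^sub>R u i)"
proof -
  define r where "r = (\<Sum>i\<in>UNIV. (inner (u i) x / d i) *\<^sub>R u i)"
  have "inner (u j) (N *v r) = inner (u j) x" for j
  proof -
    have "inner (u j) (N *v r) = (\<Sum>i\<in>UNIV. inner (u i) x / d i * inner (u j) (N *v u i))"
      by (simp add: r_def linear_sum[OF matrix_vector_mul_linear] matrix_vector_mult_scaleR inner_sum_right)
    also have "\<dots> = (\<Sum>i\<in>UNIV. if i = j then inner (u j) x else 0)"
      by (intro sum.cong) (auto simp: diag d)
    finally show ?thesis by simp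
  qed
  then have "transpose U *v (N *v r - x) = 0"
    by (simp add: vec_eq_iff matrix_vector_mult_def U_def transpose_def inner_vec_def right_diff_distrib sum_subtractf)
  moreover have "invertible (transpose U)"
    using diag_congruence_nonsingular(2) by (simp add: invertible_det_nz det_transpose)
  ultimately have "N *v r = x"
    by (metis eq_iff_diff_eq_0 invertible_def matrix_vector_mul_assoc matrix_vector_mul_lid matrix_vector_mult_0_right)
  moreover have "matrix_inv N ** N = mat 1"
    using diag_congruence_nonsingular(1) by (simp add: invertible_det_nz matrix_inv_left)
  ultimately show ?thesis by (metis matrix_vector_mul_assoc matrix_vector_mul_lid r_def)
qed

end

text \<open>Orthonormality for \<Gamma> means that its inverse is \<open>U ** transpose U\<close>;
  cyclicity of the trace then moves \<open>transpose U\<close> to the front.\<close>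

lemma diag_congruence_trace:
  fixes u :: "'n \<Rightarrow> real^'n" and \<Gamma> H :: "real^'n^'n"
  assumes "\<And>i j. inner (u i) (\<Gamma> *v u j) = (if i = j then 1 else 0)"
  shows "trace (H ** matrix_inv \<Gamma>) = (\<Sum>i\<in>UNIV. inner (u i) (H *v u i))"
proof -
  define U :: "real^'n^'n" where "U = (\<chi> i j. u j $ i)"
  have "matrix_inv \<Gamma> *v x = (U ** transpose U) *v x" for x
    unfolding matrix_vector_mul_assoc[symmetric]
    using diag_congruence_inverse[of u \<Gamma> "\<lambda>_. 1" x] assms
    by (simp add: U_def vec_eq_iff matrix_vector_mult_def transpose_def inner_vec_def mult.commute)
  then have "matrix_inv \<Gamma> = U ** transpose U" by (simp add: matrix_eq)
  then have "trace (H ** matrix_inv \<Gamma>) = trace (transpose U ** (H ** U))"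
    by (metis matrix_mul_assoc trace_mul_sym)
  then show ?thesis
    using columns_congruence[of u \<Gamma> "\<lambda>_. 1" H] assms by (simp add: trace_def U_def)
qed

text \<open>The same factor \<open>q\<close>, the squared determinant of the basis change, occurs in
  both determinants and cancels in the difference of logarithms.\<close>

lemma diag_congruence_log_det:
  fixes u :: "'n \<Rightarrow> real^'n" and \<Gamma> M :: "real^'n^'n"
  assumes \<Gamma>: "\<And>i j. inner (u i) (\<Gamma> *v u j) = (if i = j then 1 else 0)"
    and M: "\<And>i j. inner (u i) (M *v u j) = (if i = j then d i else 0)" and d: "\<And>i. d i > 0"
  shows "ln (det M) - ln (det \<Gamma>) = (\<Sum>i\<in>UNIV. ln (d i))"
proof -
  define q where "q = (det (\<chi> i j. u j $ i))\<^sup>2"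
  have d': "d i \<noteq> 0" for i using d[of i] by simp
  have 1: "det \<Gamma> * q = 1" using diag_congruence_det[of u \<Gamma> "\<lambda>_. 1"] \<Gamma> by (simp add: q_def)
  have 2: "det M * q = (\<Prod>i\<in>UNIV. d i)" using diag_congruence_det[of u M d] M d' by (simp add: q_def)
  have q: "q > 0" using 1 by (metis mult_zero_right q_def zero_less_power2 zero_neq_one power_zero_numeral)
  have "det \<Gamma> = 1 / q" "det M = (\<Prod>i\<in>UNIV. d i) / q" using 1 2 q by (simp_all add: field_simps)
  then show ?thesis using q d d' by (simp add: ln_div ln_prod prod_pos)
qed

section \<open>Fredholm determinants of finite rank perturbations\<close>

text \<open>Sylvester's identity: the products of \<open>?X\<close> and \<open>?Y\<close> in the two
  orders are both block triangular, one with corner \<open>1 + P * Q\<close>, the other with corner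
  \<open>1 + Q * P\<close>, and their determinants agree.\<close>

lemma det_one_plus_mult_commute:
  fixes P :: "real Matrix.mat"
  assumes P: "P \<in> carrier_mat a b" and Q: "Q \<in> carrier_mat b a"
  shows "Determinant.det (1\<^sub>m a + P * Q) = Determinant.det (1\<^sub>m b + Q * P)"
proof -
  let ?X = "four_block_mat (1\<^sub>m b) (- Q) P (1\<^sub>m a)"
  let ?Y = "four_block_mat (1\<^sub>m b) Q (0\<^sub>m a b) (1\<^sub>m a)"
  note c = P Q uminus_carrier_mat[OF Q] one_carrier_mat zero_carrier_mat
  have X: "?X \<in> carrier_mat (b + a) (b + a)" and Y: "?Y \<in> carrier_mat (b + a) (b + a)"
    using c by auto
  have "?X * ?Y = four_block_mat (1\<^sub>m b) (0\<^sub>m b a) P (1\<^sub>m a + P * Q)"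
  proof -
    have "1\<^sub>m b * 1\<^sub>m b + - Q * 0\<^sub>m a b = 1\<^sub>m b" "1\<^sub>m b * Q + - Q * 1\<^sub>m a = 0\<^sub>m b a"
      "P * 1\<^sub>m b + 1\<^sub>m a * 0\<^sub>m a b = P" "P * Q + 1\<^sub>m a * 1\<^sub>m a = 1\<^sub>m a + P * Q"
      using P Q by (auto intro!: eq_matI simp: comm_add_mat[of "P * Q" a a])
    then show ?thesis using P Q by (subst mult_four_block_mat[of _ b b _ a _ a _ _ b _ a]) auto
  qed
  then have 1: "Determinant.det (?X * ?Y) = Determinant.det (1\<^sub>m a + P * Q)"
    using P Q by (simp add: det_four_block_mat_upper_right_zero[of _ b _ a])
  have "?Y * ?X = four_block_mat (1\<^sub>m b + Q * P) (0\<^sub>m b a) P (1\<^sub>m a)"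
  proof -
    have "1\<^sub>m b * 1\<^sub>m b + Q * P = 1\<^sub>m b + Q * P" "1\<^sub>m b * (- Q) + Q * 1\<^sub>m a = 0\<^sub>m b a"
      "0\<^sub>m a b * 1\<^sub>m b + 1\<^sub>m a * P = P" "0\<^sub>m a b * (- Q) + 1\<^sub>m a * 1\<^sub>m a = 1\<^sub>m a"
      using P Q by (auto intro!: eq_matI)
    then show ?thesis using P Q by (subst mult_four_block_mat[of _ b b _ a _ a _ _ b _ a]) auto
  qed
  then have 2: "Determinant.det (?Y * ?X) = Determinant.det (1\<^sub>m b + Q * P)"
    using P Q by (simp add: det_four_block_mat_upper_right_zero[of _ b _ a])
  show ?thesis using 1 2 det_mult[OF X Y] det_mult[OF Y X] by (simp add: mult.commute)
qed

text \<open>\<open>fin_det\<close> lets the permutation act on the first index, the matrix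
  determinant on the second; hence the transposed matrix.\<close>

lemma fin_det_eq_det: "fin_det n M = Determinant.det (Matrix.mat n n (\<lambda>(i, j). M j i))"
  unfolding fin_det_def
  by (subst det_def'[of _ n]) (auto intro!: sum.cong prod.cong simp: atLeast0LessThan)

lemma fin_det_one_plus_mult_commute:
  "fin_det N (\<lambda>i j. (if i = j then 1 else 0) + (\<Sum>k<n. p k i * q k j))
     = fin_det n (\<lambda>k l. (if k = l then 1 else 0) + (\<Sum>i<N. q k i * p l i))"
proof -
  define P :: "real Matrix.mat" where "P = Matrix.mat N n (\<lambda>(i, k). q k i)"
  define Q :: "real Matrix.mat" where "Q = Matrix.mat n N (\<lambda>(k, i). p k i)"
  have "Matrix.mat N N (\<lambda>(i, j). (if j = i then 1 else 0) + (\<Sum>k<n. p k j * q k i)) = 1\<^sub>m N + P * Q"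
    by (rule eq_matI) (auto simp: P_def Q_def scalar_prod_def atLeast0LessThan mult.commute)
  moreover have "Matrix.mat n n (\<lambda>(k, l). (if l = k then 1 else 0) + (\<Sum>i<N. q l i * p k i)) = 1\<^sub>m n + Q * P"
    by (rule eq_matI) (auto simp: P_def Q_def scalar_prod_def atLeast0LessThan mult.commute)
  ultimately show ?thesis
    unfolding fin_det_eq_det using det_one_plus_mult_commute[of P N n Q] by (simp add: P_def Q_def)
qed

lemma tendsto_fin_det:
  assumes "\<And>i j. i < n \<Longrightarrow> j < n \<Longrightarrow> ((\<lambda>x. M x i j) \<longlongrightarrow> L i j) F"
  shows "((\<lambda>x. fin_det n (M x)) \<longlongrightarrow> fin_det n L) F"
  unfolding fin_det_def
proof (intro tendsto_sum tendsto_mult tendsto_const tendsto_prod)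
  fix p i assume "p \<in> {p. p permutes {..<n}}" "i \<in> {..<n}"
  then have "p i < n" "i < n" using permutes_in_image by fastforce+
  then show "((\<lambda>x. M x (p i) i) \<longlongrightarrow> L (p i) i) F" by (rule assms)
qed

lemma fin_det_diagonal: "fin_det n (\<lambda>i j. if i = j then d i else 0) = (\<Prod>i<n. d i)"
proof -
  have "fin_det n (\<lambda>i j. if i = j then d i else 0)
      = (\<Sum>p\<in>{id}. of_int (sign p) * (\<Prod>i<n. if p i = i then d (p i) else 0))"
    unfolding fin_det_def
  proof (rule sum.mono_neutral_right)
    show "finite {p. p permutes {..<n}}" by (rule finite_permutations) simp
    show "\<forall>p\<in>{p. p permutes {..<n}} - {id}. of_int (sign p) * (\<Prod>i<n. if p i = i then d (p i) else 0) = 0"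
    proof
      fix p assume p: "p \<in> {p. p permutes {..<n}} - {id}"
      then obtain i where "p i \<noteq> i" by (auto simp: fun_eq_iff)
      moreover have "i < n" using p \<open>p i \<noteq> i\<close> by (metis Diff_iff lessThan_iff mem_Collect_eq permutes_not_in)
      ultimately have "(\<Prod>i<n. if p i = i then d (p i) else 0) = 0" by (intro prod_zero) auto
      then show "of_int (sign p) * (\<Prod>i<n. if p i = i then d (p i) else 0) = 0" by simp
    qed
  qed (simp add: permutes_id)
  then show ?thesis by (simp add: sign_id)
qed

lemma inner_finite_rank:
  "inner (\<Sum>k<n. inner (q k) x *\<^sub>R p k) y = (\<Sum>k<n. inner (p k) y * inner (q k) x)"
  unfolding inner_sum_left inner_scaleR_left by (intro sum.cong refl mult.commute)

text \<open>Sylvester's identity trades the growing truncations for determinants of fixed size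
  \<open>n\<close>, whose entries are partial sums of Parseval series. The limit in
  \<open>fredholm_det\<close> then exists entry by entry.\<close>

lemma fredholm_det_finite_rank:
  fixes p q :: "nat \<Rightarrow> 'a::real_inner"
  assumes onb: "is_onb (onb :: nat \<Rightarrow> 'a)"
  shows "fredholm_det (\<lambda>x. \<Sum>k<n. inner (q k) x *\<^sub>R p k)
     = fin_det n (\<lambda>k l. (if k = l then 1 else 0) + inner (q k) (p l))"
proof -
  have "(\<lambda>N. fin_det n (\<lambda>k l. (if k = l then 1 else 0) + (\<Sum>i<N. inner (q k) (onb i) * inner (p l) (onb i))))
      \<longlonglongrightarrow> fin_det n (\<lambda>k l. (if k = l then 1 else 0) + inner (q k) (p l))"
  proof (intro tendsto_fin_det tendsto_add tendsto_const)
    fix k l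
    show "(\<lambda>N. \<Sum>i<N. inner (q k) (onb i) * inner (p l) (onb i)) \<longlonglongrightarrow> inner (q k) (p l)"
      using onb_parseval[OF onb, of "q k" "p l"] by (simp add: sums_def)
  qed
  then show ?thesis
    unfolding fredholm_det_def inner_finite_rank
    by (subst fin_det_one_plus_mult_commute) (rule limI)
qed

lemma op_trace_finite_rank:
  fixes p q :: "nat \<Rightarrow> 'a::real_inner"
  assumes onb: "is_onb (onb :: nat \<Rightarrow> 'a)"
  shows "op_trace (\<lambda>x. \<Sum>k<n. inner (q k) x *\<^sub>R p k) = (\<Sum>k<n. inner (q k) (p k))"
  unfolding op_trace_def inner_finite_rank
proof (intro sums_unique[symmetric] sums_sum)
  fix k
  show "(\<lambda>i. inner (p k) (onb i) * inner (q k) (onb i)) sums inner (q k) (p k)"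
    using onb_parseval[OF onb, of "p k" "q k"] by (simp only: inner_commute[of "q k" "p k"])
qed

section \<open>The two divergences\<close>

text \<open>All dependence on \<gamma> passes through resolvent forms between vectors in the range
  of \<open>K\<close>: the array \<open>F\<close> for trace and determinant, and \<open>K b\<close>
  for the mean. In the limit the determinant becomes diagonal with entries
  \<open>1 - g k / (1 + g k) = 1 / (1 + g k)\<close>.\<close>

lemma KL_gamma_tendsto:
  fixes K :: "'a::{real_inner,complete_space} \<Rightarrow> 'a" and a :: "nat \<Rightarrow> 'a" and s g :: "nat \<Rightarrow> real"
  assumes onb: "is_onb (onb :: nat \<Rightarrow> 'a)" and K: "positive_op K"
    and orth: "\<And>k l. k < n \<Longrightarrow> l < n \<Longrightarrow> inner (K (a k)) (a l) = (if k = l then g k else 0)"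
    and g: "\<And>k. k < n \<Longrightarrow> 0 \<le> g k"
  shows "((\<lambda>\<gamma>. KL_gamma \<gamma> (m + (\<Sum>k<n. (s k / (1 + g k)) *\<^sub>R K (a k)))
             (\<lambda>x. K x - (\<Sum>k<n. (inner (K x) (a k) / (1 + g k)) *\<^sub>R K (a k))) m K)
     \<longlongrightarrow> 1/2 * (\<Sum>k<n. ln (1 + g k) - g k / (1 + g k) + g k * (s k / (1 + g k))\<^sup>2)) (at_right 0)"
proof -
  note l = positive_op_linear[OF K]
  define R where "R \<gamma> = inv_into UNIV (\<lambda>x. K x + \<gamma> *\<^sub>R x)" for \<gamma>
  define F where "F \<gamma> k l = inner (K (a k)) (R \<gamma> (K (a l)))" for \<gamma> k l
  \<comment> \<open>\<open>b\<close> is a preimage under \<open>K\<close> of the mean shift, so the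
    quadratic term is a resolvent form of the convergent kind.\<close>
  define b where "b = (\<Sum>k<n. (s k / (1 + g k)) *\<^sub>R a k)"
  have Kb: "K b = (\<Sum>k<n. (s k / (1 + g k)) *\<^sub>R K (a k))"
    by (simp add: b_def linear_sum[OF l] linear_scale[OF l])
  have F: "((\<lambda>\<gamma>. F \<gamma> k l) \<longlongrightarrow> (if k = l then g k else 0)) (at_right 0)" if "k < n" "l < n" for k l
    using resolvent_form_tendsto[OF K, of "a k" "a l"] orth[OF that] by (simp add: F_def R_def)
  have KL: "KL_gamma \<gamma> (m + (\<Sum>k<n. (s k / (1 + g k)) *\<^sub>R K (a k)))
             (\<lambda>x. K x - (\<Sum>k<n. (inner (K x) (a k) / (1 + g k)) *\<^sub>R K (a k))) m K
      = 1/2 * inner (K b) (R \<gamma> (K b)) + 1/2 * ((\<Sum>k<n. - F \<gamma> k k / (1 + g k))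
        - ln (fin_det n (\<lambda>k l. (if k = l then 1 else 0) + - F \<gamma> k l / (1 + g l))))" if \<gamma>: "\<gamma> > 0" for \<gamma>
  proof -
    have Rl: "linear (R \<gamma>)" unfolding R_def by (rule resolvent_linear[OF K \<gamma>])
    define p where "p k = (- (1 / (1 + g k))) *\<^sub>R R \<gamma> (K (a k))" for k
    have B: "(\<lambda>x. R \<gamma> (K x - (\<Sum>k<n. (inner (K x) (a k) / (1 + g k)) *\<^sub>R K (a k)) - K x))
       = (\<lambda>x. \<Sum>k<n. inner (K (a k)) x *\<^sub>R p k)"
    proof
      fix x
      have "inner (K x) (a k) = inner (K (a k)) x" for k
        using positive_op_sym[OF K, of x "a k"] by (simp add: inner_commute)
      then show "R \<gamma> (K x - (\<Sum>k<n. (inner (K x) (a k) / (1 + g k)) *\<^sub>R K (a k)) - K x) = (\<Sum>k<n. inner (K (a k)) x *\<^sub>R p k)"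
        by (simp add: p_def linear_neg[OF Rl] linear_sum[OF Rl] linear_scale[OF Rl] sum_negf[symmetric])
    qed
    have qp: "inner (K (a k)) (p l) = - F \<gamma> k l / (1 + g l)" for k l by (simp add: p_def F_def)
    show ?thesis
      unfolding KL_gamma_def d1_logdet_def Let_def R_def[symmetric] B unfolding detX_def
      by (simp add: op_trace_finite_rank[OF onb] fredholm_det_finite_rank[OF onb] qp Kb)
  qed
  have "((\<lambda>\<gamma>. inner (K b) (R \<gamma> (K b))) \<longlongrightarrow> inner (K b) b) (at_right 0)"
    unfolding R_def by (rule resolvent_form_tendsto[OF K])
  moreover have "((\<lambda>\<gamma>. \<Sum>k<n. - F \<gamma> k k / (1 + g k)) \<longlongrightarrow> (\<Sum>k<n. - g k / (1 + g k))) (at_right 0)"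
  proof (intro tendsto_sum tendsto_divide tendsto_minus tendsto_const)
    fix k assume "k \<in> {..<n}"
    then show "((\<lambda>\<gamma>. F \<gamma> k k) \<longlongrightarrow> g k) (at_right 0)" "1 + g k \<noteq> 0" using F[of k k] g[of k] by auto
  qed
  moreover have "((\<lambda>\<gamma>. fin_det n (\<lambda>k l. (if k = l then 1 else 0) + - F \<gamma> k l / (1 + g l)))
      \<longlongrightarrow> (\<Prod>k<n. 1 / (1 + g k))) (at_right 0)"
  proof -
    have "((\<lambda>\<gamma>. fin_det n (\<lambda>k l. (if k = l then 1 else 0) + - F \<gamma> k l / (1 + g l)))
      \<longlongrightarrow> fin_det n (\<lambda>k l. if k = l then 1 / (1 + g k) else 0)) (at_right 0)"
    proof (rule tendsto_fin_det)
      fix k l assume kl: "k < n" "l < n"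
      have nz: "1 + g l \<noteq> 0" using g[OF kl(2)] by simp
      have "((\<lambda>\<gamma>. (if k = l then 1 else 0) + - F \<gamma> k l / (1 + g l))
         \<longlongrightarrow> (if k = l then 1 else 0) + - (if k = l then g k else 0) / (1 + g l)) (at_right 0)"
        by (intro tendsto_intros F kl nz)
      moreover have "(if k = l then 1 else 0) + - (if k = l then g k else 0) / (1 + g l) = (if k = l then 1 / (1 + g k) else 0)"
        using nz by (auto simp: field_simps)
      ultimately show "((\<lambda>\<gamma>. (if k = l then 1 else 0) + - F \<gamma> k l / (1 + g l))
         \<longlongrightarrow> (if k = l then 1 / (1 + g k) else 0)) (at_right 0)" by simp
    qed
    then show ?thesis by (simp only: fin_det_diagonal)
  qed
  moreover have "(\<Prod>k<n. 1 / (1 + g k)) \<noteq> 0" using g by (auto simp: add_nonneg_eq_0_iff)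
  ultimately have lim: "((\<lambda>\<gamma>. 1/2 * inner (K b) (R \<gamma> (K b)) + 1/2 * ((\<Sum>k<n. - F \<gamma> k k / (1 + g k))
        - ln (fin_det n (\<lambda>k l. (if k = l then 1 else 0) + - F \<gamma> k l / (1 + g l)))))
      \<longlongrightarrow> 1/2 * inner (K b) b + 1/2 * ((\<Sum>k<n. - g k / (1 + g k)) - ln (\<Prod>k<n. 1 / (1 + g k)))) (at_right 0)"
    by (intro tendsto_add tendsto_diff tendsto_mult tendsto_ln tendsto_const)
  have "inner (K b) b = (\<Sum>k<n. \<Sum>l<n. s k / (1 + g k) * (s l / (1 + g l) * inner (K (a k)) (a l)))"
    unfolding Kb inner_sum_left unfolding b_def inner_sum_right
    by (simp add: sum_distrib_left mult.commute mult.left_commute)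
  also have "\<dots> = (\<Sum>k<n. \<Sum>l<n. if l = k then g k * (s k / (1 + g k))\<^sup>2 else 0)"
    by (intro sum.cong refl) (auto simp: orth power2_eq_square)
  also have "\<dots> = (\<Sum>k<n. g k * (s k / (1 + g k))\<^sup>2)" by simp
  finally have Kbb: "inner (K b) b = (\<Sum>k<n. g k * (s k / (1 + g k))\<^sup>2)" .
  have "ln (\<Prod>k<n. 1 / (1 + g k)) = (\<Sum>k<n. ln (1 / (1 + g k)))"
    by (rule ln_prod) (use g in \<open>auto simp: add_nonneg_eq_0_iff add_pos_nonneg\<close>)
  also have "\<dots> = - (\<Sum>k<n. ln (1 + g k))"
    unfolding sum_negf[symmetric] by (intro sum.cong refl) (use g in \<open>auto simp: ln_div add_pos_nonneg\<close>)
  finally have lnp: "ln (\<Prod>k<n. 1 / (1 + g k)) = - (\<Sum>k<n. ln (1 + g k))" .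
  have val: "1/2 * inner (K b) b + 1/2 * ((\<Sum>k<n. - g k / (1 + g k)) - ln (\<Prod>k<n. 1 / (1 + g k)))
     = 1/2 * (\<Sum>k<n. ln (1 + g k) - g k / (1 + g k) + g k * (s k / (1 + g k))\<^sup>2)"
    unfolding Kbb lnp by (simp add: sum.distrib sum_subtractf sum_negf)
  show ?thesis
    using lim[unfolded val] by (rule Lim_transform_eventually)
      (use KL in \<open>auto simp: eventually_at_filter\<close>)
qed

text \<open>The divergence is the \<nu>-mean of \<open>ln f\<close>, a sum of squares of scalar
  functionals up to constants. Under \<nu> the functional of \<open>a j\<close> has variance
  \<open>g j / (1 + g j)\<close>, and \<open>z j\<close> differs from its mean by
  \<open>s j / (1 + g j)\<close>.\<close>

lemma D_KL_gaussian_orthogonal_updates: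
  fixes K :: "'a::real_inner \<Rightarrow> 'a" and a :: "'j \<Rightarrow> 'a" and z :: "'j \<Rightarrow> real"
  assumes sep: "separable_space (euclidean :: 'a topology)"
    and \<mu>: "has_gaussian_char \<mu> m K" and K: "linear K" and sym: "\<And>x y. inner (K x) y = inner x (K y)"
    and J: "finite J" and orth: "\<And>i j. i \<noteq> j \<Longrightarrow> inner (K (a i)) (a j) = 0"
  defines "g \<equiv> \<lambda>j. inner (K (a j)) (a j)" and "s \<equiv> \<lambda>j. z j - inner (a j) m"
  shows "D_KL (gaussian (m + (\<Sum>j\<in>J. (s j / (1 + g j)) *\<^sub>R K (a j)))
            (\<lambda>x. K x - (\<Sum>j\<in>J. (inner (K x) (a j) / (1 + g j)) *\<^sub>R K (a j)))) (gaussian m K)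
     = 1/2 * (\<Sum>j\<in>J. ln (1 + g j) - g j / (1 + g j) + g j * (s j / (1 + g j))\<^sup>2)"
proof -
  define m' where "m' = m + (\<Sum>j\<in>J. (s j / (1 + g j)) *\<^sub>R K (a j))"
  define C where "C x = K x - (\<Sum>j\<in>J. (inner (K x) (a j) / (1 + g j)) *\<^sub>R K (a j))" for x
  define f where "f x = (\<Prod>j\<in>J. sqrt (1 + g j) * exp ((s j)\<^sup>2 / (2 * (1 + g j)) - (z j - inner (a j) x)\<^sup>2 / 2))" for x
  define \<nu> where "\<nu> = density \<mu> (\<lambda>x. ennreal (f x))"
  have \<nu>: "has_gaussian_char \<nu> m' C"
    using gaussian_orthogonal_updates[OF \<mu> K sym J orth, where z=z]
    unfolding \<nu>_def f_def m'_def C_def[abs_def] g_def s_def by simp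
  have lin: "linear C"
    unfolding C_def[abs_def]
    by (intro linear_compose_sub K linear_compose_sum ballI linearI)
      (auto simp: linear_add[OF K] linear_scale[OF K] inner_add_left add_divide_distrib scaleR_add_left)
  have g: "g j \<ge> 0" for j unfolding g_def by (rule has_gaussian_char_nonneg[OF \<mu>])
  then have g1: "1 + g j > 0" for j by (simp add: add_pos_nonneg)
  have sets: "sets \<mu> = sets borel" and pr: "prob_space \<mu>" using \<mu> by (auto simp: has_gaussian_char_def)
  interpret prob_space \<mu> by fact
  note [measurable] = borel_measurable_inner_const'[OF sets]
  have fm [measurable]: "f \<in> borel_measurable \<mu>" unfolding f_def[abs_def] by measurable
  have fpos: "f x > 0" for x unfolding f_def using g1 by (intro prod_pos) auto
  have lnf: "ln (f x) = (\<Sum>j\<in>J. ln (1 + g j) / 2 + (s j)\<^sup>2 / (2 * (1 + g j)) - 1/2 * (z j - inner (a j) x)\<^sup>2)" for x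
  proof -
    have "ln (f x) = (\<Sum>j\<in>J. ln (sqrt (1 + g j) * exp ((s j)\<^sup>2 / (2 * (1 + g j)) - (z j - inner (a j) x)\<^sup>2 / 2)))"
      unfolding f_def by (rule ln_prod) (use g1 J in \<open>auto simp: less_imp_neq[OF g1, symmetric]\<close>)
    also have "\<dots> = (\<Sum>j\<in>J. ln (1 + g j) / 2 + (s j)\<^sup>2 / (2 * (1 + g j)) - 1/2 * (z j - inner (a j) x)\<^sup>2)"
    proof (rule sum.cong[OF refl])
      fix j
      show "ln (sqrt (1 + g j) * exp ((s j)\<^sup>2 / (2 * (1 + g j)) - (z j - inner (a j) x)\<^sup>2 / 2))
        = ln (1 + g j) / 2 + (s j)\<^sup>2 / (2 * (1 + g j)) - 1/2 * (z j - inner (a j) x)\<^sup>2"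
        using g1[of j] by (subst ln_mult) (auto simp: ln_sqrt)
    qed
    finally show ?thesis .
  qed
  have D: "D_KL \<nu> \<mu> = (LINT x|\<nu>. ln (f x))"
  proof -
    have "D_KL \<nu> \<mu> = (LINT x|\<mu>. f x * log (exp 1) (f x))"
      unfolding D_KL_def \<nu>_def using fpos by (intro KL_density) (auto intro: less_imp_le)
    also have "\<dots> = (LINT x|\<nu>. ln (f x))"
      unfolding \<nu>_def using fpos by (subst integral_real_density) (auto simp: log_def intro: less_imp_le)
    finally show ?thesis .
  qed
  have G\<nu>: "is_gaussian \<nu> m' C" by (rule has_gaussian_char_imp_is_gaussian[OF \<nu> lin])
  note mom = gaussian_second_moment[OF G\<nu> has_gaussian_char_nonneg[OF \<nu>]]
  interpret \<nu>: prob_space \<nu> using \<nu> by (simp add: has_gaussian_char_def)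
  have "(LINT x|\<nu>. ln (f x)) = (\<Sum>j\<in>J. ln (1 + g j) / 2 + (s j)\<^sup>2 / (2 * (1 + g j))
      - 1/2 * (inner (C (a j)) (a j) + (z j - inner (a j) m')\<^sup>2))"
    unfolding lnf using mom by (simp add: \<nu>.prob_space)
  also have "\<dots> = (\<Sum>j\<in>J. 1/2 * (ln (1 + g j) - g j / (1 + g j) + g j * (s j / (1 + g j))\<^sup>2))"
  proof (rule sum.cong[OF refl])
    fix j assume j: "j \<in> J"
    have "inner (\<Sum>i\<in>J. (inner (K (a j)) (a i) / (1 + g i)) *\<^sub>R K (a i)) (a j)
        = (\<Sum>i\<in>J. if i = j then g j * g j / (1 + g j) else 0)"
      unfolding inner_sum_left by (intro sum.cong refl) (auto simp: g_def orth)
    then have C: "inner (C (a j)) (a j) = g j - g j * g j / (1 + g j)"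
      using j J by (simp add: C_def inner_diff_left) (simp add: g_def)
    have "inner (a j) (\<Sum>i\<in>J. (s i / (1 + g i)) *\<^sub>R K (a i)) = (\<Sum>i\<in>J. if i = j then s j / (1 + g j) * g j else 0)"
    proof -
      have "inner (a j) (K (a i)) = (if i = j then g j else 0)" for i
        using sym[of "a j" "a i"] orth[of j i] by (auto simp: g_def)
      then show ?thesis unfolding inner_sum_right by (intro sum.cong refl) simp
    qed
    then have m': "z j - inner (a j) m' = s j - s j / (1 + g j) * g j"
      using j J by (simp add: m'_def inner_add_right s_def)
    define G where "G = 1 + g j"
    have G: "G > 0" "g j = G - 1" using g1[of j] by (auto simp: G_def)
    have "ln G / 2 + t\<^sup>2 / (2 * G) - 1/2 * ((G - 1) - (G - 1) * (G - 1) / G + (t - t / G * (G - 1))\<^sup>2)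
      = 1/2 * (ln G - (G - 1) / G + (G - 1) * (t / G)\<^sup>2)" for t
      using G(1) by (simp add: field_simps power2_eq_square)
    then show "ln (1 + g j) / 2 + (s j)\<^sup>2 / (2 * (1 + g j)) - 1/2 * (inner (C (a j)) (a j) + (z j - inner (a j) m')\<^sup>2)
       = 1/2 * (ln (1 + g j) - g j / (1 + g j) + g j * (s j / (1 + g j))\<^sup>2)"
      unfolding C m' G_def[symmetric] unfolding G(2) by blast
  qed
  finally have "D_KL \<nu> \<mu> = 1/2 * (\<Sum>j\<in>J. ln (1 + g j) - g j / (1 + g j) + g j * (s j / (1 + g j))\<^sup>2)"
    unfolding D sum_distrib_left .
  moreover have "gaussian m' C = \<nu>" by (rule gaussian_eqI[OF sep \<nu> lin])
  moreover have "gaussian m K = \<mu>" by (rule gaussian_eqI[OF sep \<mu> K])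
  ultimately show ?thesis by (simp add: m'_def C_def[abs_def])
qed

section \<open>Translation of the matrix formulas into the diagonalising basis\<close>

lemma linear_adjoint_hilbert:
  fixes A :: "'a::real_inner \<Rightarrow> 'b::real_inner"
  assumes "\<And>x y. inner (A x) y = inner x (adjoint A y)"
  shows "linear (adjoint A)"
proof (rule linearI)
  show "adjoint A (x + y) = adjoint A x + adjoint A y" for x y
    by (rule vector_eq_rdot[THEN iffD1]) (metis assms inner_add_right inner_commute)
  show "adjoint A (c *\<^sub>R x) = c *\<^sub>R adjoint A x" for c x
    by (rule vector_eq_rdot[THEN iffD1]) (metis assms inner_scaleR_right inner_commute)
qed

theorem theorem4:
  fixes C0 :: "'a::{real_inner, complete_space} \<Rightarrow> 'a"
    and m0 :: 'a
    and A :: "'a \<Rightarrow> real^'n"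
    and \<Gamma> :: "real^'n^'n"
    and y :: "real^'n"
  assumes sep: "separable_space (euclidean :: 'a topology)"
    and infdim: "\<not> (\<exists>S::'a set. finite S \<and> span S = UNIV)"
    and C0_pos: "positive_op C0"
    and C0_tr: "trace_class C0"
    and C0_ker: "\<forall>x. C0 x = 0 \<longrightarrow> x = 0"
    and m0_img: "m0 \<in> range (op_sqrt C0)"
    and A_bl: "bounded_linear A"
    and \<Gamma>_sym: "transpose \<Gamma> = \<Gamma>"
    and \<Gamma>_pd: "\<forall>v. v \<noteq> 0 \<longrightarrow> 0 < v \<bullet> (\<Gamma> *v v)"
  defines "M \<equiv> \<Gamma> + matrix (A \<circ> C0 \<circ> adjoint A)"
    and "m \<equiv> m0 + C0 (adjoint A (matrix_inv (\<Gamma> + matrix (A \<circ> C0 \<circ> adjoint A)) *v (y - A m0)))"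
    and "C \<equiv> (\<lambda>x. C0 x - C0 (adjoint A (matrix_inv (\<Gamma> + matrix (A \<circ> C0 \<circ> adjoint A)) *v A (C0 x))))"
  shows "D_KL (gaussian m C) (gaussian m0 C0) =
           1/2 * (ln (det M) - ln (det \<Gamma>)
                  - trace (matrix (A \<circ> C \<circ> adjoint A) ** matrix_inv \<Gamma>)
                  - inner (m - m0) (adjoint A (matrix_inv \<Gamma> *v (A m - y))))
       \<and> ((\<lambda>\<gamma>. KL_gamma \<gamma> m C m0 C0) \<longlongrightarrow>
           1/2 * (ln (det M) - ln (det \<Gamma>)
                  - trace (matrix (A \<circ> C \<circ> adjoint A) ** matrix_inv \<Gamma>)
                  - inner (m - m0) (adjoint A (matrix_inv \<Gamma> *v (A m - y))))) (at_right 0)"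
proof -
  have onb: "is_onb (onb :: nat \<Rightarrow> 'a)"
    unfolding onb_def by (rule someI_ex[OF onb_exists[OF sep infdim]])
  have ker: "\<And>x. C0 x = 0 \<Longrightarrow> x = 0" using C0_ker by blast
  note lC0 = positive_op_linear[OF C0_pos] and symC0 = positive_op_sym[OF C0_pos]
  have lA: "linear A" using A_bl by (rule bounded_linear.linear)
  have adj: "inner (A x) v = inner x (adjoint A v)" for x v by (rule adjoint_hilbert[OF onb A_bl])
  have lA': "linear (adjoint A)" by (rule linear_adjoint_hilbert[OF adj])
  define G where "G = matrix (A \<circ> C0 \<circ> adjoint A)"
  have G: "G *v v = A (C0 (adjoint A v))" for v
    unfolding G_def by (subst matrix_works, subst linear_matrix_vector_mul_eq) (auto intro!: linear_compose lA' lC0 lA)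
  have Gsym: "transpose G = G"
  proof -
    have "inner (transpose G *v v) w = inner (G *v v) w" for v w
    proof -
      have "inner (transpose G *v v) w = inner v (G *v w)"
        by (simp only: transpose_matrix_vector dot_lmul_matrix)
      also have "\<dots> = inner (C0 (adjoint A w)) (adjoint A v)" by (simp add: G inner_commute[of v] adj)
      also have "\<dots> = inner (G *v v) w" unfolding G adj by (subst symC0) (rule inner_commute)
      finally show ?thesis .
    qed
    then have "transpose G *v v = G *v v" for v using vector_eq_rdot by blast
    then show ?thesis by (simp add: matrix_eq)
  qed
  obtain u :: "'n \<Rightarrow> real^'n" and g where u\<Gamma>: "\<And>i j. inner (u i) (\<Gamma> *v u j) = (if i = j then 1 else 0)"
    and uG: "\<And>i j. inner (u i) (G *v u j) = (if i = j then g i else 0)"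
    using simultaneous_diagonalisation[OF \<Gamma>_sym \<Gamma>_pd[rule_format] Gsym] by blast
  define a where "a i = adjoint A (u i)" for i
  have aa: "inner (C0 (a i)) (a j) = (if i = j then g i else 0)" for i j
    using uG[of j i] by (auto simp: G inner_commute[of "u j"] adj a_def)
  have g: "g i \<ge> 0" for i using aa[of i i] positive_op_nonneg[OF C0_pos, of "a i"] by simp
  then have g1: "1 + g i > 0" for i by (simp add: add_pos_nonneg)
  have M: "M = \<Gamma> + G" by (simp add: M_def G_def)
  have uM: "inner (u i) (M *v u j) = (if i = j then 1 + g i else 0)" for i j
    by (simp add: M matrix_vector_mult_add_rdistrib inner_add_right u\<Gamma> uG)
  have Minv: "matrix_inv M *v v = (\<Sum>i\<in>UNIV. (inner (u i) v / (1 + g i)) *\<^sub>R u i)" for v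
    by (rule diag_congruence_inverse[OF uM]) (metis g1 less_irrefl)
  have \<Gamma>inv: "matrix_inv \<Gamma> *v v = (\<Sum>i\<in>UNIV. inner (u i) v *\<^sub>R u i)" for v
    using diag_congruence_inverse[OF u\<Gamma>] by simp
  have uA: "inner (u i) (A x) = inner (a i) x" for i x
    by (simp add: a_def inner_commute[of "u i"] adj inner_commute[of x])
  define z where "z i = inner (u i) y" for i
  define s where "s i = z i - inner (a i) m0" for i
  have C0sum: "C0 (adjoint A (\<Sum>i\<in>UNIV. c i *\<^sub>R u i)) = (\<Sum>i\<in>UNIV. c i *\<^sub>R C0 (a i))" for c
    by (simp add: linear_sum[OF lA'] linear_scale[OF lA'] linear_sum[OF lC0] linear_scale[OF lC0] a_def)
  have m: "m = m0 + (\<Sum>i\<in>UNIV. (s i / (1 + g i)) *\<^sub>R C0 (a i))"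
    unfolding m_def M_def[symmetric] Minv C0sum by (simp add: inner_diff_right uA s_def z_def)
  have C: "C = (\<lambda>x. C0 x - (\<Sum>i\<in>UNIV. (inner (C0 x) (a i) / (1 + g i)) *\<^sub>R C0 (a i)))"
    unfolding C_def M_def[symmetric] Minv C0sum by (simp add: uA inner_commute)
  have lC: "linear C"
    unfolding C
    by (intro linear_compose_sub lC0 linear_compose_sum ballI linearI)
      (auto simp: linear_add[OF lC0] linear_scale[OF lC0] inner_add_left add_divide_distrib scaleR_add_left)

  let ?rhs = "1/2 * (ln (det M) - ln (det \<Gamma>)
      - trace (matrix (A \<circ> C \<circ> adjoint A) ** matrix_inv \<Gamma>)
      - inner (m - m0) (adjoint A (matrix_inv \<Gamma> *v (A m - y))))"
  let ?val = "1/2 * (\<Sum>i\<in>UNIV. ln (1 + g i) - g i / (1 + g i) + g i * (s i / (1 + g i))\<^sup>2)"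
  \<comment> \<open>Only the \<open>i\<close>-th summand of the mean shift is seen by
    \<open>a i\<close>, again by \<open>C0\<close>-orthogonality.\<close>
  have am: "inner (a i) (m - m0) = s i / (1 + g i) * g i" for i
  proof -
    have "inner (a i) (C0 (a j)) = (if j = i then g i else 0)" for j
      using aa[of i j] by (auto simp: symC0)
    then have "inner (a i) (m - m0) = (\<Sum>j\<in>UNIV. if j = i then s i / (1 + g i) * g i else 0)"
      unfolding m add_diff_cancel_left' inner_sum_right by (intro sum.cong refl) simp
    then show ?thesis by simp
  qed
  have rhs: "?rhs = ?val"
  proof -
    have "trace (matrix (A \<circ> C \<circ> adjoint A) ** matrix_inv \<Gamma>)
        = (\<Sum>i\<in>UNIV. inner (u i) (matrix (A \<circ> C \<circ> adjoint A) *v u i))"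
      by (rule diag_congruence_trace[OF u\<Gamma>])
    also have "\<dots> = (\<Sum>i\<in>UNIV. inner (a i) (C (a i)))"
    proof (rule sum.cong[OF refl])
      fix i
      have "matrix (A \<circ> C \<circ> adjoint A) *v u i = A (C (a i))"
        by (subst matrix_works, subst linear_matrix_vector_mul_eq) (auto intro!: linear_compose lA' lC lA simp: a_def)
      then show "inner (u i) (matrix (A \<circ> C \<circ> adjoint A) *v u i) = inner (a i) (C (a i))" by (simp add: uA)
    qed
    also have "\<dots> = (\<Sum>i\<in>UNIV. g i / (1 + g i))"
    proof (rule sum.cong[OF refl])
      fix i
      have "inner (a i) (\<Sum>j\<in>UNIV. (inner (C0 (a i)) (a j) / (1 + g j)) *\<^sub>R C0 (a j))
          = (\<Sum>j\<in>UNIV. if j = i then g i * g i / (1 + g i) else 0)"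
        unfolding inner_sum_right by (intro sum.cong refl) (auto simp: aa inner_commute[of "a _"])
      then have "inner (a i) (C (a i)) = g i - g i * g i / (1 + g i)"
        by (simp add: C inner_diff_right aa inner_commute[of "a i" "C0 _"])
      also have "\<dots> = g i / (1 + g i)" using g1[of i] by (simp add: field_simps)
      finally show "inner (a i) (C (a i)) = g i / (1 + g i)" .
    qed
    finally have tr: "trace (matrix (A \<circ> C \<circ> adjoint A) ** matrix_inv \<Gamma>) = (\<Sum>i\<in>UNIV. g i / (1 + g i))" .
    have "inner (m - m0) (adjoint A (matrix_inv \<Gamma> *v (A m - y)))
        = (\<Sum>i\<in>UNIV. inner (u i) (A m - y) * inner (u i) (A (m - m0)))"
      unfolding adj[symmetric] \<Gamma>inv by (simp add: inner_sum_right inner_commute)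
    also have "\<dots> = (\<Sum>i\<in>UNIV. - (g i * (s i / (1 + g i))\<^sup>2))"
    proof (rule sum.cong[OF refl])
      fix i
      \<comment> \<open>The posterior residual is the prior residual \<open>s i\<close> shrunk by
        \<open>1 + g i\<close>, with opposite sign; its product with the shift gives the last term
        of \<open>?val\<close>.\<close>
      have "inner (u i) (A m - y) = inner (a i) (m - m0) - s i"
        by (simp add: inner_diff_right uA s_def z_def)
      also have "\<dots> = - (s i / (1 + g i))" using g1[of i] by (simp add: am field_simps)
      finally show "inner (u i) (A m - y) * inner (u i) (A (m - m0)) = - (g i * (s i / (1 + g i))\<^sup>2)"
        by (simp add: uA am power2_eq_square)
    qed
    finally have q: "inner (m - m0) (adjoint A (matrix_inv \<Gamma> *v (A m - y)))
        = (\<Sum>i\<in>UNIV. - (g i * (s i / (1 + g i))\<^sup>2))" .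
    show ?thesis
      unfolding tr q diag_congruence_log_det[OF u\<Gamma> uM g1]
      by (simp add: sum.distrib sum_subtractf sum_negf)
  qed

  have "summable (\<lambda>k. inner (C0 (onb k)) (onb k))"
    using C0_tr by (simp add: trace_class_def op_abs_positive[OF C0_pos])
  then obtain \<mu> where \<mu>: "has_gaussian_char \<mu> m0 C0"
    using gaussian_exists[OF sep onb C0_pos ker] by blast
  have orth: "inner (C0 (a i)) (a j) = 0" if "i \<noteq> j" for i j using that by (simp add: aa)
  have "D_KL (gaussian m C) (gaussian m0 C0) = ?val"
    using D_KL_gaussian_orthogonal_updates[OF sep \<mu> lC0 symC0 finite[of "UNIV :: 'n set"] orth, where z=z]
    by (simp add: aa m C s_def)
  moreover have "((\<lambda>\<gamma>. KL_gamma \<gamma> m C m0 C0) \<longlongrightarrow> ?val) (at_right 0)"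
  proof -
    \<comment> \<open>\<open>fin_det\<close> is indexed by an initial segment of the naturals,
      whereas the data coordinates form the type \<open>'n\<close>; \<phi> enumerates that
      type.\<close>
    obtain \<phi> where \<phi>: "bij_betw \<phi> {..<CARD('n)} (UNIV :: 'n set)"
      using ex_bij_betw_nat_finite[of "UNIV :: 'n set"] by (auto simp: atLeast0LessThan)
    have re: "(\<Sum>i\<in>UNIV. f i) = (\<Sum>k<CARD('n). f (\<phi> k))" for f :: "'n \<Rightarrow> 'b::comm_monoid_add"
      by (rule sum.reindex_bij_betw[OF \<phi>, symmetric])
    have "inner (C0 (a (\<phi> k))) (a (\<phi> l)) = (if k = l then g (\<phi> k) else 0)" if "k < CARD('n)" "l < CARD('n)" for k l
      using that bij_betw_imp_inj_on[OF \<phi>] by (auto simp: aa inj_on_def)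
    from KL_gamma_tendsto[OF onb C0_pos this g, where m=m0 and s="\<lambda>k. s (\<phi> k)"]
    show ?thesis unfolding m C re .
  qed
  ultimately show ?thesis by (simp only: rhs simp_thms)
qed

end
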